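(* Let $X\subseteq\mathbb{P}^{n+1}$ be the (possibly singular) hypersurface over $\mathbb{C}$ defined by an irreducible homogeneous polynomial $g\in\mathbb{C}[x_0,\dots,x_{n+1}]$ of degree $d$. Let $(\alpha_1,\dots,\alpha_d)$ be a linear matrix factorization of $g$ of size $m$. For each $i$ let $G_i$ be the cokernel of the map given by $\alpha_i$, i.e. the sheaf defined by the short exact sequence $$0\to\mathcal{O}_{\mathbb{P}^{n+1}}(-1)^{\oplus m}\xrightarrow{\ \alpha_i\ }\mathcal{O}_{\mathbb{P}^{n+1}}^{\oplus m}\to G_i\to 0,$$ which is supported on $X$. Let $\pi: X\to\mathbb{P}^n$ be a finite covering of degree $d$ defined by a linear projection. Then each $\pi_*G_i$ is a trivial vector bundle of rank $m$, i.e. $\pi_*G_i\cong\mathcal{O}_{\mathbb{P}^n}^{\oplus m}$.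
   Context: A homogeneous polynomial $g$ of degree $d$ has a (linear) matrix factorization $(\alpha_1,\dots,\alpha_d)$ of size $m$ if the $\alpha_i$ are $m\times m$ matrices whose entries are linear homogeneous polynomials and $\alpha_1\cdot\alpha_2\cdots\alpha_d=g\cdot\operatorname{id}_{m\times m}$. A finite covering $X\to\mathbb{P}^n$ defined by a linear projection is the restriction to $X$ of the projection $\mathbb{P}^{n+1}\dashrightarrow\mathbb{P}^n$ from a point $Q\in\mathbb{P}^{n+1}\setminus X$. The sheaf $G_i$ is regarded as a coherent sheaf on $X$. *)

theory Defs
  imports
    "HOL-Analysis.Analysis"
    "HOL-Library.Poly_Mapping"
    "HOL-Computational_Algebra.Factorial_Ring"
    "HOL-Algebra.Module"
begin

section \<open>Polynomials and linear matrix factorizations\<close>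

text \<open>The polynomial ring over the complex numbers in the variables \<open>x\<^sub>i\<close>, \<open>i :: 'v\<close>,
  for a finite type \<open>'v\<close>; the ring structure is the one of \<^theory>\<open>HOL-Library.Poly_Mapping\<close>.\<close>

type_synonym 'v cpoly = "('v \<Rightarrow>\<^sub>0 nat) \<Rightarrow>\<^sub>0 complex"

definition peval :: "('v::finite) cpoly \<Rightarrow> complex^'v \<Rightarrow> complex" where
  "peval f x = (\<Sum>m\<in>Poly_Mapping.keys f. Poly_Mapping.lookup f m * (\<Prod>i\<in>UNIV. x $ i ^ Poly_Mapping.lookup m i))"

text \<open>As usual, the zero polynomial is homogeneous of every degree.\<close>

definition homogeneous :: "nat \<Rightarrow> ('v::finite) cpoly \<Rightarrow> bool" where
  "homogeneous k f \<longleftrightarrow> (\<forall>m\<in>Poly_Mapping.keys f. (\<Sum>i\<in>UNIV. Poly_Mapping.lookup m i) = k)"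

definition linear_matrix_factorization ::
    "('v::finite) cpoly \<Rightarrow> nat \<Rightarrow> (('v cpoly)^'m^'m) list \<Rightarrow> bool" where
  "linear_matrix_factorization g d \<alpha>s \<longleftrightarrow>
     length \<alpha>s = d \<and>
     (\<forall>\<alpha>\<in>set \<alpha>s. \<forall>i j. homogeneous 1 (\<alpha> $ i $ j)) \<and>
     foldr (**) \<alpha>s (mat 1) = mat g"


section \<open>Projective space with its Zariski topology\<close>

definition proj_rel :: "complex^('v::finite) \<Rightarrow> complex^'v \<Rightarrow> bool" where
  "proj_rel x y \<longleftrightarrow> x \<noteq> 0 \<and> y \<noteq> 0 \<and> (\<exists>c. y = c *s x)"

lemma part_equivp_proj_rel: "part_equivp (proj_rel :: complex^('v::finite) \<Rightarrow> _)"
proof (rule part_equivpI)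
  show "\<exists>x. proj_rel x (x :: complex^'v)"
    by (rule exI[of _ 1]) (auto simp: proj_rel_def vec_eq_iff intro: exI[of _ 1])
  show "symp (proj_rel :: complex^'v \<Rightarrow> _)"
  proof (rule sympI)
    fix x y :: "complex^'v" assume "proj_rel x y"
    then obtain c where c: "x \<noteq> 0" "y \<noteq> 0" "y = c *s x" by (auto simp: proj_rel_def)
    then have "c \<noteq> 0" by auto
    then have "x = inverse c *s y" unfolding \<open>y = c *s x\<close> vector_smult_assoc by simp
    then show "proj_rel y x" using c(1,2) unfolding proj_rel_def by blast
  qed
  show "transp (proj_rel :: complex^'v \<Rightarrow> _)"
    by (rule transpI) (auto simp: proj_rel_def vector_smult_assoc)
qed

text \<open>The projective space of lines in the vector space \<open>complex^'v\<close>; its dimension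
  is \<open>CARD('v) - 1\<close>. For \<open>x \<noteq> 0\<close>, \<open>abs_proj x\<close> is the point with homogeneous
  coordinates \<open>x\<close>.\<close>

quotient_type 'v proj = "complex^('v::finite)" / partial: "proj_rel"
  by (rule part_equivp_proj_rel)

definition cone_over :: "('v::finite) proj set \<Rightarrow> (complex^'v) set" where
  "cone_over W = {x. x \<noteq> 0 \<and> abs_proj x \<in> W}"

definition nonvanishing :: "('v::finite) cpoly set \<Rightarrow> 'v proj set" where
  "nonvanishing F = abs_proj ` {x. x \<noteq> 0 \<and> (\<exists>f\<in>F. peval f x \<noteq> 0)}"

definition zariski :: "('v::finite) proj topology" where
  "zariski = topology (\<lambda>U. \<exists>F. (\<forall>f\<in>F. \<exists>k. homogeneous k f) \<and> U = nonvanishing F)"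

definition hypersurface :: "('v::finite) cpoly \<Rightarrow> 'v proj set" where
  "hypersurface g = abs_proj ` {x. x \<noteq> 0 \<and> peval g x = 0}"


section \<open>Sheaves of modules on ringed spaces\<close>

record ('p, 'r) ringed_space =
  topo :: "'p topology"
  rsec :: "'p set \<Rightarrow> 'r ring"
  rres :: "'p set \<Rightarrow> 'p set \<Rightarrow> 'r \<Rightarrow> 'r"

text \<open>\<open>res F U V\<close> is the restriction map from the sections over \<open>U\<close> to those over
  \<open>V \<subseteq> U\<close>. Only the additive structure and the scalar multiplication of the
  records \<open>sec F U\<close> are relevant.\<close>

record ('p, 'r, 'a) mod_presheaf =
  sec :: "'p set \<Rightarrow> ('r, 'a) module"
  res :: "'p set \<Rightarrow> 'p set \<Rightarrow> 'a \<Rightarrow> 'a"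

locale sheaf_of_modules =
  fixes S :: "('p, 'r) ringed_space" and F :: "('p, 'r, 'a) mod_presheaf"
  assumes is_module: "openin (topo S) U \<Longrightarrow> Module.module (rsec S U) (sec F U)"
    and res_closed: "\<lbrakk>openin (topo S) U; openin (topo S) V; V \<subseteq> U; s \<in> carrier (sec F U)\<rbrakk>
      \<Longrightarrow> res F U V s \<in> carrier (sec F V)"
    and res_add: "\<lbrakk>openin (topo S) U; openin (topo S) V; V \<subseteq> U;
        s \<in> carrier (sec F U); t \<in> carrier (sec F U)\<rbrakk>
      \<Longrightarrow> res F U V (s \<oplus>\<^bsub>sec F U\<^esub> t) = res F U V s \<oplus>\<^bsub>sec F V\<^esub> res F U V t"
    and res_smult: "\<lbrakk>openin (topo S) U; openin (topo S) V; V \<subseteq> U;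
        r \<in> carrier (rsec S U); s \<in> carrier (sec F U)\<rbrakk>
      \<Longrightarrow> res F U V (r \<odot>\<^bsub>sec F U\<^esub> s) = rres S U V r \<odot>\<^bsub>sec F V\<^esub> res F U V s"
    and res_id: "\<lbrakk>openin (topo S) U; s \<in> carrier (sec F U)\<rbrakk> \<Longrightarrow> res F U U s = s"
    and res_comp: "\<lbrakk>openin (topo S) U; openin (topo S) V; openin (topo S) W; W \<subseteq> V; V \<subseteq> U;
        s \<in> carrier (sec F U)\<rbrakk> \<Longrightarrow> res F V W (res F U V s) = res F U W s"
    and separated: "\<lbrakk>\<And>V. V \<in> \<U> \<Longrightarrow> openin (topo S) V;
        s \<in> carrier (sec F (\<Union>\<U>)); t \<in> carrier (sec F (\<Union>\<U>));
        \<And>V. V \<in> \<U> \<Longrightarrow> res F (\<Union>\<U>) V s = res F (\<Union>\<U>) V t\<rbrakk> \<Longrightarrow> s = t"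
    and gluing: "\<lbrakk>\<And>V. V \<in> \<U> \<Longrightarrow> openin (topo S) V;
        \<And>V. V \<in> \<U> \<Longrightarrow> c V \<in> carrier (sec F V);
        \<And>V W. V \<in> \<U> \<Longrightarrow> W \<in> \<U> \<Longrightarrow> res F V (V \<inter> W) (c V) = res F W (V \<inter> W) (c W)\<rbrakk>
      \<Longrightarrow> \<exists>s\<in>carrier (sec F (\<Union>\<U>)). \<forall>V\<in>\<U>. res F (\<Union>\<U>) V s = c V"

definition sheaf_hom ::
    "('p, 'r) ringed_space \<Rightarrow> ('p, 'r, 'a) mod_presheaf \<Rightarrow> ('p, 'r, 'b) mod_presheaf
      \<Rightarrow> ('p set \<Rightarrow> 'a \<Rightarrow> 'b) \<Rightarrow> bool" where
  "sheaf_hom S F G \<phi> \<longleftrightarrow>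
     (\<forall>U. openin (topo S) U \<longrightarrow>
        (\<forall>s\<in>carrier (sec F U). \<phi> U s \<in> carrier (sec G U)) \<and>
        (\<forall>s\<in>carrier (sec F U). \<forall>t\<in>carrier (sec F U).
           \<phi> U (s \<oplus>\<^bsub>sec F U\<^esub> t) = \<phi> U s \<oplus>\<^bsub>sec G U\<^esub> \<phi> U t) \<and>
        (\<forall>r\<in>carrier (rsec S U). \<forall>s\<in>carrier (sec F U).
           \<phi> U (r \<odot>\<^bsub>sec F U\<^esub> s) = r \<odot>\<^bsub>sec G U\<^esub> \<phi> U s) \<and>
        (\<forall>V. openin (topo S) V \<and> V \<subseteq> U \<longrightarrow>
           (\<forall>s\<in>carrier (sec F U). \<phi> V (res F U V s) = res G U V (\<phi> U s))))"

definition sheaf_isomorphic ::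
    "('p, 'r) ringed_space \<Rightarrow> ('p, 'r, 'a) mod_presheaf \<Rightarrow> ('p, 'r, 'b) mod_presheaf \<Rightarrow> bool"
  where
  "sheaf_isomorphic S F G \<longleftrightarrow>
     (\<exists>\<phi>. sheaf_hom S F G \<phi> \<and>
        (\<forall>U. openin (topo S) U \<longrightarrow> bij_betw (\<phi> U) (carrier (sec F U)) (carrier (sec G U))))"

text \<open>Exactness of \<open>0 \<rightarrow> F \<rightarrow> G \<rightarrow> H \<rightarrow> 0\<close> as a sequence of sheaves: images are
  taken locally.\<close>

definition short_exact ::
    "('p, 'r) ringed_space \<Rightarrow> ('p, 'r, 'a) mod_presheaf \<Rightarrow> ('p, 'r, 'b) mod_presheaf
      \<Rightarrow> ('p, 'r, 'c) mod_presheaf \<Rightarrow> ('p set \<Rightarrow> 'a \<Rightarrow> 'b) \<Rightarrow> ('p set \<Rightarrow> 'b \<Rightarrow> 'c) \<Rightarrow> bool"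
  where
  "short_exact S F G H \<phi> \<psi> \<longleftrightarrow>
     sheaf_hom S F G \<phi> \<and> sheaf_hom S G H \<psi> \<and>
     (\<forall>U. openin (topo S) U \<longrightarrow> inj_on (\<phi> U) (carrier (sec F U))) \<and>
     (\<forall>U. openin (topo S) U \<longrightarrow> (\<forall>s\<in>carrier (sec G U).
        \<psi> U s = \<zero>\<^bsub>sec H U\<^esub> \<longleftrightarrow>
        (\<forall>p\<in>U. \<exists>V. openin (topo S) V \<and> p \<in> V \<and> V \<subseteq> U \<and>
           res G U V s \<in> \<phi> V ` carrier (sec F V)))) \<and>
     (\<forall>U. openin (topo S) U \<longrightarrow> (\<forall>t\<in>carrier (sec H U). \<forall>p\<in>U.
        \<exists>V. openin (topo S) V \<and> p \<in> V \<and> V \<subseteq> U \<and>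
          res H U V t \<in> \<psi> V ` carrier (sec G V)))"

text \<open>The direct sum of copies of \<open>F\<close>, indexed by the finite type \<open>'m\<close>.\<close>

definition sheaf_power ::
    "('p, 'r, 'a) mod_presheaf \<Rightarrow> ('p, 'r, 'a^('m::finite)) mod_presheaf" where
  "sheaf_power F = \<lparr>
     sec = (\<lambda>U. \<lparr>
       carrier = {s. \<forall>i. s $ i \<in> carrier (sec F U)},
       monoid.mult = undefined, one = undefined,
       zero = (\<chi> i. \<zero>\<^bsub>sec F U\<^esub>),
       add = (\<lambda>s t. \<chi> i. s $ i \<oplus>\<^bsub>sec F U\<^esub> t $ i),
       smult = (\<lambda>r s. \<chi> i. r \<odot>\<^bsub>sec F U\<^esub> s $ i)\<rparr>),
     res = (\<lambda>U V s. \<chi> i. res F U V (s $ i))\<rparr>"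

text \<open>Direct image along a morphism of ringed spaces with domain \<open>S\<close>, given by the map
  \<open>f\<close> on points and the ring homomorphisms \<open>\<kappa> U\<close> from the sections over \<open>U\<close> of the
  target to the sections over the preimage of \<open>U\<close> in \<open>S\<close>.\<close>

definition preim :: "('p, 'r) ringed_space \<Rightarrow> ('p \<Rightarrow> 'q) \<Rightarrow> 'q set \<Rightarrow> 'p set" where
  "preim S f U = {p \<in> topspace (topo S). f p \<in> U}"

definition pushforward ::
    "('p, 'r) ringed_space \<Rightarrow> ('p \<Rightarrow> 'q) \<Rightarrow> ('q set \<Rightarrow> 's \<Rightarrow> 'r)
      \<Rightarrow> ('p, 'r, 'a) mod_presheaf \<Rightarrow> ('q, 's, 'a) mod_presheaf" where
  "pushforward S f \<kappa> F = \<lparr>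
     sec = (\<lambda>U. let M = sec F (preim S f U) in \<lparr>
       carrier = carrier M,
       monoid.mult = undefined, one = undefined,
       zero = \<zero>\<^bsub>M\<^esub>,
       add = add M,
       smult = (\<lambda>r s. \<kappa> U r \<odot>\<^bsub>M\<^esub> s)\<rparr>),
     res = (\<lambda>U V. res F (preim S f U) (preim S f V))\<rparr>"


section \<open>Projective varieties, twisting sheaves and linear projections\<close>

text \<open>The sections of \<open>\<O>(k)\<close> over an open subset \<open>U\<close> of \<open>X\<close>: functions on the cone over
  \<open>U\<close> that locally on \<open>U\<close> are quotients of homogeneous polynomials whose degrees differ
  by \<open>k\<close>. For \<open>k = 0\<close> these functions are constant on lines, i.e. they are the regular
  functions on \<open>U\<close>. The value \<open>0\<close> outside the cone is a convention that makes equality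
  of sections equality of functions.\<close>

definition twist_sections ::
    "('v::finite) proj set \<Rightarrow> int \<Rightarrow> 'v proj set \<Rightarrow> (complex^'v \<Rightarrow> complex) set" where
  "twist_sections X k U = {s.
     (\<forall>x. x \<notin> cone_over U \<longrightarrow> s x = 0) \<and>
     (\<forall>p\<in>U. \<exists>V a b f h.
        openin (subtopology zariski X) V \<and> p \<in> V \<and> V \<subseteq> U \<and>
        homogeneous a f \<and> homogeneous b h \<and> int a - int b = k \<and>
        (\<forall>x\<in>cone_over V. peval h x \<noteq> 0 \<and> s x = peval f x / peval h x))}"

definition restrict_cone ::
    "('v::finite) proj set \<Rightarrow> (complex^'v \<Rightarrow> complex) \<Rightarrow> complex^'v \<Rightarrow> complex" where
  "restrict_cone V s = (\<lambda>x. if x \<in> cone_over V then s x else 0)"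

text \<open>A projective variety \<open>X\<close> (a Zariski closed set of points) with its sheaf of regular
  functions. \<open>variety UNIV\<close> is projective space itself.\<close>

definition variety ::
    "('v::finite) proj set \<Rightarrow> ('v proj, complex^'v \<Rightarrow> complex) ringed_space" where
  "variety X = \<lparr>
     topo = subtopology zariski X,
     rsec = (\<lambda>U. \<lparr>
       carrier = twist_sections X 0 U,
       monoid.mult = (\<lambda>r s x. r x * s x), one = restrict_cone U (\<lambda>_. 1),
       zero = (\<lambda>_. 0), add = (\<lambda>r s x. r x + s x)\<rparr>),
     rres = (\<lambda>U V. restrict_cone V)\<rparr>"

definition twist ::
    "('v::finite) proj set \<Rightarrow> int
      \<Rightarrow> ('v proj, complex^'v \<Rightarrow> complex, complex^'v \<Rightarrow> complex) mod_presheaf" where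
  "twist X k = \<lparr>
     sec = (\<lambda>U. \<lparr>
       carrier = twist_sections X k U,
       monoid.mult = undefined, one = undefined,
       zero = (\<lambda>_. 0), add = (\<lambda>s t x. s x + t x),
       smult = (\<lambda>r s x. r x * s x)\<rparr>),
     res = (\<lambda>U V. restrict_cone V)\<rparr>"

text \<open>The map from the \<open>m\<close>-fold direct sum of \<open>\<O>(k)\<close> to that of \<open>\<O>(k + 1)\<close> given by a
  matrix of linear forms.\<close>

definition matrix_hom ::
    "('v::finite) cpoly^'m^'m \<Rightarrow> 'v proj set
      \<Rightarrow> (complex^'v \<Rightarrow> complex)^'m \<Rightarrow> (complex^'v \<Rightarrow> complex)^('m::finite)" where
  "matrix_hom \<alpha> U s = (\<chi> i. (\<lambda>x. \<Sum>j\<in>UNIV. peval (\<alpha> $ i $ j) x * (s $ j) x))"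

text \<open>Direct image along the inclusion of \<open>X\<close> into projective space.\<close>

definition inclusion_pushforward ::
    "('v::finite) proj set \<Rightarrow> ('v proj, complex^'v \<Rightarrow> complex, 'a) mod_presheaf
      \<Rightarrow> ('v proj, complex^'v \<Rightarrow> complex, 'a) mod_presheaf" where
  "inclusion_pushforward X = pushforward (variety X) (\<lambda>p. p) (\<lambda>U. restrict_cone (X \<inter> U))"

text \<open>The projection from the point \<open>Q\<close>, given in homogeneous coordinates by a surjective
  linear map \<open>A\<close> with kernel the line \<open>Q\<close>.\<close>

definition linear_projection ::
    "('v::finite) proj \<Rightarrow> complex^'v^('w::finite) \<Rightarrow> bool" where
  "linear_projection Q A \<longleftrightarrow>
     surj (\<lambda>x. A *v x) \<and> (\<forall>x. x \<noteq> 0 \<longrightarrow> (A *v x = 0 \<longleftrightarrow> abs_proj x = Q))"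

text \<open>Only meaningful at points other than \<open>Q\<close>.\<close>

definition proj_map :: "complex^'v^'w \<Rightarrow> ('v::finite) proj \<Rightarrow> ('w::finite) proj" where
  "proj_map A p = abs_proj (A *v rep_proj p)"

text \<open>Direct image along the morphism from \<open>X\<close> to the target of the projection \<open>A\<close>;
  regular functions are pulled back by composition with \<open>A\<close>.\<close>

definition projection_pushforward ::
    "complex^'v^'w \<Rightarrow> ('v::finite) proj set
      \<Rightarrow> ('v proj, complex^'v \<Rightarrow> complex, 'a) mod_presheaf
      \<Rightarrow> (('w::finite) proj, complex^'w \<Rightarrow> complex, 'a) mod_presheaf" where
  "projection_pushforward A X =
     pushforward (variety X) (proj_map A)
       (\<lambda>U r. restrict_cone (preim (variety X) (proj_map A) U) (\<lambda>x. r (A *v x)))"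

end

(* Choose coordinates x = B (A x) + \<tau> x q, where q represents the centre Q, so that the fibres of the
   projection are lines with coordinate \<tau>. The product of the factors at q is g(q) \<noteq> 0, so each factor
   has the form \<alpha> = M (\<tau> - T) with M invertible and T a matrix of linear forms in y = A x. Thus the
   cokernel of \<alpha> looks like the trivial module of rank m over the base, with \<tau> acting as T, and we
   show that s \<mapsto> [s o A] is an isomorphism from the trivial bundle to the direct image.

   Injectivity: if s(y) = (t - T(y)) u(t) with u regular near every t, then s(y) = 0, since near an
   eigenvalue of T(y) such a u is unbounded.

   Surjectivity: a section of the cokernel is locally of the form [f / k]. Two such representations
   satisfy (k k')^m (k' f - k f') \<in> Im \<alpha> as polynomials, because on each fibre the pole orders along the
   spectrum of T(y) are at most m. After replacing (f, k) by (k^m f, k^(m+1)) these relations are linear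
   in (f, k), so a generic linear combination of finitely many pairs provides one whose denominator does
   not vanish on the spectrum of T(y) for a given y. Substituting T for \<tau> then makes the denominator an
   invertible matrix k(T) near y, and s = M k(T)^(-1) (M^(-1) f)(T) is the required preimage. *)

theory Submission
  imports Defs "HOL-Computational_Algebra.Fundamental_Theorem_Algebra"
begin

section \<open>Homogeneous polynomial functions\<close>

text \<open>The obstacle is that exactness gives lifts only locally on the source, whereas a section
  of the direct image lives near a whole fibre, hence near all eigenvalues of \<open>T y\<close> at
  once. A fibre may have repeated points, so \<open>T y\<close> need not be diagonalizable and no
  eigenspace decomposition is available; everything is phrased through polynomials in
  \<open>T y\<close> applied to vectors. The exponent m has a single origin: the m + 1 vectors z, T
  z, ..., T^m z are dependent, so every vector has an annihilator of degree at most m, whatever y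
  is. This uniform bound allows one relation to hold for all y simultaneously. Passing to (k^m f,
  k^(m+1)) pays the power of k in advance; the power that remains belongs to k' alone, and this is
  what makes the condition on (f, k) linear. The isomorphism is built from the base to the direct
  image and inverted at the end. Surjectivity is first local on the base, and the pieces glue
  because injectivity is already known over every open set.\<close>

inductive hpoly :: "nat \<Rightarrow> (complex^'v::finite \<Rightarrow> complex) \<Rightarrow> bool" where
  hpoly_zero: "hpoly k (\<lambda>x. 0)"
| hpoly_const: "hpoly 0 (\<lambda>x. c)"
| hpoly_coord: "hpoly k f \<Longrightarrow> hpoly (Suc k) (\<lambda>x. x $ i * f x)"
| hpoly_add: "hpoly k f \<Longrightarrow> hpoly k g \<Longrightarrow> hpoly k (\<lambda>x. f x + g x)"

lemma hpoly_cmult: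
  assumes "hpoly k f"
  shows "hpoly k (\<lambda>x. c * f x)"
  using assms
proof induction
  case (hpoly_coord k f i)
  have "(\<lambda>x. c * (x $ i * f x)) = (\<lambda>x. x $ i * (c * f x))" by (auto simp: algebra_simps)
  then show ?case using hpoly.hpoly_coord[OF hpoly_coord.IH, of i] by simp
qed (auto simp: algebra_simps intro: hpoly.intros)

lemma hpoly_uminus: "hpoly k f \<Longrightarrow> hpoly k (\<lambda>x. - f x)"
  using hpoly_cmult[of k f "-1"] by simp

lemma hpoly_diff: "hpoly k f \<Longrightarrow> hpoly k g \<Longrightarrow> hpoly k (\<lambda>x. f x - g x)"
  using hpoly_add[OF _ hpoly_uminus, of k f g] by simp

lemma hpoly_mult:
  assumes "hpoly k f" "hpoly l g"
  shows "hpoly (k + l) (\<lambda>x. f x * g x)"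
  using assms
proof induction
  case (hpoly_coord k f i)
  have "(\<lambda>x. x $ i * f x * g x) = (\<lambda>x. x $ i * (f x * g x))" by (auto simp: algebra_simps)
  then show ?case using hpoly.hpoly_coord[OF hpoly_coord.IH, of i] hpoly_coord.prems by simp
qed (auto simp: algebra_simps intro: hpoly.intros hpoly_cmult)

lemma hpoly_mult_degree:
  "hpoly k f \<Longrightarrow> hpoly l g \<Longrightarrow> n = k + l \<Longrightarrow> hpoly n (\<lambda>x. f x * g x)"
  using hpoly_mult by blast

lemma hpoly_sum: "(\<And>i. i \<in> I \<Longrightarrow> hpoly k (f i)) \<Longrightarrow> hpoly k (\<lambda>x. \<Sum>i\<in>I. f i x)"
  by (induction I rule: infinite_finite_induct) (auto intro: hpoly.intros)

lemma hpoly_prod: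
  "finite I \<Longrightarrow> (\<And>i. i \<in> I \<Longrightarrow> hpoly (k i) (f i)) \<Longrightarrow>
    hpoly (\<Sum>i\<in>I. k i) (\<lambda>x. \<Prod>i\<in>I. f i x)"
  by (induction I rule: finite_induct) (auto intro: hpoly.intros hpoly_mult)

lemma hpoly_power: "hpoly k f \<Longrightarrow> hpoly (n * k) (\<lambda>x. f x ^ n)"
  by (induction n) (auto intro: hpoly.intros hpoly_mult)

lemma hpoly_linear_coord: "hpoly 1 (\<lambda>x. x $ i)"
  using hpoly_coord[OF hpoly_const[of 1], of i] by simp

lemma hpoly_matrix_vector: "hpoly 1 (\<lambda>x. ((B :: complex^'v^'w) *v x) $ i)"
  by (simp add: matrix_vector_mult_def) (intro hpoly_sum hpoly_cmult hpoly_linear_coord[unfolded One_nat_def])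

lemma hpoly_compose_linear:
  fixes B :: "complex^'w^'v"
  assumes "hpoly k f"
  shows "hpoly k (\<lambda>y. f (B *v y))"
  using assms
proof induction
  case (hpoly_coord k f i)
  show ?case using hpoly_mult[OF hpoly_matrix_vector[of B i] hpoly_coord.IH] by simp
qed (auto intro: hpoly.intros)

lemma hpoly_scale:
  assumes "hpoly k f"
  shows "f (c *s x) = c ^ k * f x"
  using assms by induction (auto simp: algebra_simps)

lemma hpoly_det:
  fixes M :: "complex^'v \<Rightarrow> complex^'n^'n"
  assumes "\<And>i j. hpoly k (\<lambda>x. M x $ i $ j)"
  shows "hpoly (CARD('n::finite) * k) (\<lambda>x. det (M x))"
  unfolding det_def
proof (intro hpoly_sum hpoly_cmult)
  fix p :: "'n \<Rightarrow> 'n"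
  show "hpoly (CARD('n) * k) (\<lambda>x. \<Prod>i\<in>UNIV. M x $ i $ p i)"
    using hpoly_prod[of UNIV "\<lambda>_. k" "\<lambda>i x. M x $ i $ p i"] assms by simp
qed


section \<open>Formal polynomials and the functions they define\<close>

lemma peval_superset:
  assumes "finite K" "Poly_Mapping.keys f \<subseteq> K"
  shows "peval f x = (\<Sum>m\<in>K. Poly_Mapping.lookup f m * (\<Prod>i\<in>UNIV. x $ i ^ Poly_Mapping.lookup m i))"
  unfolding peval_def
  by (rule sum.mono_neutral_left) (use assms in \<open>auto simp: in_keys_iff\<close>)

lemma peval_zero [simp]: "peval 0 x = 0"
  by (simp add: peval_def)

lemma peval_add: "peval (f + g) x = peval f x + peval g x"
proof -
  let ?K = "Poly_Mapping.keys f \<union> Poly_Mapping.keys g"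
  show ?thesis
    using peval_superset[of ?K f x] peval_superset[of ?K g x] peval_superset[of ?K "f + g" x]
    by (simp add: keys_add lookup_add algebra_simps sum.distrib)
qed

lemma peval_single:
  "peval (Poly_Mapping.single m c) x = c * (\<Prod>i\<in>UNIV. x $ i ^ Poly_Mapping.lookup m i)"
  by (simp add: peval_def)

text \<open>Evaluation is additive, so its multiplicativity only has to be checked on monomials;
  this induction performs that reduction in either factor.\<close>

lemma poly_mapping_add_single_induct [case_names zero add_single]:
  fixes f :: "'a \<Rightarrow>\<^sub>0 'b::comm_monoid_add"
  assumes "P 0" "\<And>f m c. P f \<Longrightarrow> P (Poly_Mapping.single m c + f)"
  shows "P f"
proof (induction f rule: Poly_Mapping.update_induct)
  case (update f a b)
  have "Poly_Mapping.update a b f = Poly_Mapping.single a b + f"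
    by (rule poly_mapping_eqI) (use update in \<open>auto simp: lookup_update lookup_add lookup_single when_def in_keys_iff\<close>)
  then show ?case using update assms by simp
qed (use assms in auto)

lemma peval_mult: "peval (f * g) x = peval f x * peval g x"
proof (induction f rule: poly_mapping_add_single_induct)
  case (add_single f m c)
  have "peval (Poly_Mapping.single m c * g) x = peval (Poly_Mapping.single m c) x * peval g x"
    by (induction g rule: poly_mapping_add_single_induct)
      (simp_all add: distrib_left peval_add mult_single peval_single lookup_add power_add prod.distrib)
  then show ?case using add_single by (simp add: distrib_right peval_add)
qed simp

lemma peval_sum: "peval (\<Sum>i\<in>I. f i) x = (\<Sum>i\<in>I. peval (f i) x)"
  by (induction I rule: infinite_finite_induct) (auto simp: peval_add)

lemma hpoly_peval:
  assumes "homogeneous k f"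
  shows "hpoly k (peval f)"
proof -
  have "hpoly k (\<lambda>x. \<Sum>m\<in>Poly_Mapping.keys f. Poly_Mapping.lookup f m * (\<Prod>i\<in>UNIV. x $ i ^ Poly_Mapping.lookup m i))"
  proof (intro hpoly_sum hpoly_cmult)
    fix m assume "m \<in> Poly_Mapping.keys f"
    then have "(\<Sum>i\<in>UNIV. Poly_Mapping.lookup m i) = k" using assms by (auto simp: homogeneous_def)
    then show "hpoly k (\<lambda>x. \<Prod>i\<in>UNIV. x $ i ^ Poly_Mapping.lookup m i)"
      using hpoly_prod[OF finite_class.finite_UNIV, OF hpoly_power[OF hpoly_linear_coord],
          of "Poly_Mapping.lookup m" "\<lambda>i. i"] by simp
  qed
  then show ?thesis unfolding peval_def[abs_def] .
qed

lemma homogeneous_zero: "homogeneous k 0"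
  by (simp add: homogeneous_def)

lemma homogeneous_add: "homogeneous k f \<Longrightarrow> homogeneous k g \<Longrightarrow> homogeneous k (f + g)"
  using keys_add[of f g] by (auto simp: homogeneous_def)

lemma homogeneous_mult: "homogeneous k f \<Longrightarrow> homogeneous l g \<Longrightarrow> homogeneous (k + l) (f * g)"
  unfolding homogeneous_def
proof
  fix m assume fg: "\<forall>m\<in>Poly_Mapping.keys f. (\<Sum>i\<in>UNIV. Poly_Mapping.lookup m i) = k"
    "\<forall>m\<in>Poly_Mapping.keys g. (\<Sum>i\<in>UNIV. Poly_Mapping.lookup m i) = l"
  assume "m \<in> Poly_Mapping.keys (f * g)"
  then obtain a b where "m = a + b" "a \<in> Poly_Mapping.keys f" "b \<in> Poly_Mapping.keys g"
    using keys_mult[of f g] by blast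
  then show "(\<Sum>i\<in>UNIV. Poly_Mapping.lookup m i) = k + l"
    using fg by (simp add: lookup_add sum.distrib)
qed

lemma homogeneous_const: "homogeneous 0 (Poly_Mapping.single 0 c)"
  by (auto simp: homogeneous_def)

lemma homogeneous_var: "homogeneous 1 (Poly_Mapping.single (Poly_Mapping.single i 1) c)"
  by (auto simp: homogeneous_def lookup_single when_def)

lemma peval_var: "peval (Poly_Mapping.single (Poly_Mapping.single i 1) 1) x = x $ i"
proof -
  have "(\<Prod>j\<in>UNIV. x $ j ^ (if i = j then 1 else 0)) = (\<Prod>j\<in>UNIV. if i = j then x $ j else 1)"
    by (intro prod.cong) auto
  also have "\<dots> = x $ i" by simp
  finally show ?thesis by (simp add: peval_single lookup_single when_def cong: if_cong)
qed

text \<open>Sections of the twisting sheaves are functions on a cone, so polynomials are carried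
  along as functions; a formal representative is recovered here for the places where the topology or
  the sheaves ask for a \<open>cpoly\<close>.\<close>

lemma hpoly_imp_peval:
  assumes "hpoly k f"
  shows "\<exists>F. homogeneous k F \<and> f = peval F"
  using assms
proof induction
  case (hpoly_zero k)
  show ?case by (intro exI[of _ 0]) (auto simp: homogeneous_zero)
next
  case (hpoly_const c)
  show ?case by (intro exI[of _ "Poly_Mapping.single 0 c"]) (auto simp: homogeneous_const peval_single)
next
  case (hpoly_coord k f i)
  then obtain F where "homogeneous k F" "f = peval F" by blast
  then show ?case
    using homogeneous_mult[OF homogeneous_var[of i 1] \<open>homogeneous k F\<close>]
    by (intro exI[of _ "Poly_Mapping.single (Poly_Mapping.single i 1) 1 * F"])
      (auto simp: peval_mult peval_var[unfolded One_nat_def])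
next
  case (hpoly_add k f g)
  then obtain F G where "homogeneous k F" "f = peval F" "homogeneous k G" "g = peval G" by blast
  then show ?case by (intro exI[of _ "F + G"]) (auto simp: homogeneous_add peval_add)
qed

section \<open>The Zariski topology\<close>

lemma abs_proj_eq_iff:
  assumes "x \<noteq> 0" "y \<noteq> 0"
  shows "abs_proj x = abs_proj y \<longleftrightarrow> (\<exists>c. y = c *s x)"
proof -
  have refl: "proj_rel z z" if "z \<noteq> 0" for z :: "complex^'a"
    unfolding proj_rel_def using that by (metis vector_smult_lid)
  show ?thesis
    using Quotient3_rel[OF Quotient3_proj, of x y] refl[OF assms(1)] refl[OF assms(2)] assms
    unfolding proj_rel_def by blast
qed

lemma rep_proj_nonzero: "rep_proj p \<noteq> 0"
  using Quotient3_rep_reflp[OF Quotient3_proj, of p] by (auto simp: proj_rel_def)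

lemma abs_rep_proj [simp]: "abs_proj (rep_proj p) = p"
  using Quotient3_abs_rep[OF Quotient3_proj] .

lemma proj_cases:
  obtains x where "x \<noteq> 0" "p = abs_proj x"
  using rep_proj_nonzero[of p] abs_rep_proj[of p] by metis

definition basic_open :: "(complex^'v::finite \<Rightarrow> complex) \<Rightarrow> 'v proj set" where
  "basic_open h = abs_proj ` {x. x \<noteq> 0 \<and> h x \<noteq> 0}"

lemma abs_proj_in_basic_open:
  assumes "hpoly k h" "x \<noteq> 0"
  shows "abs_proj x \<in> basic_open h \<longleftrightarrow> h x \<noteq> 0"
proof
  assume "abs_proj x \<in> basic_open h"
  then obtain y where y: "abs_proj x = abs_proj y" "y \<noteq> 0" "h y \<noteq> 0" by (auto simp: basic_open_def)
  then obtain c where "y = c *s x" using abs_proj_eq_iff assms(2) by blast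
  then show "h x \<noteq> 0" using y hpoly_scale[OF assms(1)] by auto
qed (use assms in \<open>auto simp: basic_open_def\<close>)

lemma nonvanishing_eq: "nonvanishing F = (\<Union>f\<in>F. basic_open (peval f))"
  by (auto simp: nonvanishing_def basic_open_def)

lemma basic_open_mult:
  fixes f g :: "complex^'v::finite \<Rightarrow> complex"
  assumes "hpoly k f" "hpoly l g"
  shows "basic_open (\<lambda>x. f x * g x) = basic_open f \<inter> basic_open g"
proof (rule Set.set_eqI)
  fix p :: "'v proj"
  obtain x where "x \<noteq> 0" "p = abs_proj x" using proj_cases by blast
  then show "p \<in> basic_open (\<lambda>x. f x * g x) \<longleftrightarrow> p \<in> basic_open f \<inter> basic_open g"
    using abs_proj_in_basic_open[OF hpoly_mult[OF assms]] abs_proj_in_basic_open[OF assms(1)]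
      abs_proj_in_basic_open[OF assms(2)] by auto
qed

lemma istopology_zariski:
  "istopology (\<lambda>U. \<exists>F. (\<forall>f\<in>F. \<exists>k. homogeneous k f) \<and> U = nonvanishing (F :: ('v::finite) cpoly set))"
  unfolding istopology_def
proof (intro conjI allI impI)
  fix U V :: "'v proj set"
  assume "\<exists>F. (\<forall>f\<in>F. \<exists>k. homogeneous k f) \<and> U = nonvanishing F"
    "\<exists>F. (\<forall>f\<in>F. \<exists>k. homogeneous k f) \<and> V = nonvanishing F"
  then obtain F G where FG: "\<forall>f\<in>F. \<exists>k. homogeneous k f" "U = nonvanishing F"
    "\<forall>f\<in>G. \<exists>k. homogeneous k f" "V = nonvanishing G" by blast
  have "basic_open (peval (f * g)) = basic_open (peval f) \<inter> basic_open (peval g)"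
    if fg: "f \<in> F" "g \<in> G" for f g
  proof -
    obtain k l where "homogeneous k f" "homogeneous l g" using fg FG(1,3) by blast
    moreover have "peval (f * g) = (\<lambda>x. peval f x * peval g x)" by (rule ext) (rule peval_mult)
    ultimately show ?thesis using basic_open_mult[OF hpoly_peval hpoly_peval] by metis
  qed
  then have "U \<inter> V = nonvanishing {f * g |f g. f \<in> F \<and> g \<in> G}"
    unfolding FG(2,4) nonvanishing_eq by blast
  moreover have "\<forall>h\<in>{f * g |f g. f \<in> F \<and> g \<in> G}. \<exists>k. homogeneous k h"
    using FG(1,3) homogeneous_mult by blast
  ultimately show "\<exists>F. (\<forall>f\<in>F. \<exists>k. homogeneous k f) \<and> U \<inter> V = nonvanishing F"
    by (intro exI[of _ "{f * g |f g. f \<in> F \<and> g \<in> G}"] conjI)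
next
  fix \<U> :: "'v proj set set"
  assume "\<forall>U\<in>\<U>. \<exists>F. (\<forall>f\<in>F. \<exists>k. homogeneous k f) \<and> U = nonvanishing F"
  then obtain F where F: "\<And>U. U \<in> \<U> \<Longrightarrow> (\<forall>f\<in>F U. \<exists>k. homogeneous k f)"
    "\<And>U. U \<in> \<U> \<Longrightarrow> nonvanishing (F U) = U"
    by metis
  have "\<Union>\<U> = (\<Union>U\<in>\<U>. nonvanishing (F U))" by (simp add: F(2))
  also have "\<dots> = nonvanishing (\<Union>(F ` \<U>))"
    unfolding nonvanishing_eq by auto
  finally have "\<Union>\<U> = nonvanishing (\<Union>(F ` \<U>))" .
  then show "\<exists>F. (\<forall>f\<in>F. \<exists>k. homogeneous k f) \<and> \<Union>\<U> = nonvanishing F"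
    using F(1) by (intro exI[of _ "\<Union>(F ` \<U>)"]) auto
qed

lemma openin_zariski_iff_nonvanishing:
  "openin zariski U \<longleftrightarrow> (\<exists>F. (\<forall>f\<in>F. \<exists>k. homogeneous k f) \<and> U = nonvanishing F)"
  unfolding zariski_def by (simp add: topology_inverse'[OF istopology_zariski])

text \<open>The loci \<open>basic_open h\<close> form a base, so every local argument can shrink to
  the nonvanishing locus of a single form. For the converse, the family consists of all homogeneous
  polynomials whose locus lies in \<open>U\<close>.\<close>

lemma openin_zariski:
  "openin zariski U \<longleftrightarrow>
    (\<forall>x. x \<noteq> 0 \<longrightarrow> abs_proj x \<in> U \<longrightarrow> (\<exists>k h. hpoly k h \<and> h x \<noteq> 0 \<and> basic_open h \<subseteq> U))"
proof
  assume "openin zariski U"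
  then obtain F where F: "\<forall>f\<in>F. \<exists>k. homogeneous k f" "U = nonvanishing F"
    unfolding openin_zariski_iff_nonvanishing by blast
  show "\<forall>x. x \<noteq> 0 \<longrightarrow> abs_proj x \<in> U \<longrightarrow> (\<exists>k h. hpoly k h \<and> h x \<noteq> 0 \<and> basic_open h \<subseteq> U)"
  proof (intro allI impI)
    fix x :: "complex^'a" assume x: "x \<noteq> 0" "abs_proj x \<in> U"
    then obtain f where f: "f \<in> F" "abs_proj x \<in> basic_open (peval f)"
      using F by (auto simp: nonvanishing_eq)
    then obtain k where "hpoly k (peval f)" using F hpoly_peval by blast
    then show "\<exists>k h. hpoly k h \<and> h x \<noteq> 0 \<and> basic_open h \<subseteq> U"
      using abs_proj_in_basic_open[of k "peval f" x] x f F(2) by (auto simp: nonvanishing_eq)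
  qed
next
  assume *: "\<forall>x. x \<noteq> 0 \<longrightarrow> abs_proj x \<in> U \<longrightarrow> (\<exists>k h. hpoly k h \<and> h x \<noteq> 0 \<and> basic_open h \<subseteq> U)"
  let ?F = "{f. (\<exists>k. homogeneous k f) \<and> basic_open (peval f) \<subseteq> U}"
  have "U \<subseteq> nonvanishing ?F"
  proof
    fix p assume p: "p \<in> U"
    obtain x where x: "x \<noteq> 0" "p = abs_proj x" using proj_cases by blast
    then obtain k h where h: "hpoly k h" "h x \<noteq> 0" "basic_open h \<subseteq> U" using * p by blast
    obtain H where H: "homogeneous k H" "h = peval H" using hpoly_imp_peval[OF h(1)] by blast
    then have "H \<in> ?F" "p \<in> basic_open (peval H)" using h x by (auto simp: basic_open_def)
    then show "p \<in> nonvanishing ?F" unfolding nonvanishing_eq by blast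
  qed
  moreover have "nonvanishing ?F \<subseteq> U" unfolding nonvanishing_eq by blast
  ultimately show "openin zariski U"
    unfolding openin_zariski_iff_nonvanishing by (intro exI[of _ ?F]) auto
qed

lemma openin_basic_open: "hpoly k h \<Longrightarrow> openin zariski (basic_open h)"
  unfolding openin_zariski using abs_proj_in_basic_open by blast

lemma openin_zariski_UNIV: "openin zariski UNIV"
  unfolding openin_zariski
proof (intro allI impI)
  fix x :: "complex^'a"
  show "\<exists>k h. hpoly k h \<and> h x \<noteq> 0 \<and> basic_open h \<subseteq> UNIV"
    using hpoly_const[of 1] by (intro exI[of _ 0] exI[of _ "\<lambda>_. 1"]) auto
qed

lemma topspace_zariski [simp]: "topspace zariski = UNIV"
  using openin_zariski_UNIV openin_subset by blast


section \<open>Polynomials in a matrix acting on a vector\<close>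

text \<open>The vector p(T) z: the action on C^m of the ring C[t] with t acting as T. Only values on
  vectors enter, so iterates of the linear map are used instead of matrix powers.\<close>

definition pact :: "complex poly \<Rightarrow> complex^'m^'m \<Rightarrow> complex^'m \<Rightarrow> complex^'m::finite" where
  "pact p T z = (\<Sum>j\<le>degree p. coeff p j *s ((*v) T ^^ j) z)"

lemma pact_eq_sum:
  assumes "degree p \<le> n"
  shows "pact p T z = (\<Sum>j\<le>n. coeff p j *s ((*v) T ^^ j) z)"
  unfolding pact_def
  by (rule sum.mono_neutral_left) (use assms in \<open>auto simp: coeff_eq_0\<close>)

lemma pact_0 [simp]: "pact 0 T z = 0"
  by (simp add: pact_def)

lemma pact_pCons: "pact (pCons a p) T z = a *s z + T *v pact p T z"
proof -
  have "pact (pCons a p) T z = (\<Sum>j\<le>Suc (degree p). coeff (pCons a p) j *s ((*v) T ^^ j) z)"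
    by (rule pact_eq_sum) (simp add: degree_pCons_le)
  also have "\<dots> = a *s z + (\<Sum>j\<le>degree p. coeff p j *s ((*v) T ^^ Suc j) z)"
    by (subst sum.atMost_Suc_shift) simp
  also have "(\<Sum>j\<le>degree p. coeff p j *s ((*v) T ^^ Suc j) z) = T *v pact p T z"
    unfolding pact_def by (simp add: vec.linear_sum[OF matrix_vector_mul_linear_gen] matrix_vector_mult_scaleR vector_scalar_commute)
  finally show ?thesis .
qed

lemma pact_one [simp]: "pact 1 T z = z"
  by (simp add: pact_def)

lemma pact_add_vector: "pact p T (x + y) = pact p T x + pact p T y"
  by (induction p) (simp_all add: pact_pCons matrix_vector_right_distrib vector_add_ldistrib algebra_simps)

lemma pact_scale_vector: "pact p T (c *s x) = c *s pact p T x"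
  by (induction p)
    (simp_all add: pact_pCons vector_scalar_commute vector_add_ldistrib vector_smult_assoc mult.commute)

lemma pact_zero_vector [simp]: "pact p T 0 = 0"
  using pact_scale_vector[of p T 0 0] by simp

lemma pact_sum_vector: "pact p T (\<Sum>i\<in>I. f i) = (\<Sum>i\<in>I. pact p T (f i))"
  by (induction I rule: infinite_finite_induct) (simp_all add: pact_add_vector)

lemma pact_add: "pact (p + q) T z = pact p T z + pact q T z"
proof -
  let ?n = "max (degree p) (degree q)"
  have "pact (p + q) T z = (\<Sum>j\<le>?n. coeff (p + q) j *s ((*v) T ^^ j) z)"
    by (rule pact_eq_sum) (rule degree_add_le_max)
  then show ?thesis
    by (simp add: pact_eq_sum[of p ?n] pact_eq_sum[of q ?n] sum.distrib vector_sadd_rdistrib)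
qed

lemma pact_smult: "pact (Polynomial.smult c p) T z = c *s pact p T z"
proof -
  have "pact (Polynomial.smult c p) T z = (\<Sum>j\<le>degree p. coeff (Polynomial.smult c p) j *s ((*v) T ^^ j) z)"
    by (rule pact_eq_sum) (rule degree_smult_le)
  then show ?thesis by (simp add: pact_def vec.scale_sum_right vector_smult_assoc)
qed

lemma pact_uminus: "pact (- p) T z = - pact p T z"
  using pact_smult[of "-1" p T z] by simp

lemma pact_diff: "pact (p - q) T z = pact p T z - pact q T z"
  using pact_add[of p "- q" T z] by (simp add: pact_uminus)

lemma pact_mult: "pact (p * q) T z = pact p T (pact q T z)"
  by (induction p) (simp_all add: pact_pCons pact_add pact_smult)

lemma pact_diff_vector: "pact p T (x - y) = pact p T x - pact p T y"
  by (simp add: algebra_simps flip: pact_add_vector)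

lemma pact_commute: "pact p T (pact q T z) = pact q T (pact p T z)"
  by (metis pact_mult mult.commute)

lemma pact_linear_factor: "pact [:-c, 1:] T z = T *v z - c *s z"
  by (simp add: pact_pCons)

lemma pact_eigenvector: "T *v x = c *s x \<Longrightarrow> pact p T x = poly p c *s x"
  by (induction p)
    (simp_all add: pact_pCons vector_scalar_commute vector_sadd_rdistrib vector_smult_assoc mult.commute)

text \<open>The m + 1 vectors z, T z, ..., T^m z in an m-dimensional space are linearly dependent.
  The degree bound does not depend on T and is the origin of the exponents \<open>CARD('m)\<close>
  below.\<close>

lemma exists_annihilator_vector:
  fixes T :: "complex^'m^'m::finite"
  shows "\<exists>p. p \<noteq> 0 \<and> degree p \<le> CARD('m) \<and> pact p T z = 0"
proof (cases "inj_on (\<lambda>j. ((*v) T ^^ j) z) {..CARD('m)}")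
  case False
  then obtain i j where ij: "i \<le> CARD('m)" "j \<le> CARD('m)" "i \<noteq> j" "((*v) T ^^ i) z = ((*v) T ^^ j) z"
    by (auto simp: inj_on_def)
  \<comment> \<open>If two iterates coincide, the set of iterates is too small for the dimension
    count, but the difference of two monomials annihilates z.\<close>
  let ?p = "monom 1 i - monom 1 j :: complex poly"
  have "coeff ?p i = 1" using ij by simp
  then have "?p \<noteq> 0" by (metis coeff_0 zero_neq_one)
  moreover have deg: "degree ?p \<le> CARD('m)"
    by (rule degree_diff_le) (use ij degree_monom_le[of "1::complex"] order_trans in blast)+
  moreover have "pact (monom 1 k) T z = ((*v) T ^^ k) z" for k
    by (simp add: pact_def degree_monom_eq if_distrib[of "\<lambda>c. c *s _"] cong: if_cong)
  then have "pact ?p T z = 0" using ij by (simp add: pact_diff)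
  ultimately show ?thesis by blast
next
  case True
  let ?S = "(\<lambda>j. ((*v) T ^^ j) z) ` {..CARD('m)}"
  have "card ?S = Suc CARD('m)" using True by (simp add: card_image)
  moreover have "vec.dim ?S \<le> CARD('m)" using dim_subset_UNIV_cart_gen[of ?S] by simp
  ultimately have "vec.dependent ?S" by (intro vec.dependent_biggerset_general) simp
  then obtain u v where uv: "v \<in> ?S" "u v \<noteq> 0" "(\<Sum>v\<in>?S. u v *s v) = 0"
    using vec.dependent_finite[of ?S] by auto
  then obtain k where k: "k \<le> CARD('m)" "u (((*v) T ^^ k) z) \<noteq> 0" by auto
  let ?p = "\<Sum>j\<le>CARD('m). monom (u (((*v) T ^^ j) z)) j"
  have coeff: "coeff ?p i = (if i \<le> CARD('m) then u (((*v) T ^^ i) z) else 0)" for i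
    by (simp add: coeff_sum)
  have "?p \<noteq> 0" using coeff[of k] k by (metis coeff_0)
  moreover have deg: "degree ?p \<le> CARD('m)" by (rule degree_le) (simp only: coeff, simp)
  moreover have "pact ?p T z = 0"
    using uv(3) by (simp add: pact_eq_sum[OF deg] coeff sum.reindex[OF True])
  ultimately show ?thesis by blast
qed

text \<open>Annihilators of the basis vectors are multiplied; polynomials in T commute, so each
  factor can be moved next to its own vector. The degree is of no concern here, only that the roots
  are finite in number.\<close>

lemma exists_annihilator:
  fixes T :: "complex^'m^'m::finite"
  obtains p where "p \<noteq> 0" "\<And>z. pact p T z = 0"
proof -
  obtain q where q: "\<And>z. q z \<noteq> 0 \<and> pact (q z) T z = 0"
    using exists_annihilator_vector[of T] by metis
  let ?p = "\<Prod>i\<in>UNIV. q (axis i 1)"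
  have axis: "pact ?p T (axis i 1) = 0" for i
  proof -
    have "?p = (\<Prod>i\<in>UNIV - {i}. q (axis i 1)) * q (axis i 1)"
      by (subst prod.remove[of UNIV i]) (auto simp: mult.commute)
    then show ?thesis using q by (simp add: pact_mult)
  qed
  have "pact ?p T z = 0" for z
  proof -
    have "pact ?p T z = pact ?p T (\<Sum>i\<in>UNIV. z $ i *s axis i 1)" by (simp add: basis_expansion)
    also have "\<dots> = 0" by (simp only: pact_sum_vector pact_scale_vector axis) simp
    finally show ?thesis .
  qed
  moreover have "?p \<noteq> 0" using q by simp
  ultimately show ?thesis using that by blast
qed

lemma annihilator_eigenvalue:
  assumes "\<And>z. pact p T z = 0" "T *v x = c *s x" "x \<noteq> 0"
  shows "poly p c = 0"
  using assms pact_eigenvector[of T x c p] by simp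

lemma finite_eigenvalues:
  fixes T :: "complex^'m^'m::finite"
  shows "finite {c. \<exists>x. x \<noteq> 0 \<and> T *v x = c *s x}"
proof -
  obtain p where p: "p \<noteq> 0" "\<And>z. pact p T z = 0" using exists_annihilator[of T] by blast
  have "{c. \<exists>x. x \<noteq> 0 \<and> T *v x = c *s x} \<subseteq> {c. poly p c = 0}"
    using annihilator_eigenvalue[OF p(2)] by blast
  then show ?thesis using poly_roots_finite[OF p(1)] finite_subset by blast
qed

lemma exists_linear_factor:
  fixes p :: "complex poly"
  assumes "degree p \<noteq> 0"
  obtains c q where "p = [:-c, 1:] * q" "degree p = Suc (degree q)"
proof -
  have "\<not> constant (poly p)" using assms by (simp add: constant_degree)
  then obtain c where "poly p c = 0" using fundamental_theorem_of_algebra by blast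
  then obtain q where q: "p = [:-c, 1:] * q" using poly_eq_0_iff_dvd by (metis dvdE)
  then have "q \<noteq> 0" using assms by auto
  then have "degree p = Suc (degree q)" unfolding q by (subst degree_mult_eq) auto
  then show ?thesis using that q by blast
qed

text \<open>If p = (t - c) q and p(T) x = 0, then q(T) x satisfies the eigenvector equation for c.
  As a root of p, c is no eigenvalue, so q(T) x = 0 and the degree drops.\<close>

lemma pact_injective:
  assumes "\<And>c y. y \<noteq> 0 \<Longrightarrow> T *v y = c *s y \<Longrightarrow> poly p c \<noteq> 0" "p \<noteq> 0" "pact p T x = 0"
  shows "x = 0"
  using assms
proof (induction "degree p" arbitrary: p)
  case 0
  then obtain c where c: "p = [:c:]" using degree_eq_zeroE by metis
  then show ?case using 0 by (simp add: pact_pCons)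
next
  case (Suc n)
  then obtain c q where q: "p = [:-c, 1:] * q" "degree p = Suc (degree q)"
    using exists_linear_factor[of p] by (metis nat.distinct(1))
  have "T *v pact q T x = c *s pact q T x"
    using Suc.prems(3) unfolding q pact_mult pact_linear_factor by simp
  moreover have "poly p c = 0" unfolding q by simp
  ultimately have "pact q T x = 0" using Suc.prems(1) by blast
  moreover have "q \<noteq> 0" using q(1) Suc.prems(2) by auto
  moreover have "poly q c \<noteq> 0" if "y \<noteq> 0" "T *v y = c *s y" for c y
    using Suc.prems(1)[OF that] unfolding q(1) by simp
  ultimately show ?case
    using Suc.hyps(1)[of q] Suc.hyps(2) q(2) by auto
qed

section \<open>Vectors in the image of t - T near a point\<close>

lemma tendsto_vector_smult:
  assumes "(f \<longlongrightarrow> (a :: complex)) F" "(u \<longlongrightarrow> (v :: complex^'m::finite)) F"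
  shows "((\<lambda>t. f t *s u t) \<longlongrightarrow> a *s v) F"
  unfolding vector_scalar_mult_def using assms by (intro tendsto_intros)

lemma tendsto_matrix_vector_mult:
  assumes "(u \<longlongrightarrow> (v :: complex^'m::finite)) F"
  shows "((\<lambda>t. T *v u t) \<longlongrightarrow> T *v v) F"
  unfolding matrix_vector_mult_def using assms by (intro tendsto_intros)

lemma tendsto_pact: "(u \<longlongrightarrow> v) F \<Longrightarrow> ((\<lambda>t. pact p T (u t)) \<longlongrightarrow> pact p T v) F"
  by (induction p)
    (simp_all add: pact_pCons tendsto_add tendsto_vector_smult tendsto_matrix_vector_mult)

text \<open>The fixed vector z vanishes near t modulo the image of t - T. Regularity of u is
  weakened to continuity at the point, which is all that the boundedness argument needs.\<close>

definition locally_resolved :: "complex^'m^'m \<Rightarrow> complex^'m::finite \<Rightarrow> complex \<Rightarrow> bool" where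
  "locally_resolved T z t \<longleftrightarrow>
     (\<exists>u. isCont u t \<and> (\<forall>\<^sub>F t' in nhds t. z = t' *s u t' - T *v u t'))"

text \<open>Every polynomial in T commutes with t' - T, so p(T) can be applied to u.\<close>

lemma locally_resolved_pact:
  assumes "locally_resolved T z t"
  shows "locally_resolved T (pact p T z) t"
proof -
  obtain u where u: "isCont u t" "\<forall>\<^sub>F t' in nhds t. z = t' *s u t' - T *v u t'"
    using assms by (auto simp: locally_resolved_def)
  have comm: "pact p T (T *v x) = T *v pact p T x" for x
    using pact_commute[of p T "[:0, 1:]" x] by (simp add: pact_pCons)
  have "pact p T z = t' *s pact p T (u t') - T *v pact p T (u t')"
    if "z = t' *s u t' - T *v u t'" for t'
  proof -
    have "z + T *v u t' = t' *s u t'" using that by simp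
    then have "pact p T z + T *v pact p T (u t') = t' *s pact p T (u t')"
      by (metis pact_add_vector comm pact_scale_vector)
    then show ?thesis by (simp add: algebra_simps)
  qed
  then have "\<forall>\<^sub>F t' in nhds t. pact p T z = t' *s pact p T (u t') - T *v pact p T (u t')"
    using u(2) eventually_mono by force
  moreover have "isCont (\<lambda>t. pact p T (u t)) t" using u(1) unfolding isCont_def by (rule tendsto_pact)
  ultimately show ?thesis unfolding locally_resolved_def by (intro exI[of _ "\<lambda>t. pact p T (u t)"]) simp
qed

text \<open>Off the spectrum the only candidate for \<open>u t\<close> is \<open>z / (t - c)\<close>, which is unbounded
  near \<open>c\<close>.\<close>

lemma locally_resolved_eigenvector:
  assumes "locally_resolved T z c" "T *v z = c *s z"
  shows "z = 0"
proof -
  obtain u where u: "isCont u c" "\<forall>\<^sub>F t in nhds c. z = t *s u t - T *v u t"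
    using assms(1) by (auto simp: locally_resolved_def)
  obtain p where p: "p \<noteq> 0" "\<And>z. pact p T z = 0" using exists_annihilator[of T] by blast
  have "finite {t. poly p t = 0}" using poly_roots_finite[OF p(1)] .
  then have "\<forall>\<^sub>F t in at c. poly p t \<noteq> 0"
    using islimpt_finite[of "{t. poly p t = 0}" c] unfolding islimpt_iff_eventually by simp
  moreover have "\<forall>\<^sub>F t in at c. z = t *s u t - T *v u t"
    using u(2) unfolding eventually_nhds_conv_at by blast
  ultimately have "\<forall>\<^sub>F t in at c. (t - c) *s u t = z"
  proof eventually_elim
    case (elim t)
    \<comment> \<open>Both (t - c) u(t) and z are sent to (t - c) z by t - T, so their difference
      satisfies the eigenvector equation for t, which is no root of the annihilator.\<close>
    let ?y = "(t - c) *s u t - z"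
    have "T *v ?y = (t - c) *s (T *v u t) - c *s z"
      by (simp add: matrix_vector_mult_diff_distrib vector_scalar_commute assms(2))
    also have "T *v u t = t *s u t - z" using elim(2) by (simp add: algebra_simps)
    also have "(t - c) *s (t *s u t - z) - c *s z = t *s ?y"
      by (simp add: vec_eq_iff algebra_simps)
    finally have "T *v ?y = t *s ?y" .
    then have "?y = 0" using annihilator_eigenvalue[OF p(2)] elim(1) by blast
    then show ?case by simp
  qed
  moreover have "((\<lambda>t. (t - c) *s u t) \<longlongrightarrow> (c - c) *s u c) (at c)"
    by (intro tendsto_vector_smult tendsto_intros) (use u(1) in \<open>simp add: isCont_def\<close>)
  ultimately have "((\<lambda>t. z) \<longlongrightarrow> 0) (at c)"
    using tendsto_cong by fastforce
  then show ?thesis by (simp add: tendsto_const_iff)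
qed

lemma locally_resolved_annihilated:
  assumes "p \<noteq> 0" "pact p T z = 0" "\<And>t. poly \<kappa> t \<noteq> 0 \<Longrightarrow> locally_resolved T z t"
  shows "pact (\<kappa> ^ degree p) T z = 0"
  using assms
proof (induction "degree p" arbitrary: p z)
  case 0
  then obtain c where c: "p = [:c:]" using degree_eq_zeroE by metis
  then show ?case using 0 by (simp add: pact_pCons)
next
  case (Suc n)
  then obtain c q where q: "p = [:-c, 1:] * q" "degree p = Suc (degree q)"
    using exists_linear_factor[of p] by (metis nat.distinct(1))
  then have deg: "n = degree q" "q \<noteq> 0" using Suc by auto
  show ?case
  proof (cases "poly \<kappa> c = 0")
    case False
    have "T *v pact q T z = c *s pact q T z"
      using Suc.prems(2) unfolding q pact_mult pact_linear_factor by simp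
    then have "pact q T z = 0"
      using locally_resolved_eigenvector locally_resolved_pact Suc.prems(3) False by blast
    then have "pact (\<kappa> ^ degree q) T z = 0" using Suc.hyps(1)[of q z] Suc.prems(3) deg by blast
    then show ?thesis unfolding q(2) by (simp add: pact_mult)
  next
    case True
    then obtain r where r: "\<kappa> = [:-c, 1:] * r" using poly_eq_0_iff_dvd by (metis dvdE)
    have "pact q T (pact \<kappa> T z) = pact r T (pact p T z)"
      unfolding r q pact_mult[symmetric] by (simp only: ac_simps)
    then have "pact q T (pact \<kappa> T z) = 0" using Suc.prems(2) by simp
    then have "pact (\<kappa> ^ degree q) T (pact \<kappa> T z) = 0"
      using Suc.hyps(1)[of q "pact \<kappa> T z"] Suc.prems(3) locally_resolved_pact deg by blast
    then show ?thesis unfolding q(2) by (simp add: pact_mult[symmetric] mult.commute)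
  qed
qed

text \<open>The vector (t - T)^(-1) z has poles only at zeros of \<kappa>, of order at most the
  degree of an annihilator of z. Raising the exponent to m makes it independent of T and z.\<close>

lemma locally_resolved_power:
  fixes T :: "complex^'m^'m::finite"
  assumes "\<And>t. poly \<kappa> t \<noteq> 0 \<Longrightarrow> locally_resolved T z t"
  shows "pact (\<kappa> ^ CARD('m)) T z = 0"
proof -
  obtain p where p: "p \<noteq> 0" "degree p \<le> CARD('m)" "pact p T z = 0"
    using exists_annihilator_vector[of T z] by blast
  then have "pact (\<kappa> ^ degree p) T z = 0" using locally_resolved_annihilated assms by blast
  moreover have "\<kappa> ^ CARD('m) = \<kappa> ^ (CARD('m) - degree p) * \<kappa> ^ degree p"
    using p(2) by (simp flip: power_add)
  ultimately show ?thesis by (simp add: pact_mult)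
qed

section \<open>Division by t - T with quotient and remainder\<close>

definition pquo :: "complex poly \<Rightarrow> complex^'m^'m \<Rightarrow> complex \<Rightarrow> complex^'m \<Rightarrow> complex^'m::finite" where
  "pquo p T t z = (\<Sum>j\<le>degree p. coeff p j *s (\<Sum>i<j. t ^ i *s ((*v) T ^^ (j - Suc i)) z))"

lemma pquo_eq_sum:
  assumes "degree p \<le> n"
  shows "pquo p T t z = (\<Sum>j\<le>n. coeff p j *s (\<Sum>i<j. t ^ i *s ((*v) T ^^ (j - Suc i)) z))"
  unfolding pquo_def
  by (rule sum.mono_neutral_left) (use assms in \<open>auto simp: coeff_eq_0\<close>)

lemma matrix_vector_mult_sum: "T *v (\<Sum>i\<in>I. f i) = (\<Sum>i\<in>I. T *v f i)"
  for T :: "complex^'m::finite^'n::finite"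
  by (induction I rule: infinite_finite_induct) (simp_all add: matrix_vector_right_distrib)

lemma power_division:
  fixes T :: "complex^'m^'m::finite"
  shows "t ^ j *s z - ((*v) T ^^ j) z =
    t *s (\<Sum>i<j. t ^ i *s ((*v) T ^^ (j - Suc i)) z) - T *v (\<Sum>i<j. t ^ i *s ((*v) T ^^ (j - Suc i)) z)"
proof -
  let ?f = "\<lambda>i. t ^ i *s ((*v) T ^^ (j - i)) z"
  have "t *s (\<Sum>i<j. t ^ i *s ((*v) T ^^ (j - Suc i)) z) = (\<Sum>i<j. ?f (Suc i))"
    by (simp only: vec.scale_sum_right vector_smult_assoc power_Suc)
  moreover have "T *v (\<Sum>i<j. t ^ i *s ((*v) T ^^ (j - Suc i)) z) = (\<Sum>i<j. ?f i)"
    unfolding matrix_vector_mult_sum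
  proof (rule sum.cong)
    fix i assume "i \<in> {..<j}"
    then have "j - i = Suc (j - Suc i)" by auto
    then show "T *v (t ^ i *s ((*v) T ^^ (j - Suc i)) z) = ?f i"
      by (simp add: vector_scalar_commute)
  qed simp
  moreover have "(\<Sum>i<j. ?f (Suc i)) - (\<Sum>i<j. ?f i) = ?f j - ?f 0"
    using sum_lessThan_telescope[of ?f j] by (simp only: sum_subtractf)
  ultimately show ?thesis by simp
qed

text \<open>The remainder theorem for the divisor t - T: p(t) z and p(T) z are congruent modulo its
  image, and \<open>pquo\<close> is the divided difference (p(t) - p(T)) / (t - T), obtained
  monomial by monomial from the geometric sum.\<close>

lemma pact_division:
  "poly p t *s z - pact p T z = t *s pquo p T t z - T *v pquo p T t z"
proof -
  let ?d = "\<lambda>j. \<Sum>i<j. t ^ i *s ((*v) T ^^ (j - Suc i)) z"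
  have "t *s pquo p T t z - T *v pquo p T t z
      = (\<Sum>j\<le>degree p. coeff p j *s (t *s ?d j - T *v ?d j))"
    by (simp add: pquo_def vec.scale_sum_right matrix_vector_mult_sum vector_scalar_commute
        vector_smult_assoc mult.commute mult.left_commute vec.scale_right_diff_distrib sum_subtractf)
  also have "\<dots> = (\<Sum>j\<le>degree p. coeff p j *s (t ^ j *s z)) - pact p T z"
    unfolding power_division[symmetric]
    by (simp only: vec.scale_right_diff_distrib sum_subtractf pact_def)
  also have "(\<Sum>j\<le>degree p. coeff p j *s (t ^ j *s z)) = poly p t *s z"
    by (simp add: poly_altdef vec.scale_sum_left vector_smult_assoc)
  finally show ?thesis by simp
qed

lemma pquo_scale_vector: "pquo p T t (c *s x) = c *s pquo p T t x"
proof -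
  have "((*v) T ^^ k) (c *s x) = c *s ((*v) T ^^ k) x" for k
    by (induction k) (simp_all add: vector_scalar_commute)
  then show ?thesis
    by (simp add: pquo_def vec.scale_sum_right vector_smult_assoc mult.left_commute mult.commute)
qed

lemma pquo_sum_vector: "pquo p T t (\<Sum>i\<in>I. f i) = (\<Sum>i\<in>I. pquo p T t (f i))"
proof -
  have "((*v) T ^^ k) (\<Sum>i\<in>I. f i) = (\<Sum>i\<in>I. ((*v) T ^^ k) (f i))" for k
    by (induction k) (simp_all add: matrix_vector_mult_sum)
  then show ?thesis
    unfolding pquo_def by (simp add: vec.scale_sum_right) (subst sum.swap, rule sum.cong, simp, subst sum.swap, simp)
qed

lemma isCont_pquo: "isCont (\<lambda>t. pquo p T t z) t"
  unfolding pquo_def isCont_def by (intro tendsto_intros tendsto_vector_smult)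


section \<open>Coordinates adapted to a projection\<close>

lemma matrix_vector_nth: "(T *v x) $ i = (\<Sum>j\<in>UNIV. T $ i $ j * x $ j)"
  by (simp add: matrix_vector_mult_def)

lemma hpoly_matrix_power:
  fixes T :: "complex^'v::finite \<Rightarrow> complex^'m^'m::finite"
  assumes "\<And>i j. hpoly 1 (\<lambda>x. T x $ i $ j)"
  shows "hpoly n (\<lambda>x. ((*v) (T x) ^^ n) z $ i)"
proof (induction n arbitrary: i)
  case (Suc n)
  have "hpoly (1 + n) (\<lambda>x. \<Sum>j\<in>UNIV. T x $ i $ j * ((*v) (T x) ^^ n) z $ j)"
    by (intro hpoly_sum hpoly_mult assms Suc.IH)
  then show ?case by (simp add: matrix_vector_nth)
qed (simp add: hpoly_const)

text \<open>A point \<open>x\<close> has coordinates \<open>A x\<close> and \<open>\<tau> x\<close>; the fibres of the projection are the lines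
  on which only the second coordinate varies.\<close>

locale projection_coordinates =
  fixes A :: "complex^'v^'w" and B :: "complex^'w^'v" and q :: "complex^'v::finite"
    and \<tau> :: "complex^'v \<Rightarrow> complex"
  assumes A_B [simp]: "A *v (B *v (y :: complex^'w::finite)) = y"
    and A_q [simp]: "A *v q = 0"
    and q_nonzero: "q \<noteq> 0"
    and decomposition: "x = B *v (A *v x) + \<tau> x *s q"
    and hpoly_\<tau>: "hpoly 1 \<tau>"
begin

definition line :: "complex^'w \<Rightarrow> complex \<Rightarrow> complex^'v" where
  "line y t = B *v y + t *s q"

lemma A_line [simp]: "A *v line y t = y"
  by (simp add: line_def matrix_vector_right_distrib vector_scalar_commute)

lemma \<tau>_line [simp]: "\<tau> (line y t) = t"
proof -
  have "line y t = B *v y + \<tau> (line y t) *s q" using decomposition[of "line y t"] by simp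
  then have "(t - \<tau> (line y t)) *s q = 0"
    by (simp add: line_def vec.scale_left_diff_distrib)
  then show ?thesis using q_nonzero by simp
qed

lemma line_A_\<tau> [simp]: "line (A *v x) (\<tau> x) = x"
  using decomposition[of x] by (simp add: line_def)

lemma line_nonzero: "y \<noteq> 0 \<Longrightarrow> line y t \<noteq> 0"
  using A_line[of y t] by (auto simp del: A_line)

text \<open>\<open>line y t\<close> is linear in (y, t) jointly, so a form of degree D restricts to
  a polynomial in t whose coefficient of t^j is a form of degree D - j in y.\<close>

lemma hpoly_line_coefficients:
  assumes "hpoly D k"
  shows "\<exists>P. \<forall>y. (\<forall>t. poly (P y) t = k (line y t)) \<and> degree (P y) \<le> D \<and>
    (\<forall>j\<le>D. hpoly (D - j) (\<lambda>y. coeff (P y) j))"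
  using assms
proof induction
  case (hpoly_zero k)
  show ?case by (intro exI[of _ "\<lambda>_. 0"]) (simp add: hpoly.hpoly_zero)
next
  case (hpoly_const c)
  show ?case by (intro exI[of _ "\<lambda>_. [:c:]"]) (simp add: hpoly.hpoly_const)
next
  case (hpoly_add k f g)
  then obtain P Q where P: "\<And>y. (\<forall>t. poly (P y) t = f (line y t)) \<and> degree (P y) \<le> k \<and>
    (\<forall>j\<le>k. hpoly (k - j) (\<lambda>y. coeff (P y) j))"
    and Q: "\<And>y. (\<forall>t. poly (Q y) t = g (line y t)) \<and> degree (Q y) \<le> k \<and>
    (\<forall>j\<le>k. hpoly (k - j) (\<lambda>y. coeff (Q y) j))" by metis
  then show ?case
    by (intro exI[of _ "\<lambda>y. P y + Q y"]) (simp add: hpoly.hpoly_add degree_add_le)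
next
  case (hpoly_coord D f i)
  then obtain P where P: "\<And>y. (\<forall>t. poly (P y) t = f (line y t)) \<and> degree (P y) \<le> D \<and>
    (\<forall>j\<le>D. hpoly (D - j) (\<lambda>y. coeff (P y) j))" by metis
  \<comment> \<open>Coordinate i of \<open>line y t\<close> is (B y)_i + t q_i; the shift by
    \<open>pCons 0\<close> is multiplication by t.\<close>
  let ?R = "\<lambda>y. Polynomial.smult ((B *v y) $ i) (P y) + pCons 0 (Polynomial.smult (q $ i) (P y))"
  have "poly (?R y) t = line y t $ i * f (line y t)" for y t
    using P[of y] by (simp add: line_def algebra_simps)
  moreover have "degree (?R y) \<le> Suc D" for y
    using P[of y] degree_smult_le[of "(B *v y) $ i" "P y"] degree_smult_le[of "q $ i" "P y"]
      degree_pCons_le[of 0 "Polynomial.smult (q $ i) (P y)"]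
    by (intro degree_add_le) linarith+
  moreover have "hpoly (Suc D - j) (\<lambda>y. coeff (?R y) j)" if "j \<le> Suc D" for j
  proof -
    have "hpoly (Suc D - j) (\<lambda>y. (B *v y) $ i * coeff (P y) j)"
    proof (cases "j \<le> D")
      case True
      then have "hpoly (D - j) (\<lambda>y. coeff (P y) j)" using P by blast
      with True show ?thesis by (intro hpoly_mult_degree[OF hpoly_matrix_vector]) auto
    next
      case False
      then have "coeff (P y) j = 0" for y using P[of y] by (intro coeff_eq_0) simp
      then show ?thesis by (simp add: hpoly.hpoly_zero)
    qed
    moreover have "hpoly (Suc D - j) (\<lambda>y. coeff (pCons 0 (Polynomial.smult (q $ i) (P y))) j)"
    proof (cases j)
      case 0
      then show ?thesis by (simp add: hpoly.hpoly_zero)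
    next
      case (Suc l)
      then show ?thesis using P that by (auto intro: hpoly_cmult)
    qed
    ultimately show ?thesis by (simp add: hpoly.hpoly_add)
  qed
  ultimately show ?case by (intro exI[of _ ?R]) blast
qed

text \<open>The restriction of k to the fibre over y, as a polynomial in the fibre coordinate. A
  complex polynomial is determined by its values, so there is at most one; the value is meaningful
  only when k is polynomial along the line.\<close>

definition tpoly :: "(complex^'v \<Rightarrow> complex) \<Rightarrow> complex^'w \<Rightarrow> complex poly" where
  "tpoly k y = (THE p. \<forall>t. poly p t = k (line y t))"

lemma tpoly_eqI: "(\<And>t. poly p t = k (line y t)) \<Longrightarrow> tpoly k y = p"
  unfolding tpoly_def by (rule the_equality) (auto simp flip: poly_eq_poly_eq_iff)

lemma
  assumes "hpoly D k"
  shows poly_tpoly: "poly (tpoly k y) t = k (line y t)"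
    and degree_tpoly: "degree (tpoly k y) \<le> D"
    and hpoly_coeff_tpoly: "j \<le> D \<Longrightarrow> hpoly (D - j) (\<lambda>y. coeff (tpoly k y) j)"
proof -
  obtain P where P: "\<And>y. (\<forall>t. poly (P y) t = k (line y t)) \<and> degree (P y) \<le> D \<and>
    (\<forall>j\<le>D. hpoly (D - j) (\<lambda>y. coeff (P y) j))"
    using hpoly_line_coefficients[OF assms] by metis
  moreover have "tpoly k y = P y" for y using P by (intro tpoly_eqI) auto
  ultimately show "poly (tpoly k y) t = k (line y t)" "degree (tpoly k y) \<le> D"
    "j \<le> D \<Longrightarrow> hpoly (D - j) (\<lambda>y. coeff (tpoly k y) j)" by auto
qed

lemma tpoly_mult:
  "hpoly D k \<Longrightarrow> hpoly E l \<Longrightarrow> tpoly (\<lambda>x. k x * l x) y = tpoly k y * tpoly l y"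
  by (rule tpoly_eqI) (simp add: poly_tpoly)

lemma tpoly_power: "hpoly D k \<Longrightarrow> tpoly (\<lambda>x. k x ^ n) y = tpoly k y ^ n"
  by (rule tpoly_eqI) (simp add: poly_tpoly)

lemma tpoly_add:
  "hpoly D k \<Longrightarrow> hpoly E l \<Longrightarrow> tpoly (\<lambda>x. k x + l x) y = tpoly k y + tpoly l y"
  by (rule tpoly_eqI) (simp add: poly_tpoly)

lemma tpoly_diff:
  "hpoly D k \<Longrightarrow> hpoly E l \<Longrightarrow> tpoly (\<lambda>x. k x - l x) y = tpoly k y - tpoly l y"
  by (rule tpoly_eqI) (simp add: poly_tpoly)

lemma tpoly_cmult: "hpoly D k \<Longrightarrow> tpoly (\<lambda>x. c * k x) y = Polynomial.smult c (tpoly k y)"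
  by (rule tpoly_eqI) (simp add: poly_tpoly)

text \<open>Substituting a matrix of linear forms for t keeps the total degree: a coefficient of
  degree D - j meets T^j, whose entries have degree j.\<close>

lemma hpoly_pact_tpoly:
  fixes T :: "complex^'w \<Rightarrow> complex^'m^'m::finite"
  assumes "\<And>i j. hpoly 1 (\<lambda>y. T y $ i $ j)" "hpoly D k"
  shows "hpoly D (\<lambda>y. pact (tpoly k y) (T y) z $ i)"
proof -
  have "hpoly D (\<lambda>y. \<Sum>j\<le>D. coeff (tpoly k y) j * ((*v) (T y) ^^ j) z $ i)"
  proof (rule hpoly_sum)
    fix j assume "j \<in> {..D}"
    then show "hpoly D (\<lambda>y. coeff (tpoly k y) j * ((*v) (T y) ^^ j) z $ i)"
      using assms by (intro hpoly_mult_degree[OF hpoly_coeff_tpoly hpoly_matrix_power]) auto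
  qed
  moreover have "pact (tpoly k y) (T y) z $ i = (\<Sum>j\<le>D. coeff (tpoly k y) j * ((*v) (T y) ^^ j) z $ i)" for y
    using pact_eq_sum[OF degree_tpoly[OF assms(2)], of y "T y" z] by simp
  ultimately show ?thesis by simp
qed

text \<open>Division by t - T lowers the degree by one: a coefficient of degree D - j meets \<tau>^l
  and T^(j - 1 - l), in total D - 1. This drop is what later produces sections of O(-1).\<close>

lemma hpoly_pquo_tpoly:
  fixes T :: "complex^'w \<Rightarrow> complex^'m^'m::finite"
  assumes "\<And>i j. hpoly 1 (\<lambda>y. T y $ i $ j)" "hpoly D k" "D \<ge> 1"
  shows "hpoly (D - 1) (\<lambda>x. pquo (tpoly k (A *v x)) (T (A *v x)) (\<tau> x) z $ i)"
proof -
  have "hpoly (D - 1) (\<lambda>x. \<Sum>j\<le>D. \<Sum>l<j. coeff (tpoly k (A *v x)) j *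
    (\<tau> x ^ l * ((*v) (T (A *v x)) ^^ (j - Suc l)) z $ i))"
  proof (intro hpoly_sum)
    fix j l assume jl: "j \<in> {..D}" "l \<in> {..<j}"
    have "hpoly (D - j) (\<lambda>x. coeff (tpoly k (A *v x)) j)"
      using jl assms by (intro hpoly_compose_linear[OF hpoly_coeff_tpoly]) auto
    moreover have "hpoly (l * 1) (\<lambda>x. \<tau> x ^ l)" by (rule hpoly_power[OF hpoly_\<tau>])
    moreover have "hpoly (j - Suc l) (\<lambda>x. ((*v) (T (A *v x)) ^^ (j - Suc l)) z $ i)"
      by (rule hpoly_compose_linear[OF hpoly_matrix_power[OF assms(1)]])
    ultimately have "hpoly (D - j + (l * 1 + (j - Suc l)))
      (\<lambda>x. coeff (tpoly k (A *v x)) j * (\<tau> x ^ l * ((*v) (T (A *v x)) ^^ (j - Suc l)) z $ i))"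
      by (intro hpoly_mult)
    moreover have "D - j + (l * 1 + (j - Suc l)) = D - 1" using jl by auto
    ultimately show "hpoly (D - 1)
      (\<lambda>x. coeff (tpoly k (A *v x)) j * (\<tau> x ^ l * ((*v) (T (A *v x)) ^^ (j - Suc l)) z $ i))"
      by simp
  qed
  moreover have "pquo (tpoly k (A *v x)) (T (A *v x)) (\<tau> x) z $ i = (\<Sum>j\<le>D. \<Sum>l<j.
      coeff (tpoly k (A *v x)) j * (\<tau> x ^ l * ((*v) (T (A *v x)) ^^ (j - Suc l)) z $ i))" for x
    using pquo_eq_sum[OF degree_tpoly[OF assms(2)], of "A *v x" "T (A *v x)" "\<tau> x" z]
    by (simp add: sum_distrib_left)
  ultimately show ?thesis by simp
qed

end


text \<open>Dividing \<alpha> by its value M at q turns it into the characteristic matrix \<tau> -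
  T, with T depending on the base only. Over y it drops rank exactly at the eigenvalues of
  \<open>T y\<close>.\<close>

locale matrix_coordinates = projection_coordinates A B q \<tau>
  for A :: "complex^'v^'w" and B :: "complex^'w::finite^'v" and q :: "complex^'v::finite"
    and \<tau> :: "complex^'v \<Rightarrow> complex" +
  fixes M N :: "complex^'m^'m::finite" and T :: "complex^'w \<Rightarrow> complex^'m^'m"
    and \<alpha> :: "complex^'v \<Rightarrow> complex^'m^'m"
  assumes M_N: "M *v (N *v z) = z" and N_M: "N *v (M *v z) = z"
    and hpoly_T: "hpoly 1 (\<lambda>y. T y $ i $ j)"
    and \<alpha>_eq: "\<alpha> x *v u = M *v (\<tau> x *s u - T (A *v x) *v u)"
begin

text \<open>The value of \<open>N f\<close> at the matrix \<open>T\<close> in place of the last coordinate, i.e. the remainder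
  of \<open>N f\<close> modulo \<open>\<tau> - T\<close>.\<close>

definition ev :: "(complex^'v \<Rightarrow> complex)^'m \<Rightarrow> complex^'w \<Rightarrow> complex^'m" where
  "ev f y = (\<Sum>i\<in>UNIV. pact (tpoly (f $ i) y) (T y) (N *v axis i 1))"

definition quo :: "(complex^'v \<Rightarrow> complex)^'m \<Rightarrow> complex^'w \<Rightarrow> complex \<Rightarrow> complex^'m" where
  "quo f y t = (\<Sum>i\<in>UNIV. pquo (tpoly (f $ i) y) (T y) t (N *v axis i 1))"

abbreviation act :: "(complex^'v \<Rightarrow> complex) \<Rightarrow> complex^'w \<Rightarrow> complex^'m \<Rightarrow> complex^'m" where
  "act k y \<equiv> pact (tpoly k y) (T y)"

lemma hpoly_ev: "(\<And>i. hpoly D (f $ i)) \<Longrightarrow> hpoly D (\<lambda>y. ev f y $ i)"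
  by (simp add: ev_def) (intro hpoly_sum hpoly_pact_tpoly hpoly_T)

text \<open>N f is the sum of the entries of f times the fixed vectors N e_i, to which
  \<open>pact_division\<close> applies one by one. Hence on the fibre over y the class of f modulo
  the image of \<alpha> is represented by M times \<open>ev f y\<close>, which is constant in
  t.\<close>

lemma ev_division:
  assumes "\<And>i. hpoly D (f $ i)"
  shows "N *v (\<chi> i. (f $ i) (line y t)) = ev f y + (t *s quo f y t - T y *v quo f y t)"
proof -
  have "N *v (\<chi> i. (f $ i) (line y t)) = N *v (\<Sum>i\<in>UNIV. (f $ i) (line y t) *s axis i 1)"
    using basis_expansion[of "\<chi> i. (f $ i) (line y t)"] by simp
  also have "\<dots> = (\<Sum>i\<in>UNIV. poly (tpoly (f $ i) y) t *s (N *v axis i 1))"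
    by (simp add: matrix_vector_mult_sum vector_scalar_commute poly_tpoly[OF assms])
  also have "\<dots> = (\<Sum>i\<in>UNIV. act (f $ i) y (N *v axis i 1) +
     (t *s pquo (tpoly (f $ i) y) (T y) t (N *v axis i 1)
        - T y *v pquo (tpoly (f $ i) y) (T y) t (N *v axis i 1)))"
    by (simp flip: pact_division)
  also have "\<dots> = ev f y + (t *s quo f y t - T y *v quo f y t)"
    by (simp add: ev_def quo_def sum.distrib sum_subtractf vec.scale_sum_right matrix_vector_mult_sum)
  finally show ?thesis .
qed

lemma ev_mult:
  assumes "hpoly E k" "\<And>i. hpoly D (f $ i)"
  shows "ev (\<chi> i. (\<lambda>x. k x * (f $ i) x)) y = act k y (ev f y)"
  by (simp add: ev_def tpoly_mult[OF assms] pact_mult pact_sum_vector)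

lemma ev_add:
  assumes "\<And>i. hpoly D (f $ i)" "\<And>i. hpoly D (g $ i)"
  shows "ev (\<chi> i. (\<lambda>x. (f $ i) x + (g $ i) x)) y = ev f y + ev g y"
  by (simp add: ev_def tpoly_add[OF assms] pact_add sum.distrib)

lemma ev_diff:
  assumes "\<And>i. hpoly D (f $ i)" "\<And>i. hpoly D (g $ i)"
  shows "ev (\<chi> i. (\<lambda>x. (f $ i) x - (g $ i) x)) y = ev f y - ev g y"
  by (simp add: ev_def tpoly_diff[OF assms] pact_diff sum_subtractf)

lemma isCont_quo: "isCont (\<lambda>t. quo f y t) t"
  unfolding quo_def using isCont_pquo unfolding isCont_def by (intro tendsto_intros) auto

text \<open>Multiplying f = \<alpha> u by N gives N f = (t - T) u; subtracting the quotient from u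
  leaves only the remainder on the left.\<close>

lemma locally_resolved_ev:
  assumes f: "\<And>i. hpoly D (f $ i)" and g: "\<And>i. hpoly D (g $ i)" and "isCont u t"
    and "\<forall>\<^sub>F s in nhds t. (\<chi> i. (f $ i) (line y s)) = \<alpha> (line y s) *v u s"
  shows "locally_resolved (T y) (ev f y) t"
  unfolding locally_resolved_def
proof (intro exI conjI)
  show "isCont (\<lambda>s. u s - quo f y s) t" using assms(3) isCont_quo by (intro isCont_diff)
  show "\<forall>\<^sub>F s in nhds t. ev f y = s *s (u s - quo f y s) - T y *v (u s - quo f y s)"
    using assms(4)
  proof eventually_elim
    case (elim s)
    have "s *s u s - T y *v u s = N *v (\<chi> i. (f $ i) (line y s))"
      unfolding elim \<alpha>_eq by (simp add: N_M)
    then show ?case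
      unfolding ev_division[OF f]
      by (simp add: matrix_vector_mult_diff_distrib vec.scale_right_diff_distrib algebra_simps)
  qed
qed

text \<open>The remainder form of the condition that k'^m (k' f - k f') lies in the image of
  \<alpha> on each fibre. The asymmetry is deliberate: without a power of k, the condition is linear
  in (f, k) for fixed (f', k').\<close>

definition compatible ::
  "(complex^'v \<Rightarrow> complex)^'m \<Rightarrow> (complex^'v \<Rightarrow> complex) \<Rightarrow>
    (complex^'v \<Rightarrow> complex)^'m \<Rightarrow> (complex^'v \<Rightarrow> complex) \<Rightarrow> bool" where
  "compatible f k f' k' \<longleftrightarrow> (\<forall>y. y \<noteq> 0 \<longrightarrow>
     pact (tpoly k' y ^ CARD('m)) (T y) (act k' y (ev f y) - act k y (ev f' y)) = 0)"

text \<open>If \<open>f / k\<close> and \<open>f' / k'\<close> agree modulo the image of \<open>\<alpha>\<close> wherever both are defined, then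
  expanding by a power of \<open>k\<close> removes the condition that \<open>k\<close> does not vanish.\<close>

lemma compatible_power:
  assumes k: "hpoly D k" and f: "\<And>i. hpoly D (f $ i)"
    and k': "hpoly E k'" and f': "\<And>i. hpoly E (f' $ i)"
    and local: "\<And>y t. y \<noteq> 0 \<Longrightarrow> k (line y t) \<noteq> 0 \<Longrightarrow> k' (line y t) \<noteq> 0 \<Longrightarrow>
      \<exists>u. isCont u t \<and> (\<forall>\<^sub>F s in nhds t. k (line y s) \<noteq> 0 \<and> k' (line y s) \<noteq> 0 \<and>
        (\<chi> i. (f $ i) (line y s) / k (line y s) - (f' $ i) (line y s) / k' (line y s))
          = \<alpha> (line y s) *v u s)"
  shows "compatible (\<chi> i. (\<lambda>x. k x ^ CARD('m) * (f $ i) x)) (\<lambda>x. k x ^ Suc CARD('m)) f' k'"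
  unfolding compatible_def
proof (intro allI impI)
  fix y :: "complex^'w" assume y: "y \<noteq> 0"
  define z where "z = act k' y (ev f y) - act k y (ev f' y)"
  let ?g = "\<chi> i. (\<lambda>x. k' x * (f $ i) x - k x * (f' $ i) x)"
  have deg1: "hpoly (E + D) ((\<chi> i. (\<lambda>x. k' x * (f $ i) x)) $ i)" for i
    using hpoly_mult[OF k' f] by simp
  have deg2: "hpoly (E + D) ((\<chi> i. (\<lambda>x. k x * (f' $ i) x)) $ i)" for i
    using hpoly_mult[OF k f', of i] by (simp add: add.commute)
  have z: "z = ev ?g y"
    using ev_diff[OF deg1 deg2, of y] unfolding z_def ev_mult[OF k' f] ev_mult[OF k f'] by simp
  have g: "hpoly (E + D) (?g $ i)" for i using hpoly_diff[OF deg1[of i] deg2[of i]] by simp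
  have "pact ((tpoly k y * tpoly k' y) ^ CARD('m)) (T y) z = 0"
  proof (rule locally_resolved_power)
    fix t assume "poly (tpoly k y * tpoly k' y) t \<noteq> 0"
    then have "k (line y t) \<noteq> 0" "k' (line y t) \<noteq> 0"
      by (simp_all add: poly_tpoly[OF k] poly_tpoly[OF k'])
    then obtain u where u: "isCont u t"
      and ev: "\<forall>\<^sub>F s in nhds t. k (line y s) \<noteq> 0 \<and> k' (line y s) \<noteq> 0 \<and>
        (\<chi> i. (f $ i) (line y s) / k (line y s) - (f' $ i) (line y s) / k' (line y s))
          = \<alpha> (line y s) *v u s"
      using local[OF y] by blast
    \<comment> \<open>Multiplying by k k' clears both denominators and preserves continuity.\<close>
    let ?u = "\<lambda>s. poly (tpoly k y * tpoly k' y) s *s u s"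
    have "isCont ?u t"
      using u poly_isCont[where p = "tpoly k y * tpoly k' y"]
      unfolding isCont_def by (intro tendsto_vector_smult)
    moreover have "\<forall>\<^sub>F s in nhds t. (\<chi> i. (?g $ i) (line y s)) = \<alpha> (line y s) *v ?u s"
      using ev
    proof eventually_elim
      case (elim s)
      have "\<alpha> (line y s) *v ?u s = (k (line y s) * k' (line y s)) *s (\<alpha> (line y s) *v u s)"
        by (simp add: vector_scalar_commute poly_tpoly[OF k] poly_tpoly[OF k'])
      also have "\<alpha> (line y s) *v u s =
          (\<chi> i. (f $ i) (line y s) / k (line y s) - (f' $ i) (line y s) / k' (line y s))"
        using elim by simp
      finally have *: "\<alpha> (line y s) *v ?u s = (k (line y s) * k' (line y s)) *s
          (\<chi> i. (f $ i) (line y s) / k (line y s) - (f' $ i) (line y s) / k' (line y s))" .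
      have "k (line y s) \<noteq> 0" "k' (line y s) \<noteq> 0" using elim by auto
      then show ?case unfolding * by (simp add: vec_eq_iff field_simps)
    qed
    ultimately show "locally_resolved (T y) z t"
      unfolding z by (rule locally_resolved_ev[OF g g])
  qed
  \<comment> \<open>Of the two powers, k'(T)^m is the one that \<open>compatible\<close> provides
    for, and k(T)^m is moved into the new pair.\<close>
  then have *: "pact (tpoly k' y ^ CARD('m)) (T y) (pact (tpoly k y ^ CARD('m)) (T y) z) = 0"
    by (simp add: power_mult_distrib mult.commute flip: pact_mult)
  have "ev (\<chi> i. (\<lambda>x. k x ^ CARD('m) * (f $ i) x)) y = pact (tpoly k y ^ CARD('m)) (T y) (ev f y)"
    using ev_mult[OF hpoly_power[OF k] f] by (simp add: tpoly_power[OF k])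
  then have "act k' y (ev (\<chi> i. (\<lambda>x. k x ^ CARD('m) * (f $ i) x)) y) -
       act (\<lambda>x. k x ^ Suc CARD('m)) y (ev f' y) = pact (tpoly k y ^ CARD('m)) (T y) z"
    unfolding z_def tpoly_power[OF k]
    by (simp only: power_Suc2 pact_mult pact_diff_vector pact_commute[of "tpoly k' y"])
  with * show "pact (tpoly k' y ^ CARD('m)) (T y)
      (act k' y (ev (\<chi> i. (\<lambda>x. k x ^ CARD('m) * (f $ i) x)) y) -
       act (\<lambda>x. k x ^ Suc CARD('m)) y (ev f' y)) = 0"
    by simp
qed

text \<open>Linearity in (f, k) is the gain from absorbing the power of k into the pair; the common
  degree D keeps the combination homogeneous.\<close>

lemma compatible_combination:
  assumes "hpoly D k" "hpoly D l" "\<And>i. hpoly D (f $ i)" "\<And>i. hpoly D (g $ i)"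
    and "compatible f k f' k'" "compatible g l f' k'"
  shows "compatible (\<chi> i. (\<lambda>x. (f $ i) x + c * (g $ i) x)) (\<lambda>x. k x + c * l x) f' k'"
  unfolding compatible_def
proof (intro allI impI)
  fix y :: "complex^'w" assume y: "y \<noteq> 0"
  let ?P = "pact (tpoly k' y ^ CARD('m)) (T y)"
  have cg: "hpoly D ((\<chi> i. (\<lambda>x. c * (g $ i) x)) $ i)" for i using hpoly_cmult[OF assms(4)] by simp
  have "ev (\<chi> i. (\<lambda>x. (f $ i) x + c * (g $ i) x)) y = ev f y + ev (\<chi> i. (\<lambda>x. c * (g $ i) x)) y"
    using ev_add[OF assms(3) cg] by simp
  also have "ev (\<chi> i. (\<lambda>x. c * (g $ i) x)) y = c *s ev g y"
    by (simp add: ev_def tpoly_cmult[OF assms(4)] pact_smult vec.scale_sum_right)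
  finally have "act k' y (ev (\<chi> i. (\<lambda>x. (f $ i) x + c * (g $ i) x)) y) - act (\<lambda>x. k x + c * l x) y (ev f' y)
    = (act k' y (ev f y) - act k y (ev f' y)) + c *s (act k' y (ev g y) - act l y (ev f' y))"
    by (simp add: tpoly_add[OF assms(1) hpoly_cmult[OF assms(2)]] tpoly_cmult[OF assms(2)] pact_add
        pact_smult pact_add_vector pact_scale_vector vec.scale_right_diff_distrib)
  then show "?P (act k' y (ev (\<chi> i. (\<lambda>x. (f $ i) x + c * (g $ i) x)) y)
      - act (\<lambda>x. k x + c * l x) y (ev f' y)) = 0"
    using assms(5,6) y unfolding compatible_def by (simp only: pact_add_vector pact_scale_vector) simp
qed

text \<open>Multiplying both entries by l applies l(T) to the relation, and l(T) commutes with
  everything in it. This serves to bring two pairs to the same degree.\<close>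

lemma compatible_mult:
  assumes "hpoly E l" "hpoly D k" "\<And>i. hpoly D (f $ i)" "compatible f k f' k'"
  shows "compatible (\<chi> i. (\<lambda>x. l x * (f $ i) x)) (\<lambda>x. l x * k x) f' k'"
  unfolding compatible_def
proof (intro allI impI)
  fix y :: "complex^'w" assume y: "y \<noteq> 0"
  have "act k' y (ev (\<chi> i. (\<lambda>x. l x * (f $ i) x)) y) - act (\<lambda>x. l x * k x) y (ev f' y)
    = act l y (act k' y (ev f y) - act k y (ev f' y))"
    unfolding ev_mult[OF assms(1,3)] tpoly_mult[OF assms(1,2)] pact_mult pact_diff_vector
    by (simp only: pact_commute[of "tpoly k' y"])
  then show "pact (tpoly k' y ^ CARD('m)) (T y)
     (act k' y (ev (\<chi> i. (\<lambda>x. l x * (f $ i) x)) y) - act (\<lambda>x. l x * k x) y (ev f' y)) = 0"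
    using assms(4) y unfolding compatible_def
    by (simp only: pact_commute[of _ _ "tpoly l y"] pact_zero_vector) simp
qed

text \<open>The family \<open>loc\<close> is a parameter, which keeps the linear algebra free of
  sheaves; it becomes the family of all local representatives of one section. The pair itself is not
  asked to belong to \<open>loc\<close>: combinations only have to satisfy the relations.\<close>

definition good ::
  "(nat \<Rightarrow> (complex^'v \<Rightarrow> complex)^'m \<Rightarrow> (complex^'v \<Rightarrow> complex) \<Rightarrow> bool) \<Rightarrow>
    nat \<Rightarrow> (complex^'v \<Rightarrow> complex)^'m \<Rightarrow> (complex^'v \<Rightarrow> complex) \<Rightarrow> bool" where
  "good loc D f k \<longleftrightarrow> hpoly D k \<and> (\<forall>i. hpoly D (f $ i)) \<and>
     (\<forall>E f' k'. loc E f' k' \<longrightarrow> compatible f k f' k')"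

lemma good_combination:
  assumes "good loc D f k" "good loc D g l"
  shows "good loc D (\<chi> i. (\<lambda>x. (f $ i) x + c * (g $ i) x)) (\<lambda>x. k x + c * l x)"
proof -
  have "hpoly D k" "hpoly D l" and fg: "\<And>i. hpoly D (f $ i)" "\<And>i. hpoly D (g $ i)"
    using assms by (auto simp: good_def)
  moreover have "hpoly D (\<lambda>x. (f $ i) x + c * (g $ i) x)" for i
    by (rule hpoly_add[OF fg(1) hpoly_cmult[OF fg(2)]])
  ultimately show ?thesis
    using assms unfolding good_def by (auto intro: compatible_combination hpoly_add hpoly_cmult)
qed

lemma good_mult:
  assumes "hpoly E l" "good loc D f k"
  shows "good loc (E + D) (\<chi> i. (\<lambda>x. l x * (f $ i) x)) (\<lambda>x. l x * k x)"
  using assms unfolding good_def by (auto intro: compatible_mult hpoly_mult)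

text \<open>A generic linear combination avoids the finitely many zeros.\<close>

lemma good_nonvanishing_on_finite:
  assumes "finite I" "y \<noteq> 0" "\<And>t. t \<in> I \<Longrightarrow> \<exists>D f k. good loc D f k \<and> k (line y t) \<noteq> 0"
  shows "\<exists>D f k. good loc D f k \<and> (\<forall>t\<in>I. k (line y t) \<noteq> 0)"
  using assms
proof (induction I rule: finite_induct)
  case empty
  have "good loc 0 (\<chi> i. (\<lambda>_. 0)) (\<lambda>_. 0)"
    by (simp add: good_def compatible_def hpoly_zero ev_def tpoly_eqI[of 0])
  then show ?case by blast
next
  case (insert a I)
  then obtain D f k where fk: "good loc D f k" "\<And>t. t \<in> I \<Longrightarrow> k (line y t) \<noteq> 0" by blast
  obtain E g l where gl: "good loc E g l" "l (line y a) \<noteq> 0" using insert.prems(2) by blast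
  obtain i where i: "y $ i \<noteq> 0" using insert.prems(1) by (auto simp: vec_eq_iff)
  \<comment> \<open>Powers of a base coordinate that is nonzero at y are constant along the fibre,
    so they equalize the degrees D and E without introducing zeros on it.\<close>
  let ?x = "\<lambda>n x. ((A *v x) $ i) ^ n"
  have x: "hpoly n (?x n)" for n using hpoly_power[OF hpoly_matrix_vector[of A i], of n] by simp
  have 1: "good loc (E + D) (\<chi> j. (\<lambda>x. ?x E x * (f $ j) x)) (\<lambda>x. ?x E x * k x)"
    by (rule good_mult[OF x fk(1)])
  have 2: "good loc (E + D) (\<chi> j. (\<lambda>x. ?x D x * (g $ j) x)) (\<lambda>x. ?x D x * l x)"
    using good_mult[OF x gl(1), of D] by (simp add: add.commute)
  \<comment> \<open>Each point with l nonzero excludes one coefficient. A point with l zero excludes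
    none, because it lies in I, where k is nonzero.\<close>
  let ?bad = "(\<lambda>t. - (?x E (line y t) * k (line y t)) / (?x D (line y t) * l (line y t))) ` insert a I"
  obtain c where c: "c \<notin> ?bad" "c \<noteq> 0"
    using ex_new_if_finite[of "insert 0 ?bad"] insert.hyps(1) infinite_UNIV_char_0 by blast
  have "?x E (line y t) * k (line y t) + c * (?x D (line y t) * l (line y t)) \<noteq> 0"
    if t: "t \<in> insert a I" for t
  proof (cases "l (line y t) = 0")
    case True
    then show ?thesis using t fk(2) gl(2) i by auto
  next
    case False
    then have "?x D (line y t) * l (line y t) \<noteq> 0" using i by simp
    moreover have "c \<noteq> - (?x E (line y t) * k (line y t)) / (?x D (line y t) * l (line y t))"
      using c(1) t by blast
    ultimately show ?thesis by (simp only: eq_divide_eq add_eq_0_iff2) (metis minus_minus)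
  qed
  then show ?case
    using good_combination[OF 1 2, of c] by blast
qed

text \<open>The candidate is k(T)^(-1) applied to \<open>ev f\<close>, written by Cramer's rule as S
  / \<Delta> with forms S and \<Delta> in y. As \<Delta> is the determinant of k(T), it is nonzero
  at y0 when k vanishes at no eigenvalue of \<open>T y0\<close>. The point \<open>c0\<close>
  witnesses that k is not identically zero on that fibre.\<close>

lemma good_solution:
  assumes good: "good loc D f k" and "y0 \<noteq> 0"
    and nz: "\<And>c x. x \<noteq> 0 \<Longrightarrow> T y0 *v x = c *s x \<Longrightarrow> k (line y0 c) \<noteq> 0" "k (line y0 c0) \<noteq> 0"
  shows "\<exists>e \<Delta> S. hpoly e \<Delta> \<and> (\<forall>i. hpoly e (S $ i)) \<and> \<Delta> y0 \<noteq> 0 \<and>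
    (\<forall>y E f' k'. y \<noteq> 0 \<longrightarrow> \<Delta> y \<noteq> 0 \<longrightarrow> loc E f' k' \<longrightarrow>
      pact (tpoly k' y ^ CARD('m)) (T y) (act k' y (\<chi> i. (S $ i) y) - \<Delta> y *s ev f' y) = 0)"
proof -
  have k: "hpoly D k" and f: "\<And>i. hpoly D (f $ i)" using good by (auto simp: good_def)
  define K where "K y = (\<chi> i j. act k y (axis j 1) $ i)" for y
  have K: "K y *v x = act k y x" for x y
  proof -
    have "act k y x = act k y (\<Sum>j\<in>UNIV. x $ j *s axis j 1)" by (simp add: basis_expansion)
    also have "\<dots> = (\<Sum>j\<in>UNIV. x $ j *s act k y (axis j 1))"
      by (simp add: pact_sum_vector pact_scale_vector)
    finally show ?thesis by (simp add: vec_eq_iff matrix_vector_nth K_def mult.commute)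
  qed
  have hK: "hpoly D (\<lambda>y. K y $ i $ j)" for i j
    unfolding K_def using hpoly_pact_tpoly[OF hpoly_T k] by simp
  define \<Delta> where "\<Delta> y = det (K y)" for y
  define S where "S = (\<chi> r. (\<lambda>y. det (\<chi> i j. if j = r then ev f y $ i else K y $ i $ j)))"
  let ?S = "\<lambda>y. \<chi> i. (S $ i) y"
  have KS: "act k y (?S y) = \<Delta> y *s ev f y" if "\<Delta> y \<noteq> 0" for y
  proof -
    have "K y *v ((1 / \<Delta> y) *s ?S y) = ev f y"
      using that unfolding \<Delta>_def cramer[OF that[unfolded \<Delta>_def]] S_def by (simp add: vec_eq_iff)
    then have "\<Delta> y *s ((1 / \<Delta> y) *s (K y *v ?S y)) = \<Delta> y *s ev f y"
      by (simp add: vector_scalar_commute)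
    then show ?thesis using that by (simp add: K vector_smult_assoc)
  qed
  have inj: "x = 0" if "\<Delta> y \<noteq> 0" "act k y x = 0" for x y
  proof -
    have "det (K y) \<noteq> 0" using that(1) by (simp add: \<Delta>_def)
    then show ?thesis using cramer[of "K y" x 0] cramer[of "K y" 0 0] that(2) K by simp
  qed
  have "hpoly (CARD('m) * D) \<Delta>" unfolding \<Delta>_def[abs_def] by (rule hpoly_det[OF hK])
  moreover have "hpoly (CARD('m) * D) (S $ r)" for r
  proof -
    have "hpoly D (\<lambda>y. (\<chi> i j. if j = r then ev f y $ i else K y $ i $ j) $ i $ j)" for i j
      using hK hpoly_ev[OF f] by (cases "j = r") simp_all
    then show ?thesis
      using hpoly_det[of D "\<lambda>y. \<chi> i j. if j = r then ev f y $ i else K y $ i $ j"]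
      unfolding S_def by simp
  qed
  moreover have "\<Delta> y0 \<noteq> 0"
  proof -
    have "x = 0" if "K y0 *v x = 0" for x
    proof (rule pact_injective)
      show "act k y0 x = 0" using that by (simp add: K)
      show "tpoly k y0 \<noteq> 0" using nz(2) poly_tpoly[OF k, of y0 c0] by auto
      show "poly (tpoly k y0) c \<noteq> 0" if "z \<noteq> 0" "T y0 *v z = c *s z" for c z
        using nz(1)[OF that] poly_tpoly[OF k] by simp
    qed
    then have "invertible (K y0)"
      using invertible_left_inverse matrix_left_invertible_ker by blast
    then show ?thesis by (simp add: \<Delta>_def invertible_det_nz)
  qed
  moreover have "pact (tpoly k' y ^ CARD('m)) (T y) (act k' y (?S y) - \<Delta> y *s ev f' y) = 0"
    if y: "y \<noteq> 0" "\<Delta> y \<noteq> 0" and "loc E f' k'" for y E f' k'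
  proof (rule inj[OF y(2)])
    let ?P = "pact (tpoly k' y ^ CARD('m)) (T y)"
    \<comment> \<open>k(T) is injective where \<Delta> is nonzero, so the relation may be tested
      after applying k(T); then S turns into \<Delta> times \<open>ev f\<close> and the
      compatibility of (f, k) applies.\<close>
    have "act k y (?P (act k' y (?S y) - \<Delta> y *s ev f' y))
        = ?P (act k y (act k' y (?S y) - \<Delta> y *s ev f' y))"
      by (rule pact_commute)
    also have "\<dots> = ?P (act k' y (act k y (?S y)) - \<Delta> y *s act k y (ev f' y))"
      by (simp only: pact_diff_vector pact_scale_vector pact_commute[of "tpoly k y" _ "tpoly k' y"])
    also have "\<dots> = \<Delta> y *s ?P (act k' y (ev f y) - act k y (ev f' y))"
      unfolding KS[OF y(2)]
      by (simp only: pact_scale_vector flip: vec.scale_right_diff_distrib)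
    also have "\<dots> = 0" using good that unfolding good_def compatible_def by simp
    finally show "act k y (?P (act k' y (?S y) - \<Delta> y *s ev f' y)) = 0" .
  qed
  ultimately show ?thesis by blast
qed

text \<open>By \<open>ann\<close>, k^(m+1) S and \<Delta> k^m N f have the same remainder modulo
  \<tau> - T. The difference of their quotients is an explicit preimage under \<alpha>, of degree
  one less than the denominator \<Delta> k^(m+1), which gives a section of O(-1). The form
  \<open>Suc n\<close> avoids a truncated subtraction.\<close>

lemma solution_quotient:
  assumes \<Delta>: "hpoly e \<Delta>" and S: "\<And>i. hpoly e (S $ i)" and "E \<ge> 1"
    and k: "hpoly E k" and f: "\<And>i. hpoly E (f $ i)"
    and ann: "\<And>y. y \<noteq> 0 \<Longrightarrow> \<Delta> y \<noteq> 0 \<Longrightarrow>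
      pact (tpoly k y ^ CARD('m)) (T y) (act k y (\<chi> i. (S $ i) y) - \<Delta> y *s ev f y) = 0"
  shows "\<exists>n U. (\<forall>i. hpoly n (U $ i)) \<and> Suc n = e + Suc CARD('m) * E \<and>
    (\<forall>x. A *v x \<noteq> 0 \<longrightarrow> \<Delta> (A *v x) \<noteq> 0 \<longrightarrow> k x \<noteq> 0 \<longrightarrow>
      (\<chi> i. (M *v (\<chi> j. (S $ j) (A *v x))) $ i / \<Delta> (A *v x) - (f $ i) x / k x)
        = \<alpha> x *v (\<chi> i. (U $ i) x / (\<Delta> (A *v x) * k x ^ Suc CARD('m))))"
proof -
  let ?m = "CARD('m)"
  let ?k = "\<lambda>x. k x ^ Suc ?m"
  define g where "g = (\<chi> i. (\<lambda>x. k x ^ ?m * (f $ i) x))"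
  have deg: "Suc ?m * E \<ge> 1" using \<open>E \<ge> 1\<close> by simp
  have hk: "hpoly (Suc ?m * E) ?k" by (rule hpoly_power[OF k])
  have hg: "hpoly (Suc ?m * E) (g $ i)" for i
    using hpoly_mult_degree[OF hpoly_power[OF k] f, of "Suc ?m * E" ?m i] by (simp add: g_def)
  \<comment> \<open>The quotient of k^(m+1) S, expanded over the basis because S varies with the
    base point, minus \<Delta> times the quotient of k^m N f.\<close>
  define U where "U = (\<chi> i. (\<lambda>x. (\<Sum>j\<in>UNIV. (S $ j) (A *v x) *
      pquo (tpoly ?k (A *v x)) (T (A *v x)) (\<tau> x) (axis j 1) $ i)
    - \<Delta> (A *v x) * quo g (A *v x) (\<tau> x) $ i))"
  let ?n = "e + (Suc ?m * E - 1)"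
  have "hpoly ?n (U $ i)" for i
  proof -
    have "hpoly (Suc ?m * E - 1) (\<lambda>x. quo g (A *v x) (\<tau> x) $ i)"
      by (simp only: quo_def sum_component) (intro hpoly_sum hpoly_pquo_tpoly hpoly_T hg deg)
    moreover have "hpoly (Suc ?m * E - 1) (\<lambda>x. pquo (tpoly ?k (A *v x)) (T (A *v x)) (\<tau> x) (axis j 1) $ i)" for j
      by (intro hpoly_pquo_tpoly hpoly_T hk deg)
    ultimately show ?thesis
      unfolding U_def by (simp only: vec_lambda_beta)
        (intro hpoly_diff hpoly_sum hpoly_mult hpoly_compose_linear[OF \<Delta>] hpoly_compose_linear[OF S])
  qed
  moreover have "Suc ?n = e + Suc ?m * E" using deg by linarith
  moreover have "(\<chi> i. (M *v (\<chi> j. (S $ j) (A *v x))) $ i / \<Delta> (A *v x) - (f $ i) x / k x)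
        = \<alpha> x *v (\<chi> i. (U $ i) x / (\<Delta> (A *v x) * k x ^ Suc ?m))"
    if x: "A *v x \<noteq> 0" "\<Delta> (A *v x) \<noteq> 0" "k x \<noteq> 0" for x
  proof -
    define y t where "y = A *v x" and "t = \<tau> x"
    have xyt: "line y t = x" by (simp add: y_def t_def)
    define s where "s = (\<chi> i. (S $ i) y)"
    define F where "F = (\<chi> i. (f $ i) x)"
    have U: "(\<chi> i. (U $ i) x) = pquo (tpoly ?k y) (T y) t s - \<Delta> y *s quo g y t"
    proof -
      have "pquo (tpoly ?k y) (T y) t s = pquo (tpoly ?k y) (T y) t (\<Sum>j\<in>UNIV. s $ j *s axis j 1)"
        by (simp add: basis_expansion)
      also have "\<dots> = (\<Sum>j\<in>UNIV. s $ j *s pquo (tpoly ?k y) (T y) t (axis j 1))"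
        by (simp only: pquo_sum_vector pquo_scale_vector)
      finally show ?thesis by (simp add: vec_eq_iff U_def s_def y_def t_def)
    qed
    have 1: "k x ^ Suc ?m *s s = act ?k y s + (t *s pquo (tpoly ?k y) (T y) t s - T y *v pquo (tpoly ?k y) (T y) t s)"
      unfolding pact_division[symmetric] by (simp only: poly_tpoly[OF hk] xyt) simp
    have 2: "k x ^ ?m *s (N *v F) = ev g y + (t *s quo g y t - T y *v quo g y t)"
    proof -
      have "k x ^ ?m *s F = (\<chi> i. (g $ i) (line y t))" by (simp add: vec_eq_iff g_def F_def xyt)
      then show ?thesis
        unfolding ev_division[OF hg, symmetric] by (metis vector_scalar_commute)
    qed
    have "act ?k y s = \<Delta> y *s ev g y"
    proof -
      have "ev g y = pact (tpoly k y ^ ?m) (T y) (ev f y)"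
        unfolding g_def using ev_mult[OF hpoly_power[OF k] f] by (simp add: tpoly_power[OF k])
      moreover have "pact (tpoly k y ^ ?m) (T y) (act k y s) = act ?k y s"
        unfolding tpoly_power[OF k] by (simp only: power_Suc2 pact_mult)
      ultimately show ?thesis
        using ann[of y] x unfolding s_def y_def by (simp add: pact_diff_vector pact_scale_vector)
    qed
    then have "k x ^ Suc ?m *s s - \<Delta> y *s (k x ^ ?m *s (N *v F))
      = t *s (\<chi> i. (U $ i) x) - T y *v (\<chi> i. (U $ i) x)"
      unfolding 1 2 U
      by (simp add: vec.scale_right_diff_distrib vector_add_ldistrib matrix_vector_mult_diff_distrib
          vector_scalar_commute vector_smult_assoc mult.commute)
    then have "\<alpha> x *v (\<chi> i. (U $ i) x) = M *v (k x ^ Suc ?m *s s - \<Delta> y *s (k x ^ ?m *s (N *v F)))"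
      by (simp add: \<alpha>_eq y_def t_def)
    also have "\<dots> = k x ^ Suc ?m *s (M *v s) - (\<Delta> y * k x ^ ?m) *s F"
      by (simp add: matrix_vector_mult_diff_distrib vector_scalar_commute vector_smult_assoc M_N)
    finally have main: "\<alpha> x *v (\<chi> i. (U $ i) x) = k x ^ Suc ?m *s (M *v s) - (\<Delta> y * k x ^ ?m) *s F" .
    have "(\<chi> i. (U $ i) x / (\<Delta> y * k x ^ Suc ?m)) = (1 / (\<Delta> y * k x ^ Suc ?m)) *s (\<chi> i. (U $ i) x)"
      by (simp add: vec_eq_iff)
    then have "\<alpha> x *v (\<chi> i. (U $ i) x / (\<Delta> y * k x ^ Suc ?m))
      = (1 / (\<Delta> y * k x ^ Suc ?m)) *s (k x ^ Suc ?m *s (M *v s) - (\<Delta> y * k x ^ ?m) *s F)"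
      by (simp only: vector_scalar_commute main)
    also have "\<dots> = (\<chi> i. (M *v s) $ i / \<Delta> y - F $ i / k x)"
      using x by (simp add: vec_eq_iff y_def field_simps)
    finally show ?thesis by (simp add: s_def F_def y_def)
  qed
  ultimately show ?thesis by blast
qed

end


section \<open>Sections of twisting sheaves\<close>

lemma cone_over_basic_open: "hpoly k h \<Longrightarrow> x \<in> cone_over (basic_open h) \<longleftrightarrow> x \<noteq> 0 \<and> h x \<noteq> 0"
  by (auto simp: cone_over_def abs_proj_in_basic_open)

lemma cone_over_mono: "U \<subseteq> V \<Longrightarrow> cone_over U \<subseteq> cone_over V"
  by (auto simp: cone_over_def)

lemma cone_over_Int: "cone_over (U \<inter> V) = cone_over U \<inter> cone_over V"
  by (auto simp: cone_over_def)

lemma basic_open_subset_iff: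
  "hpoly k h \<Longrightarrow> basic_open h \<subseteq> U \<longleftrightarrow> (\<forall>x. x \<noteq> 0 \<longrightarrow> h x \<noteq> 0 \<longrightarrow> x \<in> cone_over U)"
  by (auto simp: basic_open_def cone_over_def)

text \<open>Over projective space the neighbourhood in the definition can be taken to be the
  nonvanishing locus of the denominator: numerator and denominator are both multiplied by a form
  whose locus lies in the given neighbourhood.\<close>

lemma twist_sections_iff:
  "s \<in> twist_sections UNIV k U \<longleftrightarrow>
    (\<forall>x. x \<notin> cone_over U \<longrightarrow> s x = 0) \<and>
    (\<forall>x\<in>cone_over U. \<exists>a b f h. hpoly a f \<and> hpoly b h \<and> int a - int b = k \<and> h x \<noteq> 0 \<and>
       basic_open h \<subseteq> U \<and> (\<forall>x'. x' \<noteq> 0 \<longrightarrow> h x' \<noteq> 0 \<longrightarrow> s x' = f x' / h x'))"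
  (is "_ \<longleftrightarrow> ?Z \<and> ?L")
proof (intro iffI conjI)
  assume s: "s \<in> twist_sections UNIV k U"
  then show ?Z by (simp add: twist_sections_def)
  show ?L
  proof
    fix x assume x: "x \<in> cone_over U"
    then have "abs_proj x \<in> U" "x \<noteq> 0" by (auto simp: cone_over_def)
    then obtain V a b f h where V: "openin zariski V" "abs_proj x \<in> V" "V \<subseteq> U"
      and fh: "homogeneous a f" "homogeneous b h" "int a - int b = k"
        "\<And>x. x \<in> cone_over V \<Longrightarrow> peval h x \<noteq> 0 \<and> s x = peval f x / peval h x"
      using s unfolding twist_sections_def by (auto 0 0) metis
    obtain c e where e: "hpoly c e" "e x \<noteq> 0" "basic_open e \<subseteq> V"
      using V(1,2) \<open>x \<noteq> 0\<close> unfolding openin_zariski by blast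
    have eV: "x' \<in> cone_over V" if "x' \<noteq> 0" "e x' \<noteq> 0" for x'
      using e(3) that unfolding basic_open_subset_iff[OF e(1)] by blast
    let ?f = "\<lambda>x. peval f x * e x" and ?h = "\<lambda>x. peval h x * e x"
    have h: "hpoly (a + c) ?f" "hpoly (b + c) ?h"
      using fh e by (auto intro: hpoly_mult hpoly_peval)
    moreover have "int (a + c) - int (b + c) = k" using fh by simp
    moreover have "?h x \<noteq> 0" using e(2) fh(4)[OF eV] \<open>x \<noteq> 0\<close> by simp
    moreover have "basic_open ?h \<subseteq> U"
      unfolding basic_open_subset_iff[OF h(2)] using eV cone_over_mono[OF V(3)] by auto
    moreover have "s x' = ?f x' / ?h x'" if "x' \<noteq> 0" "?h x' \<noteq> 0" for x'
      using that fh(4)[OF eV] by simp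
    ultimately show "\<exists>a b f h. hpoly a f \<and> hpoly b h \<and> int a - int b = k \<and> h x \<noteq> 0 \<and>
       basic_open h \<subseteq> U \<and> (\<forall>x'. x' \<noteq> 0 \<longrightarrow> h x' \<noteq> 0 \<longrightarrow> s x' = f x' / h x')"
      by blast
  qed
next
  assume ZL: "?Z \<and> ?L"
  show "s \<in> twist_sections UNIV k U"
    unfolding twist_sections_def
  proof (intro CollectI conjI ballI)
    show ?Z using ZL by blast
    fix p assume p: "p \<in> U"
    obtain x where x: "x \<noteq> 0" "p = abs_proj x" using proj_cases by blast
    then obtain a b f h where fh: "hpoly a f" "hpoly b h" "int a - int b = k" "h x \<noteq> 0"
       "basic_open h \<subseteq> U" "\<And>x'. x' \<noteq> 0 \<Longrightarrow> h x' \<noteq> 0 \<Longrightarrow> s x' = f x' / h x'"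
      using ZL p unfolding cone_over_def by blast
    obtain f' h' where f'h': "homogeneous a f'" "f = peval f'" "homogeneous b h'" "h = peval h'"
      using hpoly_imp_peval[OF fh(1)] hpoly_imp_peval[OF fh(2)] by blast
    show "\<exists>V a b f h. openin (subtopology zariski UNIV) V \<and> p \<in> V \<and> V \<subseteq> U \<and>
        homogeneous a f \<and> homogeneous b h \<and> int a - int b = k \<and>
        (\<forall>x\<in>cone_over V. peval h x \<noteq> 0 \<and> s x = peval f x / peval h x)"
    proof (intro exI conjI)
      show "openin (subtopology zariski UNIV) (basic_open h)" using openin_basic_open[OF fh(2)] by simp
      show "p \<in> basic_open h" using fh x by (simp add: abs_proj_in_basic_open)
      show "\<forall>x\<in>cone_over (basic_open h). peval h' x \<noteq> 0 \<and> s x = peval f' x / peval h' x"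
        using fh(6) f'h' cone_over_basic_open[OF fh(2)] by auto
    qed (use fh f'h' in auto)
  qed
qed

lemma twist_sections_outside: "s \<in> twist_sections UNIV k U \<Longrightarrow> x \<notin> cone_over U \<Longrightarrow> s x = 0"
  by (simp add: twist_sections_iff)

lemma twist_sections_local:
  assumes "s \<in> twist_sections UNIV k U" "x \<in> cone_over U"
  obtains a b f h where "hpoly a f" "hpoly b h" "int a - int b = k" "h x \<noteq> 0" "basic_open h \<subseteq> U"
    "\<And>x'. x' \<noteq> 0 \<Longrightarrow> h x' \<noteq> 0 \<Longrightarrow> s x' = f x' / h x'"
  using assms unfolding twist_sections_iff by blast

lemma twist_sections_quotient:
  assumes "openin zariski U" "hpoly a f" "hpoly b h" "int a - int b = k"
    and "\<And>x. x \<in> cone_over U \<Longrightarrow> h x \<noteq> 0"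
  shows "restrict_cone U (\<lambda>x. f x / h x) \<in> twist_sections UNIV k U"
  unfolding twist_sections_iff
proof (intro conjI ballI allI impI)
  fix x assume x: "x \<in> cone_over U"
  then obtain c e where e: "hpoly c e" "e x \<noteq> 0" "basic_open e \<subseteq> U"
    using assms(1) unfolding openin_zariski cone_over_def by blast
  have eU: "x' \<in> cone_over U" if "x' \<noteq> 0" "e x' \<noteq> 0" for x'
    using e(3) that unfolding basic_open_subset_iff[OF e(1)] by blast
  have h: "hpoly (a + c) (\<lambda>x. f x * e x)" "hpoly (b + c) (\<lambda>x. h x * e x)"
    using assms e by (auto intro: hpoly_mult)
  show "\<exists>a b f' h'. hpoly a f' \<and> hpoly b h' \<and> int a - int b = k \<and> h' x \<noteq> 0 \<and> basic_open h' \<subseteq> U \<and>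
      (\<forall>x'. x' \<noteq> 0 \<longrightarrow> h' x' \<noteq> 0 \<longrightarrow> restrict_cone U (\<lambda>x. f x / h x) x' = f' x' / h' x')"
  proof (intro exI conjI)
    show "int (a + c) - int (b + c) = k" using assms by simp
    show "basic_open (\<lambda>x. h x * e x) \<subseteq> U"
      unfolding basic_open_subset_iff[OF h(2)] using eU by auto
  qed (use h x e assms eU in \<open>auto simp: restrict_cone_def\<close>)
qed (simp add: restrict_cone_def)

lemma twist_sections_add:
  assumes "s \<in> twist_sections UNIV k U" "t \<in> twist_sections UNIV k U"
  shows "(\<lambda>x. s x + t x) \<in> twist_sections UNIV k U"
  unfolding twist_sections_iff
proof (intro conjI ballI allI impI)
  fix x assume x: "x \<in> cone_over U"
  obtain a b f h where fh: "hpoly a f" "hpoly b h" "int a - int b = k" "h x \<noteq> 0" "basic_open h \<subseteq> U"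
    "\<And>x'. x' \<noteq> 0 \<Longrightarrow> h x' \<noteq> 0 \<Longrightarrow> s x' = f x' / h x'"
    using twist_sections_local[OF assms(1) x] by metis
  obtain a' b' f' h' where fh': "hpoly a' f'" "hpoly b' h'" "int a' - int b' = k" "h' x \<noteq> 0"
    "basic_open h' \<subseteq> U" "\<And>x'. x' \<noteq> 0 \<Longrightarrow> h' x' \<noteq> 0 \<Longrightarrow> t x' = f' x' / h' x'"
    using twist_sections_local[OF assms(2) x] by metis
  have "b + a' = a + b'" using fh(3) fh'(3) by linarith
  then have "hpoly (a + b') (\<lambda>x. f x * h' x + h x * f' x)"
    by (intro hpoly_add hpoly_mult[OF fh(1) fh'(2)] hpoly_mult_degree[OF fh(2) fh'(1)]) simp
  moreover have "hpoly (b + b') (\<lambda>x. h x * h' x)" by (rule hpoly_mult[OF fh(2) fh'(2)])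
  moreover have "int (a + b') - int (b + b') = k" using fh by simp
  moreover have "basic_open (\<lambda>x. h x * h' x) \<subseteq> U"
    using basic_open_mult[OF fh(2) fh'(2)] fh(5) by blast
  ultimately show "\<exists>a b f h. hpoly a f \<and> hpoly b h \<and> int a - int b = k \<and> h x \<noteq> 0 \<and> basic_open h \<subseteq> U \<and>
      (\<forall>x'. x' \<noteq> 0 \<longrightarrow> h x' \<noteq> 0 \<longrightarrow> s x' + t x' = f x' / h x')"
    using fh(4) fh'(4) fh(6) fh'(6)
    by (intro exI[of _ "a + b'"] exI[of _ "b + b'"] exI[of _ "\<lambda>x. f x * h' x + h x * f' x"]
        exI[of _ "\<lambda>x. h x * h' x"]) (simp add: field_simps)
qed (use twist_sections_outside[OF assms(1)] twist_sections_outside[OF assms(2)] in auto)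

lemma twist_sections_mult:
  assumes "r \<in> twist_sections UNIV l U" "s \<in> twist_sections UNIV k U"
  shows "(\<lambda>x. r x * s x) \<in> twist_sections UNIV (l + k) U"
  unfolding twist_sections_iff
proof (intro conjI ballI allI impI)
  fix x assume x: "x \<in> cone_over U"
  obtain a b f h where fh: "hpoly a f" "hpoly b h" "int a - int b = l" "h x \<noteq> 0" "basic_open h \<subseteq> U"
    "\<And>x'. x' \<noteq> 0 \<Longrightarrow> h x' \<noteq> 0 \<Longrightarrow> r x' = f x' / h x'"
    using twist_sections_local[OF assms(1) x] by metis
  obtain a' b' f' h' where fh': "hpoly a' f'" "hpoly b' h'" "int a' - int b' = k" "h' x \<noteq> 0"
    "basic_open h' \<subseteq> U" "\<And>x'. x' \<noteq> 0 \<Longrightarrow> h' x' \<noteq> 0 \<Longrightarrow> s x' = f' x' / h' x'"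
    using twist_sections_local[OF assms(2) x] by metis
  have "hpoly (a + a') (\<lambda>x. f x * f' x)" by (rule hpoly_mult[OF fh(1) fh'(1)])
  moreover have "hpoly (b + b') (\<lambda>x. h x * h' x)" by (rule hpoly_mult[OF fh(2) fh'(2)])
  moreover have "int (a + a') - int (b + b') = l + k" using fh fh' by simp
  moreover have "basic_open (\<lambda>x. h x * h' x) \<subseteq> U"
    using basic_open_mult[OF fh(2) fh'(2)] fh(5) by blast
  ultimately show "\<exists>a b f h. hpoly a f \<and> hpoly b h \<and> int a - int b = l + k \<and> h x \<noteq> 0 \<and> basic_open h \<subseteq> U \<and>
      (\<forall>x'. x' \<noteq> 0 \<longrightarrow> h x' \<noteq> 0 \<longrightarrow> r x' * s x' = f x' / h x')"
    using fh(4) fh'(4) fh(6) fh'(6)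
    by (intro exI[of _ "a + a'"] exI[of _ "b + b'"] exI[of _ "\<lambda>x. f x * f' x"]
        exI[of _ "\<lambda>x. h x * h' x"]) simp
qed (use assms twist_sections_outside in auto)

lemma twist_sections_uminus:
  assumes "s \<in> twist_sections UNIV k U"
  shows "(\<lambda>x. - s x) \<in> twist_sections UNIV k U"
  unfolding twist_sections_iff
proof (intro conjI ballI allI impI)
  fix x assume x: "x \<in> cone_over U"
  obtain a b f h where fh: "hpoly a f" "hpoly b h" "int a - int b = k" "h x \<noteq> 0" "basic_open h \<subseteq> U"
    "\<And>x'. x' \<noteq> 0 \<Longrightarrow> h x' \<noteq> 0 \<Longrightarrow> s x' = f x' / h x'"
    using twist_sections_local[OF assms(1) x] by metis
  then show "\<exists>a b f h. hpoly a f \<and> hpoly b h \<and> int a - int b = k \<and> h x \<noteq> 0 \<and> basic_open h \<subseteq> U \<and>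
      (\<forall>x'. x' \<noteq> 0 \<longrightarrow> h x' \<noteq> 0 \<longrightarrow> - s x' = f x' / h x')"
    using hpoly_uminus[OF fh(1)]
    by (intro exI[of _ a] exI[of _ b] exI[of _ "\<lambda>x. - f x"] exI[of _ h]) simp
qed (use assms twist_sections_outside in auto)

lemma twist_sections_diff:
  "s \<in> twist_sections UNIV k U \<Longrightarrow> t \<in> twist_sections UNIV k U \<Longrightarrow>
    (\<lambda>x. s x - t x) \<in> twist_sections UNIV k U"
  using twist_sections_add[OF _ twist_sections_uminus, of s k U t] by simp

lemma twist_sections_locally:
  assumes "\<And>x. x \<notin> cone_over U \<Longrightarrow> s x = 0"
    and "\<And>x. x \<in> cone_over U \<Longrightarrow>
      \<exists>V t. x \<in> cone_over V \<and> V \<subseteq> U \<and> t \<in> twist_sections UNIV k V \<and> (\<forall>x'\<in>cone_over V. s x' = t x')"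
  shows "s \<in> twist_sections UNIV k U"
  unfolding twist_sections_iff
proof (intro conjI ballI allI impI)
  fix x assume "x \<in> cone_over U"
  then obtain V t where V: "x \<in> cone_over V" "V \<subseteq> U" "t \<in> twist_sections UNIV k V"
    "\<And>x'. x' \<in> cone_over V \<Longrightarrow> s x' = t x'" using assms(2) by blast
  obtain a b f h where fh: "hpoly a f" "hpoly b h" "int a - int b = k" "h x \<noteq> 0" "basic_open h \<subseteq> V"
    "\<And>x'. x' \<noteq> 0 \<Longrightarrow> h x' \<noteq> 0 \<Longrightarrow> t x' = f x' / h x'"
    using twist_sections_local[OF V(3,1)] by metis
  then have "s x' = f x' / h x'" if "x' \<noteq> 0" "h x' \<noteq> 0" for x'
    using that V(4) basic_open_subset_iff[OF fh(2)] by auto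
  then show "\<exists>a b f h. hpoly a f \<and> hpoly b h \<and> int a - int b = k \<and> h x \<noteq> 0 \<and> basic_open h \<subseteq> U \<and>
      (\<forall>x'. x' \<noteq> 0 \<longrightarrow> h x' \<noteq> 0 \<longrightarrow> s x' = f x' / h x')"
    using fh(1-5) V(2) by blast
qed (rule assms(1))

lemma twist_sections_restrict:
  assumes "s \<in> twist_sections UNIV k U" "openin zariski V" "V \<subseteq> U"
  shows "restrict_cone V s \<in> twist_sections UNIV k V"
  unfolding twist_sections_iff
proof (intro conjI ballI allI impI)
  fix x assume x: "x \<in> cone_over V"
  then have "x \<in> cone_over U" using cone_over_mono[OF assms(3)] by blast
  then obtain a b f h where fh: "hpoly a f" "hpoly b h" "int a - int b = k" "h x \<noteq> 0" "basic_open h \<subseteq> U"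
    "\<And>x'. x' \<noteq> 0 \<Longrightarrow> h x' \<noteq> 0 \<Longrightarrow> s x' = f x' / h x'"
    using twist_sections_local[OF assms(1)] by metis
  obtain c e where e: "hpoly c e" "e x \<noteq> 0" "basic_open e \<subseteq> V"
    using assms(2) x unfolding openin_zariski cone_over_def by blast
  have eV: "x' \<in> cone_over V" if "x' \<noteq> 0" "e x' \<noteq> 0" for x'
    using e(3) that unfolding basic_open_subset_iff[OF e(1)] by blast
  have h: "hpoly (a + c) (\<lambda>x. f x * e x)" "hpoly (b + c) (\<lambda>x. h x * e x)"
    using fh e by (auto intro: hpoly_mult)
  show "\<exists>a b f h. hpoly a f \<and> hpoly b h \<and> int a - int b = k \<and> h x \<noteq> 0 \<and> basic_open h \<subseteq> V \<and>
      (\<forall>x'. x' \<noteq> 0 \<longrightarrow> h x' \<noteq> 0 \<longrightarrow> restrict_cone V s x' = f x' / h x')"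
  proof (intro exI conjI)
    show "int (a + c) - int (b + c) = k" using fh by simp
    show "basic_open (\<lambda>x. h x * e x) \<subseteq> V"
      unfolding basic_open_subset_iff[OF h(2)] using eV by auto
  qed (use h fh e eV in \<open>auto simp: restrict_cone_def\<close>)
qed (simp add: restrict_cone_def)

text \<open>Taken in the whole projective space rather than in X. Cones omit 0, so points that A
  sends to 0 lie in no preimage, not even in that of \<open>UNIV\<close>.\<close>

definition projection_preimage :: "complex^'v^'w \<Rightarrow> 'w::finite proj set \<Rightarrow> 'v::finite proj set" where
  "projection_preimage A U = {p. A *v rep_proj p \<in> cone_over U}"

lemma projection_preimage_iff:
  assumes "x \<noteq> 0"
  shows "abs_proj x \<in> projection_preimage A U \<longleftrightarrow> A *v x \<in> cone_over U"
proof -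
  have "abs_proj x = abs_proj (rep_proj (abs_proj x))" by simp
  then obtain c where c: "rep_proj (abs_proj x) = c *s x"
    using abs_proj_eq_iff[OF assms rep_proj_nonzero] by blast
  then have "c \<noteq> 0" using rep_proj_nonzero[of "abs_proj x"] by auto
  then have "A *v x \<noteq> 0 \<Longrightarrow> abs_proj (c *s (A *v x)) = abs_proj (A *v x)"
    using abs_proj_eq_iff[of "A *v x" "c *s (A *v x)"] by auto
  then show ?thesis
    using \<open>c \<noteq> 0\<close> by (auto simp: projection_preimage_def c vector_scalar_commute cone_over_def)
qed

lemma cone_over_projection_preimage:
  "x \<in> cone_over (projection_preimage A U) \<longleftrightarrow> A *v x \<in> cone_over U"
proof (cases "x = 0")
  case False
  then show ?thesis
    using projection_preimage_iff[OF False, of A U] unfolding cone_over_def[of "projection_preimage A U"]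
    by simp
qed (simp add: cone_over_def)

lemma openin_projection_preimage:
  assumes "openin zariski U"
  shows "openin zariski (projection_preimage A U)"
  unfolding openin_zariski
proof (intro allI impI)
  fix x assume "x \<noteq> 0" "abs_proj x \<in> projection_preimage A U"
  then have "A *v x \<noteq> 0" "abs_proj (A *v x) \<in> U"
    using projection_preimage_iff by (auto simp: cone_over_def)
  then obtain k h where h: "hpoly k h" "h (A *v x) \<noteq> 0" "basic_open h \<subseteq> U"
    using assms unfolding openin_zariski by blast
  obtain i where i: "(A *v x) $ i \<noteq> 0" using \<open>A *v x \<noteq> 0\<close> by (auto simp: vec_eq_iff)
  text \<open>The factor \<open>(A *v x) $ i\<close> excludes the kernel of \<open>A\<close> also when \<open>h\<close> is constant.\<close>
  let ?h = "\<lambda>x. (A *v x) $ i * h (A *v x)"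
  have hA: "hpoly (1 + k) ?h"
    by (rule hpoly_mult[OF hpoly_matrix_vector hpoly_compose_linear[OF h(1)]])
  have "basic_open ?h \<subseteq> projection_preimage A U"
    unfolding basic_open_subset_iff[OF hA] cone_over_projection_preimage
  proof (intro allI impI)
    fix x' assume "?h x' \<noteq> 0"
    then have "A *v x' \<noteq> 0" "h (A *v x') \<noteq> 0" by auto
    then show "A *v x' \<in> cone_over U" using h(3) unfolding basic_open_subset_iff[OF h(1)] by blast
  qed
  then show "\<exists>k h. hpoly k h \<and> h x \<noteq> 0 \<and> basic_open h \<subseteq> projection_preimage A U"
    using hA h(2) i by (intro exI[of _ "1 + k"] exI[of _ ?h]) simp
qed

lemma twist_sections_compose:
  assumes "s \<in> twist_sections UNIV k U" "openin zariski U"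
  shows "(\<lambda>x. s (A *v x)) \<in> twist_sections UNIV k (projection_preimage A U)"
proof (rule twist_sections_locally)
  fix x assume "x \<notin> cone_over (projection_preimage A U)"
  then show "s (A *v x) = 0"
    using twist_sections_outside[OF assms(1)] by (simp add: cone_over_projection_preimage)
next
  fix x assume x: "x \<in> cone_over (projection_preimage A U)"
  then have Ax: "A *v x \<in> cone_over U" by (simp add: cone_over_projection_preimage)
  obtain a b f h where fh: "hpoly a f" "hpoly b h" "int a - int b = k" "h (A *v x) \<noteq> 0" "basic_open h \<subseteq> U"
    "\<And>x'. x' \<noteq> 0 \<Longrightarrow> h x' \<noteq> 0 \<Longrightarrow> s x' = f x' / h x'"
    using twist_sections_local[OF assms(1) Ax] by metis
  let ?V = "projection_preimage A (basic_open h)"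
  have V: "x' \<in> cone_over ?V \<longleftrightarrow> A *v x' \<noteq> 0 \<and> h (A *v x') \<noteq> 0" for x'
    by (simp add: cone_over_projection_preimage cone_over_basic_open[OF fh(2)])
  have "restrict_cone ?V (\<lambda>x. f (A *v x) / h (A *v x)) \<in> twist_sections UNIV k ?V"
    using V by (intro twist_sections_quotient[OF openin_projection_preimage[OF openin_basic_open[OF fh(2)]]
          hpoly_compose_linear[OF fh(1)] hpoly_compose_linear[OF fh(2)] fh(3)]) blast
  moreover have "x \<in> cone_over ?V" using V fh(4) Ax by (simp add: cone_over_def)
  moreover have "?V \<subseteq> projection_preimage A U"
    using fh(5) by (auto simp: projection_preimage_def cone_over_def)
  ultimately show "\<exists>V t. x \<in> cone_over V \<and> V \<subseteq> projection_preimage A U \<and>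
      t \<in> twist_sections UNIV k V \<and> (\<forall>x'\<in>cone_over V. s (A *v x') = t x')"
    using fh(6) V by (intro exI[of _ ?V] exI[of _ "restrict_cone ?V (\<lambda>x. f (A *v x) / h (A *v x))"])
      (simp add: restrict_cone_def)
qed

section \<open>Sections along the fibre lines\<close>

lemma (in projection_coordinates) eventually_line_nonzero:
  assumes "hpoly k h" "h (line y t) \<noteq> 0"
  shows "\<forall>\<^sub>F s in nhds t. h (line y s) \<noteq> 0"
proof -
  have "isCont (\<lambda>s. poly (tpoly h y) s) t" by simp
  then have "\<forall>\<^sub>F s in nhds t. poly (tpoly h y) s \<noteq> 0"
    using assms poly_tpoly[OF assms(1)] tendsto_imp_eventually_ne
    unfolding isCont_def eventually_nhds_conv_at by metis
  then show ?thesis by (simp add: poly_tpoly[OF assms(1)])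
qed

text \<open>On a fibre line a section is locally a quotient of polynomials in t with nonvanishing
  denominator. Only its continuity is retained, as this is what \<open>locally_resolved\<close> asks
  for.\<close>

lemma (in projection_coordinates) twist_sections_line:
  assumes "s \<in> twist_sections UNIV k U" "y \<noteq> 0" "line y t \<in> cone_over U"
  shows "isCont (\<lambda>t. s (line y t)) t"
proof -
  obtain a b f h where fh: "hpoly a f" "hpoly b h" "h (line y t) \<noteq> 0"
    "\<And>x'. x' \<noteq> 0 \<Longrightarrow> h x' \<noteq> 0 \<Longrightarrow> s x' = f x' / h x'"
    using twist_sections_local[OF assms(1,3)] by metis
  have "\<forall>\<^sub>F t' in nhds t. s (line y t') = poly (tpoly f y) t' / poly (tpoly h y) t'"
    using eventually_line_nonzero[OF fh(2,3)]
    by eventually_elim (simp add: poly_tpoly[OF fh(1)] poly_tpoly[OF fh(2)] fh(4) line_nonzero[OF assms(2)])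
  from isCont_cong[OF this] have "isCont (\<lambda>t. s (line y t)) t \<longleftrightarrow>
      isCont (\<lambda>t'. poly (tpoly f y) t' / poly (tpoly h y) t') t" .
  moreover have "isCont (\<lambda>t'. poly (tpoly f y) t' / poly (tpoly h y) t') t"
    using fh(3) by (intro isCont_divide poly_isCont) (simp add: poly_tpoly[OF fh(2)])
  ultimately show ?thesis by blast
qed

lemma (in projection_coordinates) eventually_line_cone:
  assumes "openin zariski U" "y \<noteq> 0" "line y t \<in> cone_over U"
  shows "\<forall>\<^sub>F s in nhds t. line y s \<in> cone_over U"
proof -
  obtain c e where e: "hpoly c e" "e (line y t) \<noteq> 0" "basic_open e \<subseteq> U"
    using assms(1,3) unfolding openin_zariski cone_over_def by blast
  from eventually_line_nonzero[OF e(1,2)] show ?thesis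
    by eventually_elim
      (use e(3)[unfolded basic_open_subset_iff[OF e(1)]] line_nonzero[OF assms(2)] in blast)
qed


section \<open>The cokernel sheaf and its direct image\<close>

abbreviation vsections :: "int \<Rightarrow> 'v::finite proj set \<Rightarrow> ((complex^'v \<Rightarrow> complex)^'m::finite) set" where
  "vsections k U \<equiv> {s. \<forall>i. s $ i \<in> twist_sections UNIV k U}"

definition vrestrict :: "'v::finite proj set \<Rightarrow> (complex^'v \<Rightarrow> complex)^'m::finite \<Rightarrow> (complex^'v \<Rightarrow> complex)^'m" where
  "vrestrict V s = (\<chi> i. restrict_cone V (s $ i))"

lemma vrestrict_apply: "(vrestrict V s $ i) x = (if x \<in> cone_over V then (s $ i) x else 0)"
  by (simp add: vrestrict_def restrict_cone_def)

lemma vsections_restrict: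
  "s \<in> vsections k U \<Longrightarrow> openin zariski V \<Longrightarrow> V \<subseteq> U \<Longrightarrow> vrestrict V s \<in> vsections k V"
  by (auto simp: vrestrict_def intro: twist_sections_restrict)

lemma vsections_eqI:
  fixes s t :: "(complex^'v::finite \<Rightarrow> complex)^'m::finite"
  assumes "s \<in> vsections k U" "t \<in> vsections k U"
    and "\<And>x i. x \<in> cone_over U \<Longrightarrow> (s $ i) x = (t $ i) x"
  shows "s = t"
proof -
  have "(s $ i) x = (t $ i) x" for i x
    using assms twist_sections_outside[of "s $ i" k U x] twist_sections_outside[of "t $ i" k U x]
    by (cases "x \<in> cone_over U") auto
  then show ?thesis by (simp add: vec_eq_iff fun_eq_iff)
qed

lemma topo_variety: "topo (variety X) = subtopology zariski X"
  by (simp add: variety_def)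

lemma openin_variety_UNIV: "openin (topo (variety UNIV)) = openin zariski"
  by (simp add: topo_variety)

lemma carrier_twist_power: "carrier (sec (sheaf_power (twist UNIV k)) U) = vsections k U"
  by (simp add: sheaf_power_def twist_def)

lemma add_twist_power:
  "add (sec (sheaf_power (twist UNIV k)) U) s t = (\<chi> i. (\<lambda>x. (s $ i) x + (t $ i) x))"
  by (simp add: sheaf_power_def twist_def)

lemma smult_twist_power:
  "r \<odot>\<^bsub>sec (sheaf_power (twist UNIV k)) U\<^esub> s = (\<chi> i. (\<lambda>x. r x * (s $ i) x))"
  by (simp add: sheaf_power_def twist_def)

lemma res_twist_power: "res (sheaf_power (twist UNIV k)) U V s = vrestrict V s"
  by (simp add: sheaf_power_def twist_def vrestrict_def)

lemma preim_inclusion: "preim (variety X) (\<lambda>p. p) V = X \<inter> V"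
  by (auto simp: preim_def topo_variety)

lemma sec_inclusion_pushforward:
  "carrier (sec (inclusion_pushforward X G) V) = carrier (sec G (X \<inter> V))"
  "\<zero>\<^bsub>sec (inclusion_pushforward X G) V\<^esub> = \<zero>\<^bsub>sec G (X \<inter> V)\<^esub>"
  "add (sec (inclusion_pushforward X G) V) = add (sec G (X \<inter> V))"
  "r \<odot>\<^bsub>sec (inclusion_pushforward X G) V\<^esub> s = restrict_cone (X \<inter> V) r \<odot>\<^bsub>sec G (X \<inter> V)\<^esub> s"
  "res (inclusion_pushforward X G) V W = res G (X \<inter> V) (X \<inter> W)"
  by (simp_all add: inclusion_pushforward_def pushforward_def preim_inclusion Let_def)

lemma sec_projection_pushforward:
  "carrier (sec (projection_pushforward A X G) U) = carrier (sec G (preim (variety X) (proj_map A) U))"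
  "add (sec (projection_pushforward A X G) U) = add (sec G (preim (variety X) (proj_map A) U))"
  "r \<odot>\<^bsub>sec (projection_pushforward A X G) U\<^esub> s =
    restrict_cone (preim (variety X) (proj_map A) U) (\<lambda>x. r (A *v x))
      \<odot>\<^bsub>sec G (preim (variety X) (proj_map A) U)\<^esub> s"
  "res (projection_pushforward A X G) U V =
    res G (preim (variety X) (proj_map A) U) (preim (variety X) (proj_map A) V)"
  by (simp_all add: projection_pushforward_def pushforward_def Let_def)

lemma openin_variety_Int: "openin zariski V \<Longrightarrow> openin (topo (variety X)) (X \<inter> V)"
  by (simp add: topo_variety openin_subtopology_Int2)

text \<open>The sheaf G is known only through the exact sequence, so its sections are reached
  through \<psi> on open sets of the ambient space. The assumption \<open>center\<close> makes the
  projection well defined on X.\<close>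

locale cokernel_sheaf = matrix_coordinates A B q \<tau> M N T \<alpha>
  for A :: "complex^'v^'w" and B :: "complex^'w::finite^'v" and q :: "complex^'v::finite"
    and \<tau> :: "complex^'v \<Rightarrow> complex" and M N :: "complex^'m^'m::finite"
    and T :: "complex^'w \<Rightarrow> complex^'m^'m" and \<alpha> :: "complex^'v \<Rightarrow> complex^'m^'m" +
  fixes a :: "'v cpoly^'m^'m" and X :: "'v proj set"
    and G :: "('v proj, complex^'v \<Rightarrow> complex, 'a) mod_presheaf"
    and \<psi> :: "'v proj set \<Rightarrow> (complex^'v \<Rightarrow> complex)^'m \<Rightarrow> 'a"
  assumes \<alpha>_peval: "\<alpha> x $ i $ j = peval (a $ i $ j) x"
    and sheaf_G: "sheaf_of_modules (variety X) G"
    and exact: "short_exact (variety UNIV) (sheaf_power (twist UNIV (-1))) (sheaf_power (twist UNIV 0))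
      (inclusion_pushforward X G) (matrix_hom a) \<psi>"
    and center: "abs_proj q \<notin> X"
begin

lemma
  assumes "openin zariski U"
  shows \<psi>_closed: "s \<in> vsections 0 U \<Longrightarrow> \<psi> U s \<in> carrier (sec G (X \<inter> U))"
    and \<psi>_add: "s \<in> vsections 0 U \<Longrightarrow> t \<in> vsections 0 U \<Longrightarrow>
      \<psi> U (\<chi> i. (\<lambda>x. (s $ i) x + (t $ i) x)) = \<psi> U s \<oplus>\<^bsub>sec G (X \<inter> U)\<^esub> \<psi> U t"
    and \<psi>_smult: "r \<in> twist_sections UNIV 0 U \<Longrightarrow> s \<in> vsections 0 U \<Longrightarrow>
      \<psi> U (\<chi> i. (\<lambda>x. r x * (s $ i) x)) = restrict_cone (X \<inter> U) r \<odot>\<^bsub>sec G (X \<inter> U)\<^esub> \<psi> U s"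
    and \<psi>_restrict: "openin zariski V \<Longrightarrow> V \<subseteq> U \<Longrightarrow> s \<in> vsections 0 U \<Longrightarrow>
      \<psi> V (vrestrict V s) = res G (X \<inter> U) (X \<inter> V) (\<psi> U s)"
proof -
  have "sheaf_hom (variety UNIV) (sheaf_power (twist UNIV 0)) (inclusion_pushforward X G) \<psi>"
    using exact by (simp add: short_exact_def)
  note hom = this[unfolded sheaf_hom_def openin_variety_UNIV carrier_twist_power add_twist_power
      smult_twist_power res_twist_power sec_inclusion_pushforward, THEN spec, THEN mp, OF assms]
  have ring: "carrier (rsec (variety UNIV) U) = twist_sections UNIV 0 U"
    by (simp add: variety_def)
  show "s \<in> vsections 0 U \<Longrightarrow> \<psi> U s \<in> carrier (sec G (X \<inter> U))"
    using hom[THEN conjunct1] by (rule bspec)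
  show "s \<in> vsections 0 U \<Longrightarrow> t \<in> vsections 0 U \<Longrightarrow>
      \<psi> U (\<chi> i. (\<lambda>x. (s $ i) x + (t $ i) x)) = \<psi> U s \<oplus>\<^bsub>sec G (X \<inter> U)\<^esub> \<psi> U t"
    by (rule hom[THEN conjunct2, THEN conjunct1, THEN bspec, THEN bspec])
  show "r \<in> twist_sections UNIV 0 U \<Longrightarrow> s \<in> vsections 0 U \<Longrightarrow>
      \<psi> U (\<chi> i. (\<lambda>x. r x * (s $ i) x)) = restrict_cone (X \<inter> U) r \<odot>\<^bsub>sec G (X \<inter> U)\<^esub> \<psi> U s"
    by (rule hom[THEN conjunct2, THEN conjunct2, THEN conjunct1, unfolded ring, THEN bspec, THEN bspec])
  show "openin zariski V \<Longrightarrow> V \<subseteq> U \<Longrightarrow> s \<in> vsections 0 U \<Longrightarrow>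
      \<psi> V (vrestrict V s) = res G (X \<inter> U) (X \<inter> V) (\<psi> U s)"
    using hom[THEN conjunct2, THEN conjunct2, THEN conjunct2, THEN spec, THEN mp, THEN bspec] by simp
qed

text \<open>Membership in the image sheaf of \<alpha>, in terms of values on the cone; the preimage
  h may depend on the neighbourhood, as in the definition of exactness.\<close>

definition locally_in_image :: "'v proj set \<Rightarrow> (complex^'v \<Rightarrow> complex^'m) \<Rightarrow> bool" where
  "locally_in_image U v \<longleftrightarrow> (\<forall>x\<in>cone_over U. \<exists>V h. openin zariski V \<and> x \<in> cone_over V \<and> V \<subseteq> U \<and>
     h \<in> vsections (-1) V \<and> (\<forall>x'\<in>cone_over V. v x' = \<alpha> x' *v (\<chi> i. (h $ i) x')))"

lemma \<psi>_eq_zero_iff: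
  assumes U: "openin zariski U" and s: "s \<in> vsections 0 U"
  shows "\<psi> U s = \<zero>\<^bsub>sec G (X \<inter> U)\<^esub> \<longleftrightarrow> locally_in_image U (\<lambda>x. \<chi> i. (s $ i) x)"
proof -
  have "\<psi> U s = \<zero>\<^bsub>sec G (X \<inter> U)\<^esub> \<longleftrightarrow> (\<forall>p\<in>U. \<exists>V. openin zariski V \<and> p \<in> V \<and> V \<subseteq> U \<and>
      vrestrict V s \<in> matrix_hom a V ` vsections (-1) V)"
    using exact[unfolded short_exact_def openin_variety_UNIV carrier_twist_power res_twist_power
        sec_inclusion_pushforward, THEN conjunct2, THEN conjunct2, THEN conjunct2, THEN conjunct1,
        THEN spec, THEN mp, OF U, THEN bspec, OF s] .
  also have "\<dots> \<longleftrightarrow> (\<forall>x\<in>cone_over U. \<exists>V. openin zariski V \<and> x \<in> cone_over V \<and> V \<subseteq> U \<and>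
      vrestrict V s \<in> matrix_hom a V ` vsections (-1) V)"
    (is "(\<forall>p\<in>U. ?P p) \<longleftrightarrow> ?R")
  proof
    assume L: "\<forall>p\<in>U. ?P p"
    show ?R
    proof
      fix x assume "x \<in> cone_over U"
      then have "?P (abs_proj x)" "x \<noteq> 0" using L by (auto simp: cone_over_def)
      then show "\<exists>V. openin zariski V \<and> x \<in> cone_over V \<and> V \<subseteq> U \<and>
        vrestrict V s \<in> matrix_hom a V ` vsections (-1) V" by (auto simp: cone_over_def)
    qed
  next
    assume R: ?R
    show "\<forall>p\<in>U. ?P p"
    proof
      fix p assume p: "p \<in> U"
      obtain x where "x \<noteq> 0" "p = abs_proj x" using proj_cases by blast
      then show "?P p" using R p by (auto simp: cone_over_def)
    qed
  qed
  also have "\<dots> \<longleftrightarrow> locally_in_image U (\<lambda>x. \<chi> i. (s $ i) x)"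
  proof -
    have hom: "matrix_hom a V h = (\<chi> i. (\<lambda>x. (\<alpha> x *v (\<chi> i. (h $ i) x)) $ i))" for V h
      by (simp add: matrix_hom_def matrix_vector_nth \<alpha>_peval)
    have "vrestrict V s = matrix_hom a V h \<longleftrightarrow>
        (\<forall>x'\<in>cone_over V. (\<chi> i. (s $ i) x') = \<alpha> x' *v (\<chi> i. (h $ i) x'))"
      if h: "h \<in> vsections (-1) V" for V h
    proof -
      \<comment> \<open>Sections are extended by zero off their cone, so equality of the extended
        functions only has to be tested on the cone.\<close>
      have "(h $ i) x = 0" if "x \<notin> cone_over V" for x i
        using h that twist_sections_outside[of "h $ i" "-1" V x] by auto
      then have zero: "(\<alpha> x *v (\<chi> i. (h $ i) x)) $ i = 0" if "x \<notin> cone_over V" for x i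
        using that by (simp add: matrix_vector_nth)
      have "vrestrict V s = matrix_hom a V h \<longleftrightarrow>
          (\<forall>x i. (if x \<in> cone_over V then (s $ i) x else 0) = (\<alpha> x *v (\<chi> i. (h $ i) x)) $ i)"
        unfolding hom vec_eq_iff fun_eq_iff vrestrict_apply vec_lambda_beta by blast
      also have "\<dots> \<longleftrightarrow> (\<forall>x\<in>cone_over V. \<forall>i. (s $ i) x = (\<alpha> x *v (\<chi> i. (h $ i) x)) $ i)"
        using zero by auto
      finally show ?thesis by (simp add: vec_eq_iff)
    qed
    then have "vrestrict V s \<in> matrix_hom a V ` vsections (-1) V \<longleftrightarrow> (\<exists>h. h \<in> vsections (-1) V \<and>
        (\<forall>x'\<in>cone_over V. (\<chi> i. (s $ i) x') = \<alpha> x' *v (\<chi> i. (h $ i) x')))" for V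
      unfolding image_iff by blast
    then show ?thesis unfolding locally_in_image_def by (simp only: simp_thms ex_simps)
  qed
  finally show ?thesis .
qed

lemma abelian_group_G: "openin zariski U \<Longrightarrow> abelian_group (sec G (X \<inter> U))"
  by (rule Module.module.axioms(2)[OF sheaf_of_modules.is_module[OF sheaf_G openin_variety_Int]])

text \<open>Writing s as (s - t) + t, additivity of \<psi> and cancellation in the group of sections
  of G reduce equality to the kernel.\<close>

lemma \<psi>_eq_iff:
  assumes U: "openin zariski U" and s: "s \<in> vsections 0 U" and t: "t \<in> vsections 0 U"
  shows "\<psi> U s = \<psi> U t \<longleftrightarrow> locally_in_image U (\<lambda>x. \<chi> i. (s $ i) x - (t $ i) x)"
proof -
  interpret abelian_group "sec G (X \<inter> U)" by (rule abelian_group_G[OF U])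
  let ?d = "\<chi> i. (\<lambda>x. (s $ i) x - (t $ i) x)"
  have d: "?d \<in> vsections 0 U" using s t by (simp add: twist_sections_diff)
  have "s = (\<chi> i. (\<lambda>x. (?d $ i) x + (t $ i) x))" by (simp add: vec_eq_iff)
  then have "\<psi> U s = \<psi> U ?d \<oplus>\<^bsub>sec G (X \<inter> U)\<^esub> \<psi> U t" using \<psi>_add[OF U d t] by simp
  moreover have "\<psi> U ?d \<in> carrier (sec G (X \<inter> U))" "\<psi> U t \<in> carrier (sec G (X \<inter> U))"
    using \<psi>_closed[OF U] d t by blast+
  moreover have "x \<oplus>\<^bsub>sec G (X \<inter> U)\<^esub> y = y \<longleftrightarrow> x = \<zero>\<^bsub>sec G (X \<inter> U)\<^esub>"
    if xy: "x \<in> carrier (sec G (X \<inter> U))" "y \<in> carrier (sec G (X \<inter> U))" for x y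
  proof
    assume eq: "x \<oplus>\<^bsub>sec G (X \<inter> U)\<^esub> y = y"
    have "x = (x \<oplus>\<^bsub>sec G (X \<inter> U)\<^esub> y) \<oplus>\<^bsub>sec G (X \<inter> U)\<^esub> (\<ominus>\<^bsub>sec G (X \<inter> U)\<^esub> y)"
      using xy by (simp add: a_assoc r_neg)
    also have "\<dots> = \<zero>\<^bsub>sec G (X \<inter> U)\<^esub>"
      unfolding eq using xy by (simp add: r_neg)
    finally show "x = \<zero>\<^bsub>sec G (X \<inter> U)\<^esub>" .
  next
    assume "x = \<zero>\<^bsub>sec G (X \<inter> U)\<^esub>"
    then show "x \<oplus>\<^bsub>sec G (X \<inter> U)\<^esub> y = y" using xy(2) by simp
  qed
  ultimately have "\<psi> U s = \<psi> U t \<longleftrightarrow> \<psi> U ?d = \<zero>\<^bsub>sec G (X \<inter> U)\<^esub>"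
    by simp
  then show ?thesis using \<psi>_eq_zero_iff[OF U d] by simp
qed

text \<open>Covers are taken in projective space and then cut down to X.\<close>

lemma G_separated:
  assumes "\<And>V. V \<in> \<V> \<Longrightarrow> openin zariski V" "U = \<Union>\<V>"
    and "s \<in> carrier (sec G (X \<inter> U))" "t \<in> carrier (sec G (X \<inter> U))"
    and "\<And>V. V \<in> \<V> \<Longrightarrow> res G (X \<inter> U) (X \<inter> V) s = res G (X \<inter> U) (X \<inter> V) t"
  shows "s = t"
proof -
  have *: "X \<inter> U = \<Union>((\<inter>) X ` \<V>)" using assms(2) by auto
  show ?thesis
  proof (rule sheaf_of_modules.separated[OF sheaf_G, of "(\<inter>) X ` \<V>"])
    show "openin (topo (variety X)) W" if "W \<in> (\<inter>) X ` \<V>" for W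
      using that assms(1) openin_variety_Int by blast
    show "res G (\<Union>((\<inter>) X ` \<V>)) W s = res G (\<Union>((\<inter>) X ` \<V>)) W t" if "W \<in> (\<inter>) X ` \<V>" for W
      unfolding *[symmetric] using that assms(5) by blast
  qed (use assms(3,4) in \<open>simp_all add: *\<close>)
qed

lemma G_res_comp:
  assumes "openin zariski U" "openin zariski V" "openin zariski W" "W \<subseteq> V" "V \<subseteq> U"
    and "s \<in> carrier (sec G (X \<inter> U))"
  shows "res G (X \<inter> V) (X \<inter> W) (res G (X \<inter> U) (X \<inter> V) s) = res G (X \<inter> U) (X \<inter> W) s"
  by (rule sheaf_of_modules.res_comp[OF sheaf_G])
    (use assms openin_variety_Int in auto)

lemma G_res_closed:
  assumes "openin zariski U" "openin zariski V" "V \<subseteq> U" "s \<in> carrier (sec G (X \<inter> U))"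
  shows "res G (X \<inter> U) (X \<inter> V) s \<in> carrier (sec G (X \<inter> V))"
  by (rule sheaf_of_modules.res_closed[OF sheaf_G])
    (use assms openin_variety_Int in auto)

section \<open>Pulling sections back from the base; injectivity\<close>

definition pullback :: "(complex^'w \<Rightarrow> complex)^'m \<Rightarrow> (complex^'v \<Rightarrow> complex)^'m" where
  "pullback s = (\<chi> i. (\<lambda>x. (s $ i) (A *v x)))"

abbreviation preimage :: "'w proj set \<Rightarrow> 'v proj set" where
  "preimage \<equiv> projection_preimage A"

definition \<Phi> :: "'w proj set \<Rightarrow> (complex^'w \<Rightarrow> complex)^'m \<Rightarrow> 'a" where
  "\<Phi> U s = \<psi> (preimage U) (pullback s)"

lemma pullback_vsections:
  "openin zariski U \<Longrightarrow> s \<in> vsections 0 U \<Longrightarrow> pullback s \<in> vsections 0 (preimage U)"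
  by (simp add: pullback_def twist_sections_compose)

lemma line_in_cone: "line y t \<in> cone_over (preimage U) \<longleftrightarrow> y \<in> cone_over U"
  by (simp add: cone_over_projection_preimage)

lemma preimage_mono: "V \<subseteq> U \<Longrightarrow> preimage V \<subseteq> preimage U"
  using cone_over_mono by (auto simp: projection_preimage_def)

lemma pullback_restrict: "pullback (vrestrict V s) = vrestrict (preimage V) (pullback s)"
  by (simp add: vec_eq_iff fun_eq_iff vrestrict_apply pullback_def cone_over_projection_preimage)

lemma \<Phi>_closed:
  "openin zariski U \<Longrightarrow> s \<in> vsections 0 U \<Longrightarrow> \<Phi> U s \<in> carrier (sec G (X \<inter> preimage U))"
  unfolding \<Phi>_def by (rule \<psi>_closed[OF openin_projection_preimage pullback_vsections])

lemma \<Phi>_restrict: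
  assumes "openin zariski U" "openin zariski V" "V \<subseteq> U" "s \<in> vsections 0 U"
  shows "\<Phi> V (vrestrict V s) = res G (X \<inter> preimage U) (X \<inter> preimage V) (\<Phi> U s)"
  unfolding \<Phi>_def pullback_restrict
  by (rule \<psi>_restrict[OF openin_projection_preimage[OF assms(1)] openin_projection_preimage[OF assms(2)]
        preimage_mono[OF assms(3)] pullback_vsections[OF assms(1,4)]])

text \<open>The bridge from sheaves to linear algebra: a local preimage under \<alpha> is restricted
  to a fibre line, where only its continuity is kept.\<close>

lemma locally_in_image_line:
  assumes "locally_in_image U v" "y \<noteq> 0" "line y t \<in> cone_over U"
  shows "\<exists>u. isCont u t \<and> (\<forall>\<^sub>F s in nhds t. v (line y s) = \<alpha> (line y s) *v u s)"
proof -
  obtain V h where V: "openin zariski V" "line y t \<in> cone_over V" "h \<in> vsections (-1) V"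
    and v: "\<And>x'. x' \<in> cone_over V \<Longrightarrow> v x' = \<alpha> x' *v (\<chi> i. (h $ i) x')"
    using bspec[OF assms(1)[unfolded locally_in_image_def] assms(3)] by (elim exE conjE) blast
  have "h $ i \<in> twist_sections UNIV (-1) V" for i using V(3) by simp
  then have "isCont (\<lambda>s. (h $ i) (line y s)) t" for i
    using twist_sections_line[OF _ assms(2) V(2)] by blast
  then have "isCont (\<lambda>s. \<chi> i. (h $ i) (line y s)) t"
    unfolding isCont_def by (rule tendsto_vec_lambda)
  moreover have "\<forall>\<^sub>F s in nhds t. v (line y s) = \<alpha> (line y s) *v (\<chi> i. (h $ i) (line y s))"
    using eventually_line_cone[OF V(1) assms(2) V(2)] by eventually_elim (rule v)
  ultimately show ?thesis by (intro exI conjI)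
qed

text \<open>A pullback is constant along each fibre, so N times the difference of the values at y is
  one fixed vector. It is resolved at every point of the line, because the whole line lies over
  U.\<close>

lemma \<Phi>_injective:
  assumes U: "openin zariski U" and s: "s \<in> vsections 0 U" and t: "t \<in> vsections 0 U"
    and eq: "\<Phi> U s = \<Phi> U t"
  shows "s = t"
proof (rule vsections_eqI[OF s t])
  fix y i assume y: "y \<in> cone_over U"
  then have y0: "y \<noteq> 0" by (simp add: cone_over_def)
  let ?z = "\<chi> i. (s $ i) y - (t $ i) y"
  have *: "locally_in_image (preimage U) (\<lambda>x. \<chi> i. (pullback s $ i) x - (pullback t $ i) x)"
    using eq \<psi>_eq_iff[OF openin_projection_preimage[OF U] pullback_vsections[OF U s] pullback_vsections[OF U t]]
    unfolding \<Phi>_def by blast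
  have ex: "\<exists>u. isCont u c \<and> (\<forall>\<^sub>F s in nhds c. ?z = \<alpha> (line y s) *v u s)" for c
    using locally_in_image_line[OF * y0, of c] y by (simp add: line_in_cone pullback_def)
  have "locally_resolved (T y) (N *v ?z) c" for c
  proof -
    obtain u where u: "isCont u c" "\<forall>\<^sub>F s in nhds c. ?z = \<alpha> (line y s) *v u s" using ex[of c] by blast
    from u(2) have "\<forall>\<^sub>F s in nhds c. N *v ?z = s *s u s - T y *v u s"
    proof eventually_elim
      case (elim s)
      show ?case unfolding elim \<alpha>_eq by (simp add: N_M)
    qed
    then show ?thesis using u(1) unfolding locally_resolved_def by blast
  qed
  \<comment> \<open>Resolution holds at every t, so \<kappa> = 1 is allowed and no power
    remains.\<close>
  then have "pact (1 ^ CARD('m)) (T y) (N *v ?z) = 0" by (rule locally_resolved_power)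
  then have "M *v (N *v ?z) = 0" by simp
  then have "?z = 0" unfolding M_N .
  then show "(s $ i) y = (t $ i) y" by (simp add: vec_eq_iff)
qed

end


section \<open>Local lifts and surjectivity\<close>

context cokernel_sheaf
begin

definition fraction :: "(complex^'v \<Rightarrow> complex)^'m \<Rightarrow> (complex^'v \<Rightarrow> complex) \<Rightarrow> (complex^'v \<Rightarrow> complex)^'m" where
  "fraction f k = (\<chi> i. restrict_cone (basic_open k) (\<lambda>x. (f $ i) x / k x))"

lemma fraction_vsections:
  assumes "hpoly D k" "\<And>i. hpoly D (f $ i)"
  shows "fraction f k \<in> vsections 0 (basic_open k)"
proof -
  have "restrict_cone (basic_open k) (\<lambda>x. (f $ i) x / k x) \<in> twist_sections UNIV 0 (basic_open k)" for i
    by (rule twist_sections_quotient[OF openin_basic_open[OF assms(1)] assms(2,1)])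
      (simp_all add: cone_over_basic_open[OF assms(1)])
  then show ?thesis by (simp add: fraction_def)
qed

lemma fraction_apply: "hpoly D k \<Longrightarrow> x \<noteq> 0 \<Longrightarrow> k x \<noteq> 0 \<Longrightarrow> (fraction f k $ i) x = (f $ i) x / k x"
  by (simp add: fraction_def restrict_cone_def cone_over_basic_open)

text \<open>One form k is both the common denominator and the equation that cuts out the domain.
  Numerators and denominators are polynomial on all of affine space, so pairs with different domains
  can be compared and added.\<close>

definition local_lift ::
  "'w proj set \<Rightarrow> 'a \<Rightarrow> nat \<Rightarrow> (complex^'v \<Rightarrow> complex)^'m \<Rightarrow> (complex^'v \<Rightarrow> complex) \<Rightarrow> bool" where
  "local_lift U \<sigma> D f k \<longleftrightarrow> hpoly D k \<and> (\<forall>i. hpoly D (f $ i)) \<and> basic_open k \<subseteq> preimage U \<and>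
     \<psi> (basic_open k) (fraction f k) = res G (X \<inter> preimage U) (X \<inter> basic_open k) \<sigma>"

text \<open>A nonzero constant k would have all of projective space as its locus, including the
  centre, which lies in no preimage.\<close>

lemma local_lift_degree:
  assumes "local_lift U \<sigma> D f k" "k x \<noteq> 0"
  shows "D \<ge> 1"
proof (rule ccontr)
  assume "\<not> D \<ge> 1"
  then have "D = 0" by simp
  then have k: "hpoly 0 k" "basic_open k \<subseteq> preimage U" using assms(1) by (auto simp: local_lift_def)
  have "k q = k x" using hpoly_scale[OF k(1), of 0 q] hpoly_scale[OF k(1), of 0 x] by simp
  then have "q \<in> cone_over (preimage U)"
    using k(2) assms(2) q_nonzero unfolding basic_open_subset_iff[OF k(1)] by simp
  then show False by (simp add: cone_over_projection_preimage) (simp add: cone_over_def)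
qed

text \<open>The components of a local lift receive the product of their denominators as common
  denominator; a further factor \<open>e\<close> shrinks the locus of k into the set on which the
  lift is defined.\<close>

lemma local_lift_exists:
  assumes U: "openin zariski U" and \<sigma>: "\<sigma> \<in> carrier (sec G (X \<inter> preimage U))"
    and x: "x \<in> cone_over (preimage U)"
  shows "\<exists>D f k. local_lift U \<sigma> D f k \<and> k x \<noteq> 0"
proof -
  have x0: "x \<noteq> 0" and xU: "abs_proj x \<in> preimage U" using x by (auto simp: cone_over_def)
  have "\<exists>V. openin zariski V \<and> abs_proj x \<in> V \<and> V \<subseteq> preimage U \<and>
      res G (X \<inter> preimage U) (X \<inter> V) \<sigma> \<in> \<psi> V ` vsections 0 V"
    using exact[unfolded short_exact_def openin_variety_UNIV carrier_twist_power res_twist_power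
        sec_inclusion_pushforward, THEN conjunct2, THEN conjunct2, THEN conjunct2, THEN conjunct2,
        THEN spec, THEN mp, OF openin_projection_preimage[OF U], THEN bspec, OF \<sigma>, THEN bspec, OF xU] .
  then obtain V s where V: "openin zariski V" "abs_proj x \<in> V" "V \<subseteq> preimage U"
    and s: "s \<in> vsections 0 V" "res G (X \<inter> preimage U) (X \<inter> V) \<sigma> = \<psi> V s" by blast
  have xV: "x \<in> cone_over V" using x0 V(2) by (simp add: cone_over_def)
  have "\<exists>a f h. hpoly a f \<and> hpoly a h \<and> h x \<noteq> 0 \<and> (\<forall>x'. x' \<noteq> 0 \<longrightarrow> h x' \<noteq> 0 \<longrightarrow> (s $ i) x' = f x' / h x')" for i
  proof -
    have "s $ i \<in> twist_sections UNIV 0 V" using s(1) by simp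
    then obtain a b f h where *: "hpoly a f" "hpoly b h" "int a - int b = 0" "h x \<noteq> 0"
      "\<And>x'. x' \<noteq> 0 \<Longrightarrow> h x' \<noteq> 0 \<Longrightarrow> (s $ i) x' = f x' / h x'"
      using twist_sections_local[OF _ xV] by metis
    then have "a = b" by simp
    with * show ?thesis by blast
  qed
  then obtain a f h where fh: "\<And>i. hpoly (a i) (f i)" "\<And>i. hpoly (a i) (h i)" "\<And>i. h i x \<noteq> 0"
    "\<And>i x'. x' \<noteq> 0 \<Longrightarrow> h i x' \<noteq> 0 \<Longrightarrow> (s $ i) x' = f i x' / h i x'" by metis
  obtain c e where e: "hpoly c e" "e x \<noteq> 0" "basic_open e \<subseteq> V"
    using V(1,2) x0 unfolding openin_zariski by blast
  define k where "k = (\<lambda>x. e x * (\<Prod>j\<in>UNIV. h j x))"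
  define F where "F = (\<chi> i. (\<lambda>x. e x * (f i x * (\<Prod>j\<in>UNIV - {i}. h j x))))"
  let ?D = "c + (\<Sum>j\<in>UNIV. a j)"
  have k: "hpoly ?D k" unfolding k_def by (intro hpoly_mult e hpoly_prod fh) simp
  have F: "hpoly ?D (F $ i)" for i
  proof -
    have "hpoly (c + (a i + (\<Sum>j\<in>UNIV - {i}. a j))) (F $ i)"
      unfolding F_def vec_lambda_beta by (intro hpoly_mult e hpoly_prod fh) simp
    then show ?thesis by (simp add: sum.remove[of UNIV i])
  qed
  have kV: "basic_open k \<subseteq> V"
    using e(3) unfolding basic_open_subset_iff[OF k] basic_open_subset_iff[OF e(1)] by (auto simp: k_def)
  have "(F $ i) x' / k x' = (s $ i) x'" if "x' \<noteq> 0" "k x' \<noteq> 0" for x' i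
  proof -
    have nz: "e x' \<noteq> 0" "h i x' \<noteq> 0" "(\<Prod>j\<in>UNIV - {i}. h j x') \<noteq> 0"
      using that(2) by (auto simp: k_def)
    have "k x' = e x' * (h i x' * (\<Prod>j\<in>UNIV - {i}. h j x'))"
      unfolding k_def by (simp add: prod.remove[of UNIV i])
    then show ?thesis using nz fh(4)[OF that(1) nz(2)] by (simp add: F_def)
  qed
  then have "fraction F k = vrestrict (basic_open k) s"
    by (simp add: vec_eq_iff fun_eq_iff fraction_def vrestrict_def restrict_cone_def cone_over_basic_open[OF k])
  then have "\<psi> (basic_open k) (fraction F k) = res G (X \<inter> preimage U) (X \<inter> basic_open k) \<sigma>"
    using \<psi>_restrict[OF V(1) openin_basic_open[OF k] kV s(1)]
      G_res_comp[OF openin_projection_preimage[OF U] V(1) openin_basic_open[OF k] kV V(3) \<sigma>]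
    by (simp add: s(2))
  then have "local_lift U \<sigma> ?D F k"
    using k F kV V(3) unfolding local_lift_def by blast
  moreover have "k x \<noteq> 0" using e(2) fh(3) by (simp add: k_def)
  ultimately show ?thesis by blast
qed

lemma local_lift_restrict:
  assumes U: "openin zariski U" and \<sigma>: "\<sigma> \<in> carrier (sec G (X \<inter> preimage U))"
    and "local_lift U \<sigma> D f k" and W: "openin zariski W" "W \<subseteq> basic_open k"
  shows "\<psi> W (vrestrict W (fraction f k)) = res G (X \<inter> preimage U) (X \<inter> W) \<sigma>"
    and "vrestrict W (fraction f k) \<in> vsections 0 W"
proof -
  have k: "hpoly D k" "\<And>i. hpoly D (f $ i)" "basic_open k \<subseteq> preimage U"
    and eq: "\<psi> (basic_open k) (fraction f k) = res G (X \<inter> preimage U) (X \<inter> basic_open k) \<sigma>"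
    using assms(3) by (auto simp: local_lift_def)
  note o = openin_basic_open[OF k(1)]
  show "\<psi> W (vrestrict W (fraction f k)) = res G (X \<inter> preimage U) (X \<inter> W) \<sigma>"
    using \<psi>_restrict[OF o W fraction_vsections[OF k(1,2)]]
      G_res_comp[OF openin_projection_preimage[OF U] o W(1) W(2) k(3) \<sigma>] eq by simp
  show "vrestrict W (fraction f k) \<in> vsections 0 W"
    by (rule vsections_restrict[OF fraction_vsections[OF k(1,2)] W])
qed

text \<open>Two lifts of the same \<sigma> have equal images under \<psi> on the overlap of their
  loci, hence differ there by the image of \<alpha>. This is the local hypothesis of
  \<open>compatible_power\<close>.\<close>

lemma good_local_lift:
  assumes U: "openin zariski U" and \<sigma>: "\<sigma> \<in> carrier (sec G (X \<inter> preimage U))"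
    and lift: "local_lift U \<sigma> D f k"
  shows "good (local_lift U \<sigma>) (Suc CARD('m) * D)
    (\<chi> i. (\<lambda>x. k x ^ CARD('m) * (f $ i) x)) (\<lambda>x. k x ^ Suc CARD('m))"
proof -
  have k: "hpoly D k" and f: "\<And>i. hpoly D (f $ i)" using lift by (auto simp: local_lift_def)
  have "hpoly (Suc CARD('m) * D) (\<lambda>x. k x ^ CARD('m) * (f $ i) x)" for i
    using hpoly_mult[OF hpoly_power[OF k, of "CARD('m)"] f] by (simp add: add.commute)
  moreover have "compatible (\<chi> i. (\<lambda>x. k x ^ CARD('m) * (f $ i) x)) (\<lambda>x. k x ^ Suc CARD('m)) f' k'"
    if lift': "local_lift U \<sigma> E f' k'" for E f' k'
  proof -
    have k': "hpoly E k'" and f': "\<And>i. hpoly E (f' $ i)" using lift' by (auto simp: local_lift_def)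
    show ?thesis
    proof (rule compatible_power[OF k f k' f'])
      fix y t assume y: "y \<noteq> 0" and nz: "k (line y t) \<noteq> 0" "k' (line y t) \<noteq> 0"
      let ?W = "basic_open k \<inter> basic_open k'"
      have W: "openin zariski ?W"
        by (rule openin_Int[OF openin_basic_open[OF k] openin_basic_open[OF k']])
      have coneW: "x \<in> cone_over ?W \<longleftrightarrow> x \<noteq> 0 \<and> k x \<noteq> 0 \<and> k' x \<noteq> 0" for x
        by (auto simp: cone_over_Int cone_over_basic_open[OF k] cone_over_basic_open[OF k'])
      note r = local_lift_restrict[OF U \<sigma> lift W Int_lower1]
      note r' = local_lift_restrict[OF U \<sigma> lift' W Int_lower2]
      have "\<psi> ?W (vrestrict ?W (fraction f k)) = \<psi> ?W (vrestrict ?W (fraction f' k'))"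
        unfolding r(1) r'(1) ..
      then have "locally_in_image ?W
          (\<lambda>x. \<chi> i. (vrestrict ?W (fraction f k) $ i) x - (vrestrict ?W (fraction f' k') $ i) x)"
        unfolding \<psi>_eq_iff[OF W r(2) r'(2)] .
      moreover have tW: "line y t \<in> cone_over ?W" using nz line_nonzero[OF y] coneW by simp
      ultimately obtain u where u: "isCont u t" and ev: "\<forall>\<^sub>F s in nhds t.
          (\<chi> i. (vrestrict ?W (fraction f k) $ i) (line y s) - (vrestrict ?W (fraction f' k') $ i) (line y s))
            = \<alpha> (line y s) *v u s"
        using locally_in_image_line[OF _ y] by blast
      from ev eventually_line_cone[OF W y tW]
      have "\<forall>\<^sub>F s in nhds t. k (line y s) \<noteq> 0 \<and> k' (line y s) \<noteq> 0 \<and>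
        (\<chi> i. (f $ i) (line y s) / k (line y s) - (f' $ i) (line y s) / k' (line y s))
          = \<alpha> (line y s) *v u s"
      proof eventually_elim
        case (elim s)
        then have nz: "line y s \<noteq> 0" "k (line y s) \<noteq> 0" "k' (line y s) \<noteq> 0" using coneW by auto
        then show ?case
          using elim by (simp add: vrestrict_apply fraction_apply[OF k] fraction_apply[OF k'])
      qed
      then show "\<exists>u. isCont u t \<and> (\<forall>\<^sub>F s in nhds t. k (line y s) \<noteq> 0 \<and> k' (line y s) \<noteq> 0 \<and>
        (\<chi> i. (f $ i) (line y s) / k (line y s) - (f' $ i) (line y s) / k' (line y s))
          = \<alpha> (line y s) *v u s)"
        using u by (intro exI conjI)
    qed
  qed
  ultimately show ?thesis
    unfolding good_def using hpoly_power[OF k, of "Suc CARD('m)"] by simp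
qed

text \<open>The image of the candidate must equal \<sigma> over the whole preimage of V, also at
  points where the combined denominator vanishes. It is therefore compared with every local lift on
  the locus of that lift, which is why \<open>good\<close> ranges over the whole family.\<close>

lemma \<Phi>_locally_surjective:
  assumes U: "openin zariski U" and \<sigma>: "\<sigma> \<in> carrier (sec G (X \<inter> preimage U))"
    and y0: "y0 \<in> cone_over U"
  shows "\<exists>V s. openin zariski V \<and> y0 \<in> cone_over V \<and> V \<subseteq> U \<and> s \<in> vsections 0 V \<and>
    \<Phi> V s = res G (X \<inter> preimage U) (X \<inter> preimage V) \<sigma>"
proof -
  let ?loc = "local_lift U \<sigma>"
  have y0_nz: "y0 \<noteq> 0" using y0 by (simp add: cone_over_def)
  \<comment> \<open>The eigenvalues are the points that the denominator has to avoid; 0 is added to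
    supply \<open>c0\<close> in \<open>good_solution\<close>.\<close>
  let ?I = "insert 0 {c. \<exists>x. x \<noteq> 0 \<and> T y0 *v x = c *s x}"
  have "finite ?I" using finite_eigenvalues by simp
  moreover have ex: "\<exists>D f k. good ?loc D f k \<and> k (line y0 t) \<noteq> 0" for t
  proof -
    obtain D f k where lift: "?loc D f k" "k (line y0 t) \<noteq> 0"
      using local_lift_exists[OF U \<sigma>, of "line y0 t"] y0 by (auto simp: line_in_cone)
    have "k (line y0 t) ^ Suc CARD('m) \<noteq> 0" using lift(2) by simp
    with good_local_lift[OF U \<sigma> lift(1)] show ?thesis by (intro exI conjI)
  qed
  ultimately have "\<exists>D f k. good ?loc D f k \<and> (\<forall>t\<in>?I. k (line y0 t) \<noteq> 0)"
    by (intro good_nonvanishing_on_finite y0_nz)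
  then obtain D f k where good: "good ?loc D f k" "\<forall>t\<in>?I. k (line y0 t) \<noteq> 0"
    by (elim exE conjE)
  have "\<exists>e \<Delta> S. hpoly e \<Delta> \<and> (\<forall>i. hpoly e (S $ i)) \<and> \<Delta> y0 \<noteq> 0 \<and>
    (\<forall>y E f' k'. y \<noteq> 0 \<longrightarrow> \<Delta> y \<noteq> 0 \<longrightarrow> ?loc E f' k' \<longrightarrow>
      pact (tpoly k' y ^ CARD('m)) (T y) (act k' y (\<chi> i. (S $ i) y) - \<Delta> y *s ev f' y) = 0)"
  proof (rule good_solution[OF good(1) y0_nz])
    show "k (line y0 0) \<noteq> 0" using good(2) by simp
    show "k (line y0 c) \<noteq> 0" if "x \<noteq> 0" "T y0 *v x = c *s x" for c x
      using bspec[OF good(2), of c] that by blast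
  qed
  then obtain e \<Delta> S where \<Delta>: "hpoly e \<Delta>" and S': "\<forall>i. hpoly e (S $ i)" and \<Delta>0: "\<Delta> y0 \<noteq> 0"
    and ann: "\<forall>y E f' k'. y \<noteq> 0 \<longrightarrow> \<Delta> y \<noteq> 0 \<longrightarrow> ?loc E f' k' \<longrightarrow>
      pact (tpoly k' y ^ CARD('m)) (T y) (act k' y (\<chi> i. (S $ i) y) - \<Delta> y *s ev f' y) = 0"
    by (elim exE conjE)
  note S = S'[rule_format]
  define V where "V = basic_open \<Delta> \<inter> U"
  have V: "openin zariski V" "V \<subseteq> U"
    unfolding V_def by (auto intro: openin_Int[OF openin_basic_open[OF \<Delta>] U])
  have coneV: "y \<in> cone_over V \<longleftrightarrow> \<Delta> y \<noteq> 0 \<and> y \<in> cone_over U" for y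
    by (auto simp: V_def cone_over_Int cone_over_basic_open[OF \<Delta>]) (simp add: cone_over_def)
  \<comment> \<open>The factor M undoes the N built into \<open>ev\<close>.\<close>
  define s where "s = (\<chi> i. restrict_cone V (\<lambda>y. (M *v (\<chi> j. (S $ j) y)) $ i / \<Delta> y))"
  have s: "s \<in> vsections 0 V"
  proof -
    have "hpoly e (\<lambda>y. (M *v (\<chi> j. (S $ j) y)) $ i)" for i
      by (simp add: matrix_vector_nth hpoly_sum hpoly_cmult S)
    then have "restrict_cone V (\<lambda>y. (M *v (\<chi> j. (S $ j) y)) $ i / \<Delta> y) \<in> twist_sections UNIV 0 V" for i
      by (rule twist_sections_quotient[OF V(1) _ \<Delta>]) (simp_all add: coneV)
    then show ?thesis by (simp add: s_def)
  qed
  let ?\<V> = "{basic_open k' \<inter> preimage V |E f' k'. ?loc E f' k'}"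
  have oPV: "openin zariski (preimage V)" by (rule openin_projection_preimage[OF V(1)])
  have oPU: "openin zariski (preimage U)" by (rule openin_projection_preimage[OF U])
  have \<sigma>V: "res G (X \<inter> preimage U) (X \<inter> preimage V) \<sigma> \<in> carrier (sec G (X \<inter> preimage V))"
    by (rule G_res_closed[OF oPU oPV preimage_mono[OF V(2)] \<sigma>])
  have "\<Phi> V s = res G (X \<inter> preimage U) (X \<inter> preimage V) \<sigma>"
  proof (rule G_separated[of ?\<V> "preimage V"])
    show "openin zariski W" if W: "W \<in> ?\<V>" for W
    proof -
      obtain E f' k' where "W = basic_open k' \<inter> preimage V" "?loc E f' k'" using W by blast
      then show ?thesis using openin_Int[OF openin_basic_open oPV] by (auto simp: local_lift_def)
    qed
    show "preimage V = \<Union>?\<V>"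
    proof
      show "preimage V \<subseteq> \<Union>?\<V>"
      proof
        fix p assume p: "p \<in> preimage V"
        obtain x where x: "x \<noteq> 0" "p = abs_proj x" using proj_cases by blast
        then have "x \<in> cone_over (preimage U)"
          using p preimage_mono[OF V(2)] by (auto simp: cone_over_def)
        then obtain E f' k' where "?loc E f' k'" "k' x \<noteq> 0" using local_lift_exists[OF U \<sigma>] by blast
        then show "p \<in> \<Union>?\<V>" using p x by (auto simp: basic_open_def)
      qed
    qed blast
    show "\<Phi> V s \<in> carrier (sec G (X \<inter> preimage V))" by (rule \<Phi>_closed[OF V(1) s])
    show "res G (X \<inter> preimage U) (X \<inter> preimage V) \<sigma> \<in> carrier (sec G (X \<inter> preimage V))"
      by (rule \<sigma>V)
    fix W assume "W \<in> ?\<V>"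
    then obtain E f' k' where W: "W = basic_open k' \<inter> preimage V" and lift: "?loc E f' k'" by blast
    have k': "hpoly E k'" and f': "\<And>i. hpoly E (f' $ i)" using lift by (auto simp: local_lift_def)
    have oW: "openin zariski W" unfolding W by (rule openin_Int[OF openin_basic_open[OF k'] oPV])
    have WV: "W \<subseteq> preimage V" "W \<subseteq> basic_open k'" unfolding W by auto
    have coneW: "x \<in> cone_over W \<longleftrightarrow> x \<noteq> 0 \<and> k' x \<noteq> 0 \<and> A *v x \<in> cone_over V" for x
      by (auto simp: W cone_over_Int cone_over_basic_open[OF k'] cone_over_projection_preimage)
    note r = local_lift_restrict[OF U \<sigma> lift oW WV(2)]
    have ps: "pullback s \<in> vsections 0 (preimage V)" by (rule pullback_vsections[OF V(1) s])
    have vs: "vrestrict W (pullback s) \<in> vsections 0 W" by (rule vsections_restrict[OF ps oW WV(1)])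
    have "locally_in_image W
        (\<lambda>x. \<chi> i. (vrestrict W (pullback s) $ i) x - (vrestrict W (fraction f' k') $ i) x)"
      unfolding locally_in_image_def
    proof
      fix x assume x: "x \<in> cone_over W"
      then have "E \<ge> 1" using local_lift_degree[OF lift] coneW by blast
      moreover have "pact (tpoly k' y ^ CARD('m)) (T y) (act k' y (\<chi> i. (S $ i) y) - \<Delta> y *s ev f' y) = 0"
        if "y \<noteq> 0" "\<Delta> y \<noteq> 0" for y
        by (rule ann[rule_format, OF that lift])
      ultimately have "\<exists>n Q. (\<forall>i. hpoly n (Q $ i)) \<and> Suc n = e + Suc CARD('m) * E \<and>
        (\<forall>x. A *v x \<noteq> 0 \<longrightarrow> \<Delta> (A *v x) \<noteq> 0 \<longrightarrow> k' x \<noteq> 0 \<longrightarrow>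
          (\<chi> i. (M *v (\<chi> j. (S $ j) (A *v x))) $ i / \<Delta> (A *v x) - (f' $ i) x / k' x)
            = \<alpha> x *v (\<chi> i. (Q $ i) x / (\<Delta> (A *v x) * k' x ^ Suc CARD('m))))"
        by (rule solution_quotient[OF \<Delta> S _ k' f'])
      then obtain n Q where Q': "\<forall>i. hpoly n (Q $ i)" and n: "Suc n = e + Suc CARD('m) * E"
        and eq: "\<forall>x. A *v x \<noteq> 0 \<longrightarrow> \<Delta> (A *v x) \<noteq> 0 \<longrightarrow> k' x \<noteq> 0 \<longrightarrow>
          (\<chi> i. (M *v (\<chi> j. (S $ j) (A *v x))) $ i / \<Delta> (A *v x) - (f' $ i) x / k' x)
            = \<alpha> x *v (\<chi> i. (Q $ i) x / (\<Delta> (A *v x) * k' x ^ Suc CARD('m)))"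
        by (elim exE conjE)
      note Q = Q'[rule_format]
      let ?h = "\<lambda>x. \<Delta> (A *v x) * k' x ^ Suc CARD('m)"
      have h: "hpoly (e + Suc CARD('m) * E) ?h"
        by (rule hpoly_mult[OF hpoly_compose_linear[OF \<Delta>] hpoly_power[OF k']])
      \<comment> \<open>The explicit quotient is defined on all of W at once, so W itself serves as
        the neighbourhood of each of its points.\<close>
      define w where "w = (\<chi> i. restrict_cone W (\<lambda>x. (Q $ i) x / ?h x))"
      have "restrict_cone W (\<lambda>x. (Q $ i) x / ?h x) \<in> twist_sections UNIV (-1) W" for i
      proof (rule twist_sections_quotient[OF oW Q h])
        show "int n - int (e + Suc CARD('m) * E) = - 1" unfolding n[symmetric] by simp
        show "?h x \<noteq> 0" if "x \<in> cone_over W" for x using that coneW coneV by simp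
      qed
      then have "w \<in> vsections (-1) W" by (simp add: w_def)
      moreover have "(\<chi> i. (vrestrict W (pullback s) $ i) x' - (vrestrict W (fraction f' k') $ i) x')
          = \<alpha> x' *v (\<chi> i. (w $ i) x')" if x': "x' \<in> cone_over W" for x'
      proof -
        have nz: "x' \<noteq> 0" "k' x' \<noteq> 0" "A *v x' \<in> cone_over V" "\<Delta> (A *v x') \<noteq> 0"
          using x' coneW coneV by auto
        then have "A *v x' \<noteq> 0" by (simp add: cone_over_def)
        then show ?thesis
          using eq[rule_format, OF _ nz(4,2)] nz x'
          by (simp add: vrestrict_apply fraction_apply[OF k'] pullback_def s_def w_def restrict_cone_def)
      qed
      ultimately show "\<exists>V h. openin zariski V \<and> x \<in> cone_over V \<and> V \<subseteq> W \<and> h \<in> vsections (-1) V \<and>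
        (\<forall>x'\<in>cone_over V. (\<chi> i. (vrestrict W (pullback s) $ i) x' - (vrestrict W (fraction f' k') $ i) x')
          = \<alpha> x' *v (\<chi> i. (h $ i) x'))"
        using oW x by (intro exI[of _ W] exI[of _ w] conjI ballI) auto
    qed
    then have "\<psi> W (vrestrict W (pullback s)) = \<psi> W (vrestrict W (fraction f' k'))"
      unfolding \<psi>_eq_iff[OF oW vs r(2)] .
    then show "res G (X \<inter> preimage V) (X \<inter> W) (\<Phi> V s) =
        res G (X \<inter> preimage V) (X \<inter> W) (res G (X \<inter> preimage U) (X \<inter> preimage V) \<sigma>)"
      unfolding r(1) \<Phi>_def \<psi>_restrict[OF oPV oW WV(1) ps]
        G_res_comp[OF oPU oPV oW WV(1) preimage_mono[OF V(2)] \<sigma>] .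
  qed
  moreover have "y0 \<in> cone_over V" using y0 \<Delta>0 coneV by simp
  ultimately show ?thesis using V s by blast
qed

text \<open>Local preimages are chosen around each point. Over intersections they have the same
  image, hence agree by injectivity, and so glue to a section of the trivial bundle.\<close>

lemma \<Phi>_surjective:
  assumes U: "openin zariski U" and \<sigma>: "\<sigma> \<in> carrier (sec G (X \<inter> preimage U))"
  shows "\<exists>s\<in>vsections 0 U. \<Phi> U s = \<sigma>"
proof -
  let ?res = "\<lambda>V. res G (X \<inter> preimage U) (X \<inter> preimage V) \<sigma>"
  have "\<forall>y. \<exists>V s. y \<in> cone_over U \<longrightarrow> openin zariski V \<and> y \<in> cone_over V \<and> V \<subseteq> U \<and>
      s \<in> vsections 0 V \<and> \<Phi> V s = ?res V"
    using \<Phi>_locally_surjective[OF U \<sigma>] by blast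
  from choice[OF this] obtain V where "\<forall>y. \<exists>s. y \<in> cone_over U \<longrightarrow> openin zariski (V y) \<and>
      y \<in> cone_over (V y) \<and> V y \<subseteq> U \<and> s \<in> vsections 0 (V y) \<and> \<Phi> (V y) s = ?res (V y)"
    by (rule exE)
  from choice[OF this] obtain t where Vt: "\<forall>y. y \<in> cone_over U \<longrightarrow> openin zariski (V y) \<and>
      y \<in> cone_over (V y) \<and> V y \<subseteq> U \<and> t y \<in> vsections 0 (V y) \<and> \<Phi> (V y) (t y) = ?res (V y)"
    by (rule exE)
  have V: "\<And>y. y \<in> cone_over U \<Longrightarrow> openin zariski (V y)"
      "\<And>y. y \<in> cone_over U \<Longrightarrow> y \<in> cone_over (V y)" "\<And>y. y \<in> cone_over U \<Longrightarrow> V y \<subseteq> U"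
    and t: "\<And>y. y \<in> cone_over U \<Longrightarrow> t y \<in> vsections 0 (V y)"
      "\<And>y. y \<in> cone_over U \<Longrightarrow> \<Phi> (V y) (t y) = ?res (V y)"
    using Vt by blast+
  note o = openin_projection_preimage
  have agree: "(t y $ i) x = (t z $ i) x"
    if yz: "y \<in> cone_over U" "z \<in> cone_over U" and x: "x \<in> cone_over (V y)" "x \<in> cone_over (V z)" for x y z i
  proof -
    let ?W = "V y \<inter> V z"
    have W: "openin zariski ?W" by (rule openin_Int[OF V(1)[OF yz(1)] V(1)[OF yz(2)]])
    have WU: "?W \<subseteq> U" using V(3) yz(1) by blast
    have *: "\<Phi> ?W (vrestrict ?W (t y')) = ?res ?W"
      if y': "y' \<in> cone_over U" and sub: "?W \<subseteq> V y'" for y'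
      unfolding \<Phi>_restrict[OF V(1)[OF y'] W sub t(1)[OF y']] t(2)[OF y']
      by (rule G_res_comp[OF o[OF U] o[OF V(1)[OF y']] o[OF W] preimage_mono[OF sub]
          preimage_mono[OF V(3)[OF y']] \<sigma>])
    have "vrestrict ?W (t y) = vrestrict ?W (t z)"
    proof (rule \<Phi>_injective[OF W])
      show "vrestrict ?W (t y) \<in> vsections 0 ?W"
        by (rule vsections_restrict[OF t(1)[OF yz(1)] W Int_lower1])
      show "vrestrict ?W (t z) \<in> vsections 0 ?W"
        by (rule vsections_restrict[OF t(1)[OF yz(2)] W Int_lower2])
      show "\<Phi> ?W (vrestrict ?W (t y)) = \<Phi> ?W (vrestrict ?W (t z))"
        unfolding *[OF yz(1) Int_lower1] *[OF yz(2) Int_lower2] ..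
    qed
    then have "(vrestrict ?W (t y) $ i) x = (vrestrict ?W (t z) $ i) x" by simp
    then show ?thesis using x by (simp add: vrestrict_apply cone_over_Int)
  qed
  \<comment> \<open>The value at y is taken from the piece chosen at y itself; the agreement on
    overlaps then identifies s with each piece on its whole domain.\<close>
  define s where "s = (\<chi> i. (\<lambda>y. if y \<in> cone_over U then (t y $ i) y else 0))"
  have s_eq: "(s $ i) x = (t y $ i) x" if "y \<in> cone_over U" "x \<in> cone_over (V y)" for x y i
  proof -
    have "x \<in> cone_over U" using that cone_over_mono[OF V(3)[OF that(1)]] by blast
    then show ?thesis using agree[of x y x i] that V(2) by (simp add: s_def)
  qed
  have "s $ i \<in> twist_sections UNIV 0 U" for i
  proof (rule twist_sections_locally)
    show "(s $ i) x = 0" if "x \<notin> cone_over U" for x using that by (simp add: s_def)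
    show "\<exists>V t. x \<in> cone_over V \<and> V \<subseteq> U \<and> t \<in> twist_sections UNIV 0 V \<and>
        (\<forall>x'\<in>cone_over V. (s $ i) x' = t x')" if x: "x \<in> cone_over U" for x
      using V(2,3)[OF x] t(1)[OF x] s_eq[OF x] by (intro exI[of _ "V x"] exI[of _ "t x $ i"]) simp
  qed
  then have s: "s \<in> vsections 0 U" by simp
  have "\<Phi> U s = \<sigma>"
  proof (rule G_separated[of "(\<lambda>y. preimage (V y)) ` cone_over U" "preimage U"])
    show "openin zariski W" if "W \<in> (\<lambda>y. preimage (V y)) ` cone_over U" for W
      using that o[OF V(1)] by blast
    show "preimage U = \<Union>((\<lambda>y. preimage (V y)) ` cone_over U)"
    proof
      show "\<Union>((\<lambda>y. preimage (V y)) ` cone_over U) \<subseteq> preimage U"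
        using preimage_mono[OF V(3)] by (rule UN_least)
      show "preimage U \<subseteq> \<Union>((\<lambda>y. preimage (V y)) ` cone_over U)"
        unfolding projection_preimage_def using V(2) by auto
    qed
    show "\<Phi> U s \<in> carrier (sec G (X \<inter> preimage U))" by (rule \<Phi>_closed[OF U s])
    show "\<sigma> \<in> carrier (sec G (X \<inter> preimage U))" by (rule \<sigma>)
    fix W assume "W \<in> (\<lambda>y. preimage (V y)) ` cone_over U"
    then obtain y where y: "y \<in> cone_over U" "W = preimage (V y)" by blast
    have "vrestrict (V y) s = t y"
    proof (rule vsections_eqI[OF _ t(1)[OF y(1)]])
      show "vrestrict (V y) s \<in> vsections 0 (V y)"
        by (rule vsections_restrict[OF s V(1)[OF y(1)] V(3)[OF y(1)]])
      show "(vrestrict (V y) s $ i) x = (t y $ i) x" if "x \<in> cone_over (V y)" for x i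
        using that s_eq[OF y(1)] by (simp add: vrestrict_apply)
    qed
    then show "res G (X \<inter> preimage U) (X \<inter> W) (\<Phi> U s) = res G (X \<inter> preimage U) (X \<inter> W) \<sigma>"
      using \<Phi>_restrict[OF U V(1)[OF y(1)] V(3)[OF y(1)] s] t(2)[OF y(1)] unfolding y(2) by simp
  qed
  with s show ?thesis by blast
qed

lemma \<Phi>_bij:
  assumes "openin zariski U"
  shows "bij_betw (\<Phi> U) (vsections 0 U) (carrier (sec G (X \<inter> preimage U)))"
proof (rule bij_betw_imageI)
  show "inj_on (\<Phi> U) (vsections 0 U)" by (rule inj_onI) (rule \<Phi>_injective[OF assms])
  show "\<Phi> U ` vsections 0 U = carrier (sec G (X \<inter> preimage U))"
  proof
    show "\<Phi> U ` vsections 0 U \<subseteq> carrier (sec G (X \<inter> preimage U))"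
      using \<Phi>_closed[OF assms] by (rule image_subsetI)
    show "carrier (sec G (X \<inter> preimage U)) \<subseteq> \<Phi> U ` vsections 0 U"
      using \<Phi>_surjective[OF assms] by (metis (mono_tags) image_eqI subsetI)
  qed
qed

end


section \<open>The isomorphism of sheaves\<close>

context cokernel_sheaf
begin

text \<open>X avoids the centre, so A does not vanish on representatives of its points, and
  membership of the image point in U becomes a condition on cones.\<close>

lemma preim_projection: "preim (variety X) (proj_map A) U = X \<inter> preimage U"
proof -
  have "A *v rep_proj p \<noteq> 0" if p: "p \<in> X" for p
  proof
    assume "A *v rep_proj p = 0"
    then have "rep_proj p = \<tau> (rep_proj p) *s q" using decomposition[of "rep_proj p"] by simp
    then have "abs_proj q = abs_proj (rep_proj p)"
      using abs_proj_eq_iff[OF q_nonzero rep_proj_nonzero] by blast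
    then show False using center p by simp
  qed
  then show ?thesis
    by (auto simp: preim_def topo_variety projection_preimage_def proj_map_def cone_over_def)
qed

lemma \<Phi>_add:
  assumes U: "openin zariski U" and s: "s \<in> vsections 0 U" and t: "t \<in> vsections 0 U"
  shows "\<Phi> U (\<chi> i. (\<lambda>x. (s $ i) x + (t $ i) x)) = \<Phi> U s \<oplus>\<^bsub>sec G (X \<inter> preimage U)\<^esub> \<Phi> U t"
  using \<psi>_add[OF openin_projection_preimage[OF U] pullback_vsections[OF U s] pullback_vsections[OF U t]]
  by (simp add: \<Phi>_def pullback_def)

lemma \<Phi>_smult:
  assumes U: "openin zariski U" and r: "r \<in> twist_sections UNIV 0 U" and s: "s \<in> vsections 0 U"
  shows "\<Phi> U (\<chi> i. (\<lambda>x. r x * (s $ i) x)) =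
    restrict_cone (X \<inter> preimage U) (\<lambda>x. r (A *v x)) \<odot>\<^bsub>sec G (X \<inter> preimage U)\<^esub> \<Phi> U s"
  using \<psi>_smult[OF openin_projection_preimage[OF U] twist_sections_compose[OF r U] pullback_vsections[OF U s]]
  by (simp add: \<Phi>_def pullback_def)

text \<open>The isomorphism is asked from the direct image to the trivial bundle, so it is the
  inverse of \<Phi> on each open set; its compatibilities follow from those of \<Phi> by uniqueness
  of preimages.\<close>

theorem direct_image_trivial:
  "sheaf_isomorphic (variety UNIV) (projection_pushforward A X G)
    (sheaf_power (twist UNIV 0) :: (_, _, (complex^'w \<Rightarrow> complex)^'m) mod_presheaf)"
proof -
  define \<phi> where "\<phi> U = inv_into (vsections 0 U) (\<Phi> U)" for U
  have bij: "bij_betw (\<phi> U) (carrier (sec G (X \<inter> preimage U))) (vsections 0 U)"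
    if "openin zariski U" for U
    unfolding \<phi>_def by (rule bij_betw_inv_into[OF \<Phi>_bij[OF that]])
  have in_sections: "\<phi> U \<sigma> \<in> vsections 0 U"
    if "openin zariski U" "\<sigma> \<in> carrier (sec G (X \<inter> preimage U))" for U \<sigma>
    using bij_betw_apply[OF bij] that by blast
  have \<Phi>_\<phi>: "\<Phi> U (\<phi> U \<sigma>) = \<sigma>"
    if "openin zariski U" "\<sigma> \<in> carrier (sec G (X \<inter> preimage U))" for U \<sigma>
    unfolding \<phi>_def by (rule bij_betw_inv_into_right[OF \<Phi>_bij[OF that(1)] that(2)])
  have \<phi>_eqI: "\<phi> U \<sigma> = s"
    if "openin zariski U" "s \<in> vsections 0 U" "\<Phi> U s = \<sigma>" for U \<sigma> s
    unfolding \<phi>_def using bij_betw_inv_into_left[OF \<Phi>_bij[OF that(1)] that(2)] that(3) by simp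
  have ring: "carrier (rsec (variety UNIV) U) = twist_sections UNIV 0 U" for U :: "'w proj set"
    by (simp add: variety_def)
  have "sheaf_hom (variety UNIV) (projection_pushforward A X G)
    (sheaf_power (twist UNIV 0) :: (_, _, (complex^'w \<Rightarrow> complex)^'m) mod_presheaf) \<phi>"
    unfolding sheaf_hom_def openin_variety_UNIV carrier_twist_power add_twist_power ring
      smult_twist_power res_twist_power sec_projection_pushforward preim_projection
  proof (intro allI impI conjI ballI)
    fix U :: "'w proj set" assume U: "openin zariski U"
    show "\<phi> U s \<in> vsections 0 U" if "s \<in> carrier (sec G (X \<inter> preimage U))" for s
      by (rule in_sections[OF U that])
    show "\<phi> U (s \<oplus>\<^bsub>sec G (X \<inter> preimage U)\<^esub> t) = (\<chi> i. (\<lambda>x. (\<phi> U s $ i) x + (\<phi> U t $ i) x))"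
      if s: "s \<in> carrier (sec G (X \<inter> preimage U))" and t: "t \<in> carrier (sec G (X \<inter> preimage U))" for s t
    proof (rule \<phi>_eqI[OF U])
      show "(\<chi> i. (\<lambda>x. (\<phi> U s $ i) x + (\<phi> U t $ i) x)) \<in> vsections 0 U"
        using in_sections[OF U s] in_sections[OF U t] by (simp add: twist_sections_add)
      show "\<Phi> U (\<chi> i. (\<lambda>x. (\<phi> U s $ i) x + (\<phi> U t $ i) x)) = s \<oplus>\<^bsub>sec G (X \<inter> preimage U)\<^esub> t"
        using \<Phi>_add[OF U in_sections[OF U s] in_sections[OF U t]] \<Phi>_\<phi>[OF U s] \<Phi>_\<phi>[OF U t] by simp
    qed
    show "\<phi> U (restrict_cone (X \<inter> preimage U) (\<lambda>x. r (A *v x)) \<odot>\<^bsub>sec G (X \<inter> preimage U)\<^esub> s) =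
        (\<chi> i. (\<lambda>x. r x * (\<phi> U s $ i) x))"
      if r: "r \<in> twist_sections UNIV 0 U" and s: "s \<in> carrier (sec G (X \<inter> preimage U))" for r s
    proof (rule \<phi>_eqI[OF U])
      show "(\<chi> i. (\<lambda>x. r x * (\<phi> U s $ i) x)) \<in> vsections 0 U"
        using in_sections[OF U s] twist_sections_mult[OF r, of _ 0] by simp
      show "\<Phi> U (\<chi> i. (\<lambda>x. r x * (\<phi> U s $ i) x)) =
          restrict_cone (X \<inter> preimage U) (\<lambda>x. r (A *v x)) \<odot>\<^bsub>sec G (X \<inter> preimage U)\<^esub> s"
        using \<Phi>_smult[OF U r in_sections[OF U s]] \<Phi>_\<phi>[OF U s] by simp
    qed
    show "\<phi> V (res G (X \<inter> preimage U) (X \<inter> preimage V) s) = vrestrict V (\<phi> U s)"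
      if V: "openin zariski V \<and> V \<subseteq> U" and s: "s \<in> carrier (sec G (X \<inter> preimage U))" for V s
    proof (rule \<phi>_eqI)
      show "openin zariski V" using V by simp
      show "vrestrict V (\<phi> U s) \<in> vsections 0 V"
        by (rule vsections_restrict[OF in_sections[OF U s]]) (use V in simp_all)
      show "\<Phi> V (vrestrict V (\<phi> U s)) = res G (X \<inter> preimage U) (X \<inter> preimage V) s"
        using \<Phi>_restrict[OF U _ _ in_sections[OF U s], of V] V \<Phi>_\<phi>[OF U s] by simp
    qed
  qed
  then show ?thesis
    unfolding sheaf_isomorphic_def openin_variety_UNIV carrier_twist_power
      sec_projection_pushforward preim_projection
    using bij by blast
qed

end


section \<open>Linear matrix factorizations\<close>

lemma hpoly_0_constant:
  assumes "hpoly k f" "k = 0"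
  shows "f x = f y"
  using assms by induction auto

lemma hpoly_1_add:
  assumes "hpoly k f" "k = 1"
  shows "f (x + y) = f x + f y"
  using assms
proof induction
  case (hpoly_coord k f i)
  then have "f (x + y) = f x" "f y = f x" using hpoly_0_constant by auto
  then show ?case by (simp add: algebra_simps)
qed auto

definition matrix_eval :: "('v::finite) cpoly^'m^'n \<Rightarrow> complex^'v \<Rightarrow> complex^'m^'n" where
  "matrix_eval a x = (\<chi> i j. peval (a $ i $ j) x)"

lemma matrix_eval_mult: "matrix_eval (a ** b) x = matrix_eval a x ** matrix_eval b x"
  by (simp add: matrix_eval_def matrix_matrix_mult_def peval_sum peval_mult)

lemma matrix_eval_mat: "matrix_eval (mat c) x = mat (peval c x)"
  by (simp add: matrix_eval_def mat_def vec_eq_iff)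

lemma det_mat_nonzero:
  assumes "(c :: complex) \<noteq> 0"
  shows "det (mat c :: complex^'m^'m::finite) \<noteq> 0"
proof -
  have "mat c *v x = c *s x" for x :: "complex^'m"
    by (simp add: vec_eq_iff matrix_vector_nth mat_def if_distrib[of "\<lambda>u. u * _"] cong: if_cong)
  then have "x = 0" if "mat c *v x = 0" for x :: "complex^'m" using that assms by simp
  then have "invertible (mat c :: complex^'m^'m)"
    using invertible_left_inverse matrix_left_invertible_ker by blast
  then show ?thesis by (simp add: invertible_det_nz)
qed

text \<open>Determinants are multiplicative, so an invertible product excludes a singular factor.
  This is applied at the centre, where the product is g(q) times the identity.\<close>

lemma det_matrix_eval_factor:
  fixes as :: "(('v::finite) cpoly^'m^'m::finite) list"
  assumes "a \<in> set as" "det (matrix_eval (foldr (**) as (mat 1)) x) \<noteq> 0"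
  shows "det (matrix_eval a x) \<noteq> 0"
  using assms by (induction as) (auto simp: matrix_eval_mult det_mul)

theorem proposition3p3:
  fixes n d :: nat
    and g :: "('v::finite) cpoly"
    and X :: "'v proj set"
    and \<alpha> :: "('v cpoly^('m::finite)^'m) list"
    and G :: "nat \<Rightarrow> ('v proj, complex^'v \<Rightarrow> complex, 'a) mod_presheaf"
    and Q :: "'v proj"
    and A :: "complex^'v^('w::finite)"
  assumes "CARD('w) = n + 1" and "CARD('v) = n + 2"
    and "homogeneous d g" and "irreducible g"
    and "X = hypersurface g"
    and "linear_matrix_factorization g d \<alpha>"
    and "\<And>i. i < d \<Longrightarrow> sheaf_of_modules (variety X) (G i)"
    and "\<And>i. i < d \<Longrightarrow> \<exists>q. short_exact (variety UNIV)
           (sheaf_power (twist UNIV (-1))) (sheaf_power (twist UNIV 0))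
           (inclusion_pushforward X (G i)) (matrix_hom (\<alpha> ! i)) q"
    and "Q \<notin> X" and "linear_projection Q A"
  shows "\<forall>i<d. sheaf_isomorphic (variety UNIV) (projection_pushforward A X (G i))
           (sheaf_power (twist UNIV 0) :: (_, _, (complex^'w \<Rightarrow> complex)^'m) mod_presheaf)"
proof (intro allI impI)
  fix k assume k: "k < d"
  define q where "q = rep_proj Q"
  have q: "q \<noteq> 0" "abs_proj q = Q" by (simp_all add: q_def rep_proj_nonzero)
  have surj: "surj (\<lambda>x. A *v x)" and ker: "\<And>x. x \<noteq> 0 \<Longrightarrow> A *v x = 0 \<longleftrightarrow> abs_proj x = Q"
    using \<open>linear_projection Q A\<close> by (auto simp: linear_projection_def)
  \<comment> \<open>B is a linear section of the projection; it fixes the point with coordinate 0 on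
    each fibre line.\<close>
  obtain B where "A ** B = mat 1" using surj matrix_right_invertible_surjective[of A] by auto
  then have AB: "A *v (B *v y) = y" for y by (simp add: matrix_vector_mul_assoc)
  obtain i0 where i0: "q $ i0 \<noteq> 0" using q(1) by (auto simp: vec_eq_iff)
  \<comment> \<open>x - B A x lies in the kernel of A and is a multiple of q; the multiple is read
    off at a coordinate where q is nonzero.\<close>
  define \<tau> where "\<tau> x = (1 / q $ i0) * (x $ i0 - ((B ** A) *v x) $ i0)" for x
  have hpoly_\<tau>: "hpoly 1 \<tau>"
    unfolding \<tau>_def[abs_def] by (intro hpoly_cmult hpoly_diff hpoly_linear_coord hpoly_matrix_vector)
  have decomposition: "x = B *v (A *v x) + \<tau> x *s q" for x
  proof -
    let ?r = "x - B *v (A *v x)"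
    have "\<exists>c. ?r = c *s q"
    proof (cases "?r = 0")
      case True
      then show ?thesis by (intro exI[of _ 0]) simp
    next
      case False
      have "A *v ?r = 0" by (simp add: matrix_vector_mult_diff_distrib AB)
      then have "abs_proj q = abs_proj ?r" using ker[OF False] q(2) by simp
      then show ?thesis using abs_proj_eq_iff[OF q(1) False] by blast
    qed
    then obtain c where c: "?r = c *s q" by blast
    then have "\<tau> x = (1 / q $ i0) * (c *s q) $ i0"
      unfolding c[symmetric] by (simp add: \<tau>_def matrix_vector_mul_assoc)
    then have "\<tau> x = c" using i0 by simp
    then show ?thesis using c by (simp add: algebra_simps)
  qed
  define a where "a = \<alpha> ! k"
  have fact: "length \<alpha> = d" "\<And>b i j. b \<in> set \<alpha> \<Longrightarrow> homogeneous 1 (b $ i $ j)"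
    "foldr (**) \<alpha> (mat 1) = mat g"
    using \<open>linear_matrix_factorization g d \<alpha>\<close> by (auto simp: linear_matrix_factorization_def)
  have a: "a \<in> set \<alpha>" using k fact(1) by (simp add: a_def)
  have "peval g q \<noteq> 0"
    using \<open>Q \<notin> X\<close> q unfolding \<open>X = hypersurface g\<close> hypersurface_def by blast
  then have "det (matrix_eval a q) \<noteq> 0"
    using a by (intro det_matrix_eval_factor[of a \<alpha>]) (simp_all add: fact(3) matrix_eval_mat det_mat_nonzero)
  then obtain N where N: "matrix_eval a q ** N = mat 1" "N ** matrix_eval a q = mat 1"
    unfolding invertible_det_nz[symmetric] invertible_def by blast
  have hpoly_a: "hpoly 1 (\<lambda>x. matrix_eval a x $ i $ j)" for i j
    using hpoly_peval[OF fact(2)[OF a]] by (simp add: matrix_eval_def)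
  have a_add: "matrix_eval a (x + c *s q) *v u = matrix_eval a x *v u + c *s (matrix_eval a q *v u)" for x c u
  proof -
    have "matrix_eval a (x + c *s q) $ i $ j = matrix_eval a x $ i $ j + c * matrix_eval a q $ i $ j" for i j
      using hpoly_1_add[OF hpoly_a, of x "c *s q" i j] hpoly_scale[OF hpoly_a, of c q i j] by simp
    then show ?thesis
      by (simp add: vec_eq_iff matrix_vector_nth sum.distrib sum_distrib_left algebra_simps)
  qed
  \<comment> \<open>With y = A x, linearity gives \<alpha>(x) = \<alpha>(B y) + \<tau>(x)
    \<alpha>(q); factoring out M = \<alpha>(q) leaves \<tau> - T.\<close>
  define T where "T y = - (N ** matrix_eval a (B *v y))" for y
  obtain \<psi> where \<psi>: "short_exact (variety UNIV) (sheaf_power (twist UNIV (-1)))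
      (sheaf_power (twist UNIV 0)) (inclusion_pushforward X (G k)) (matrix_hom a) \<psi>"
    using assms(8)[OF k] unfolding a_def by blast
  interpret cokernel_sheaf A B q \<tau> "matrix_eval a q" N T "matrix_eval a" a X "G k" \<psi>
  proof (intro cokernel_sheaf.intro cokernel_sheaf_axioms.intro matrix_coordinates.intro
      matrix_coordinates_axioms.intro projection_coordinates.intro)
    show "A *v q = 0" using ker[OF q(1)] q(2) by simp
    show "matrix_eval a q *v (N *v z) = z" "N *v (matrix_eval a q *v z) = z" for z
      by (simp_all add: matrix_vector_mul_assoc N)
    show "hpoly 1 (\<lambda>y. T y $ i $ j)" for i j
    proof -
      have "hpoly 1 (\<lambda>y. - (\<Sum>l\<in>UNIV. N $ i $ l * matrix_eval a (B *v y) $ l $ j))"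
        by (intro hpoly_uminus hpoly_sum hpoly_cmult hpoly_compose_linear[OF hpoly_a])
      then show ?thesis by (simp add: T_def matrix_matrix_mult_def)
    qed
    show "matrix_eval a x *v u = matrix_eval a q *v (\<tau> x *s u - T (A *v x) *v u)" for x u
    proof -
      have "T (A *v x) *v u = - (N *v (matrix_eval a (B *v (A *v x)) *v u))"
        by (simp add: T_def matrix_vector_mul_assoc vec_eq_iff matrix_vector_nth sum_negf)
      then have "matrix_eval a q *v (\<tau> x *s u - T (A *v x) *v u)
        = \<tau> x *s (matrix_eval a q *v u) + matrix_eval a (B *v (A *v x)) *v u"
        by (simp add: matrix_vector_right_distrib vector_scalar_commute matrix_vector_mul_assoc
            matrix_mul_assoc N)
      also have "\<dots> = matrix_eval a x *v u"
        using a_add[of "B *v (A *v x)" "\<tau> x" u] decomposition[of x] by (simp add: add.commute)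
      finally show ?thesis by simp
    qed
    show "abs_proj q \<notin> X" using q(2) \<open>Q \<notin> X\<close> by simp
    show "sheaf_of_modules (variety X) (G k)" by (rule assms(7)[OF k])
  qed (use AB q hpoly_\<tau> decomposition \<psi> in \<open>simp_all add: matrix_eval_def\<close>)
  show "sheaf_isomorphic (variety UNIV) (projection_pushforward A X (G k))
           (sheaf_power (twist UNIV 0) :: (_, _, (complex^'w \<Rightarrow> complex)^'m) mod_presheaf)"
    by (rule direct_image_trivial)
qed

end
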